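(* Let $f(\nu),g(\nu)$, $\nu\in\mathcal I$, be two differentiable functions with $f(\nu)-g(\nu)\neq0$ and $f'(\nu)g'(\nu)\neq0$, and let $\nu(u,v)$, $(u,v)\in\mathcal D$, be a differentiable function with $\nu_u\nu_v\neq0$ and $\nu(u,v)\in\mathcal I$. Let $(u_0,v_0)\in\mathcal D$, $\nu_0=\nu(u_0,v_0)$, and let $\mathfrak a\neq0$, $\mathfrak b\neq0$ be two constants. If $$\mathfrak a^2\exp\left(2\int_{\nu_0}^{\nu}\frac{f'd\nu}{f-g}\right)\left[g'\nu_{uu}+\left(g''-\frac{2g'^2}{g-f}\right)\nu_u^2\right]+\mathfrak b^2\exp\left(2\int_{\nu_0}^{\nu}\frac{g'd\nu}{g-f}\right)\left[f'\nu_{vv}+\left(f''-\frac{2f'^2}{f-g}\right)\nu_v^2\right]=fg(f-g),$$ then there exists a unique (up to a motion) strongly regular time-like Weingarten surface $\mathcal M:z=z(u,v)$, $(u,v)\in\mathcal D_0\subset\mathcal D$, with invariants $$\nu_1=f(\nu),\quad \nu_2=g(\nu),\quad \gamma_1=\exp\left(\int_{\nu_0}^{\nu}\frac{g'd\nu}{g-f}\right)\frac{-\mathfrak b f'}{f-g}\,\nu_v,\quad \gamma_2=\exp\left(\int_{\nu_0}^{\nu}\frac{f'd\nu}{f-g}\right)\frac{-\mathfrak a g'}{f-g}\,\nu_u.$$ Furthermore, $(u,v)$ are natural principal parameters for $\mathcal M$.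
   Context: $\mathbb R^3_1$ is $\mathbb R^3$ with the flat metric $\langle x,y\rangle=x_1y_1+x_2y_2-x_3y_3$ and standard orientation; all surfaces lie in $\mathbb R^3_1$. Functions are assumed sufficiently smooth. $\mathcal D$ is a domain of parameters $(u,v)$ and $\mathcal D_0\subset\mathcal D$ is a neighborhood of $(u_0,v_0)$. For a time-like surface $z=z(u,v)$ let $l$ be the unit normal field, $\langle l,l\rangle=1$, and $E=\langle z_u,z_u\rangle<0$, $F=\langle z_u,z_v\rangle$, $G=\langle z_v,z_v\rangle>0$, $L=\langle l,z_{uu}\rangle$, $M=\langle l,z_{uv}\rangle$, $N=\langle l,z_{vv}\rangle$. Parameters are principal if $F=M=0$; surfaces are always considered in principal parameters and with distinct real principal curvatures. Set $X=z_u/\sqrt{-E}$, $Y=z_v/\sqrt G$; the frame $XYl$ is positively oriented. The principal curvatures and principal geodesic curvatures are $$\nu_1=\frac LE,\quad \nu_2=\frac NG,\quad \gamma_1=\frac{E_v}{2E\sqrt G},\quad \gamma_2=\frac{-G_u}{2G\sqrt{-E}}.$$ The surface is strongly regular if $(\nu_1-\nu_2)\gamma_1\gamma_2\neq0$ everywhere. It is a Weingarten surface (W-surface) if there are differentiable functions $f(\nu),g(\nu)$, $\nu\in\mathcal I\subseteq\mathbb R$, with $f-g\ne0$, $f'g'\neq0$, and a function $\nu=\nu(u,v)$ such that $\nu_1=f(\nu)$, $\nu_2=g(\nu)$. Principal parameters $(u,v)$ on a Weingarten surface are natural principal if both functions $\sqrt{-E}\,\exp\left(\int\frac{f'd\nu}{f-g}\right)$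 and $\sqrt G\,\exp\left(\int\frac{g'd\nu}{g-f}\right)$ are constant. In the partial differential equation, $f,g,f',g',f'',g''$ and the upper integration limits are evaluated at $\nu=\nu(u,v)$.
   Formalization: The prescribed invariants γ₁, γ₂ are stated with |𝔟| and |𝔞| in place of 𝔟 and 𝔞: the Codazzi equations force 𝔞, 𝔟 > 0, while the equation contains only 𝔞², 𝔟², so existence as written fails for negative constants. *)

theory Defs
  imports "HOL-Analysis.Analysis"
begin

definition Du :: "(real \<times> real \<Rightarrow> 'a::real_normed_vector) \<Rightarrow> real \<times> real \<Rightarrow> 'a" where
  "Du h p = vector_derivative (\<lambda>s. h (s, snd p)) (at (fst p))"

definition Dv :: "(real \<times> real \<Rightarrow> 'a::real_normed_vector) \<Rightarrow> real \<times> real \<Rightarrow> 'a" where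
  "Dv h p = vector_derivative (\<lambda>t. h (fst p, t)) (at (snd p))"

text \<open>\<open>Ck_on k D h\<close> is meant for open \<open>D\<close>, where it says that \<open>h\<close> is of class \<open>C^k\<close>.\<close>

fun Ck_on :: "nat \<Rightarrow> (real \<times> real) set \<Rightarrow> (real \<times> real \<Rightarrow> 'a::real_normed_vector) \<Rightarrow> bool" where
  "Ck_on 0 D h \<longleftrightarrow> continuous_on D h"
| "Ck_on (Suc k) D h \<longleftrightarrow> h differentiable_on D \<and> Ck_on k D (Du h) \<and> Ck_on k D (Dv h)"

definition param_domain :: "(real \<times> real) set \<Rightarrow> bool" where
  "param_domain D \<longleftrightarrow> open D \<and> connected D \<and> D \<noteq> {}"

definition mink :: "real^3 \<Rightarrow> real^3 \<Rightarrow> real" where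
  "mink x y = x $ 1 * y $ 1 + x $ 2 * y $ 2 - x $ 3 * y $ 3"

text \<open>
  Motions are the isometries that preserve the orientation. They may reverse the time
  orientation: all the invariants below are preserved by such motions as well
  (for instance by the linear map with matrix diag(1, -1, -1)).
\<close>

definition motion :: "(real^3 \<Rightarrow> real^3) \<Rightarrow> bool" where
  "motion T \<longleftrightarrow> (\<exists>(A::real^3^3) c. (\<forall>x y. mink (A *v x) (A *v y) = mink x y) \<and> det A = 1 \<and>
     (\<forall>x. T x = A *v x + c))"

definition cE :: "(real \<times> real \<Rightarrow> real^3) \<Rightarrow> real \<times> real \<Rightarrow> real" where
  "cE z p = mink (Du z p) (Du z p)"

definition cF :: "(real \<times> real \<Rightarrow> real^3) \<Rightarrow> real \<times> real \<Rightarrow> real" where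
  "cF z p = mink (Du z p) (Dv z p)"

definition cG :: "(real \<times> real \<Rightarrow> real^3) \<Rightarrow> real \<times> real \<Rightarrow> real" where
  "cG z p = mink (Dv z p) (Dv z p)"

definition frameX :: "(real \<times> real \<Rightarrow> real^3) \<Rightarrow> real \<times> real \<Rightarrow> real^3" where
  "frameX z p = Du z p /\<^sub>R sqrt (- cE z p)"

definition frameY :: "(real \<times> real \<Rightarrow> real^3) \<Rightarrow> real \<times> real \<Rightarrow> real^3" where
  "frameY z p = Dv z p /\<^sub>R sqrt (cG z p)"

text \<open>
  Where \<open>E < 0 < G\<close> the tangent plane is Lorentzian, so exactly two vectors are normal and of
  unit length; the orientation of the frame selects one of them.
\<close>

definition unit_normal :: "(real \<times> real \<Rightarrow> real^3) \<Rightarrow> real \<times> real \<Rightarrow> real^3" where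
  "unit_normal z p = (THE l. mink l l = 1 \<and> mink l (Du z p) = 0 \<and> mink l (Dv z p) = 0 \<and>
     det (vector [frameX z p, frameY z p, l] :: real^3^3) > 0)"

definition cL :: "(real \<times> real \<Rightarrow> real^3) \<Rightarrow> real \<times> real \<Rightarrow> real" where
  "cL z p = mink (unit_normal z p) (Du (Du z) p)"

definition cM :: "(real \<times> real \<Rightarrow> real^3) \<Rightarrow> real \<times> real \<Rightarrow> real" where
  "cM z p = mink (unit_normal z p) (Dv (Du z) p)"

definition cN :: "(real \<times> real \<Rightarrow> real^3) \<Rightarrow> real \<times> real \<Rightarrow> real" where
  "cN z p = mink (unit_normal z p) (Dv (Dv z) p)"

definition nu1 :: "(real \<times> real \<Rightarrow> real^3) \<Rightarrow> real \<times> real \<Rightarrow> real" where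
  "nu1 z p = cL z p / cE z p"

definition nu2 :: "(real \<times> real \<Rightarrow> real^3) \<Rightarrow> real \<times> real \<Rightarrow> real" where
  "nu2 z p = cN z p / cG z p"

text \<open>
  The square roots in the following definitions are positive. The Codazzi equations therefore
  fix the signs: \<open>gamma1\<close> has the sign of \<open>- (nu1)_v / (nu1 - nu2)\<close> and
  \<open>gamma2\<close> has the sign of \<open>- (nu2)_u / (nu1 - nu2)\<close>. Consequently \<open>has_invariants\<close>
  below can hold (where \<open>\<nu>_u\<close>, \<open>\<nu>_v\<close>, \<open>f'\<close>, \<open>g'\<close>, \<open>f - g\<close> do not vanish) only for
  positive \<open>a\<close> and \<open>b\<close>; constants of arbitrary sign enter it through their absolute values.
\<close>

definition gamma1 :: "(real \<times> real \<Rightarrow> real^3) \<Rightarrow> real \<times> real \<Rightarrow> real" where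
  "gamma1 z p = Dv (cE z) p / (2 * cE z p * sqrt (cG z p))"

definition gamma2 :: "(real \<times> real \<Rightarrow> real^3) \<Rightarrow> real \<times> real \<Rightarrow> real" where
  "gamma2 z p = - Du (cG z) p / (2 * cG z p * sqrt (- cE z p))"

text \<open>
  Surfaces are regular parametrized surfaces of class \<open>C^3\<close>; regularity follows
  from \<open>E < 0 < G\<close>, and injectivity is not required.
\<close>

definition timelike_surface :: "(real \<times> real) set \<Rightarrow> (real \<times> real \<Rightarrow> real^3) \<Rightarrow> bool" where
  "timelike_surface D z \<longleftrightarrow> param_domain D \<and> Ck_on 3 D z \<and> (\<forall>p\<in>D. cE z p < 0 \<and> cG z p > 0)"

definition principal_params :: "(real \<times> real) set \<Rightarrow> (real \<times> real \<Rightarrow> real^3) \<Rightarrow> bool" where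
  "principal_params D z \<longleftrightarrow> (\<forall>p\<in>D. cF z p = 0 \<and> cM z p = 0)"

definition strongly_regular :: "(real \<times> real) set \<Rightarrow> (real \<times> real \<Rightarrow> real^3) \<Rightarrow> bool" where
  "strongly_regular D z \<longleftrightarrow> (\<forall>p\<in>D. (nu1 z p - nu2 z p) * gamma1 z p * gamma2 z p \<noteq> 0)"

text \<open>
  \<open>f'\<close> and \<open>g'\<close> are the derivatives of \<open>f\<close> and \<open>g\<close> (one-sided at
  end points that belong to the interval \<open>I\<close>).
\<close>

definition weingarten_via ::
  "real set \<Rightarrow> (real \<Rightarrow> real) \<Rightarrow> (real \<Rightarrow> real) \<Rightarrow> (real \<Rightarrow> real) \<Rightarrow> (real \<Rightarrow> real) \<Rightarrow>
   (real \<times> real \<Rightarrow> real) \<Rightarrow> (real \<times> real) set \<Rightarrow> (real \<times> real \<Rightarrow> real^3) \<Rightarrow> bool" where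
  "weingarten_via I f f' g g' \<nu> D z \<longleftrightarrow>
     is_interval I \<and>
     (\<forall>t\<in>I. (f has_real_derivative f' t) (at t within I) \<and>
             (g has_real_derivative g' t) (at t within I)) \<and>
     continuous_on I f' \<and> continuous_on I g' \<and>
     (\<forall>t\<in>I. f t - g t \<noteq> 0 \<and> f' t * g' t \<noteq> 0) \<and>
     Ck_on 1 D \<nu> \<and> \<nu> ` D \<subseteq> I \<and>
     (\<forall>p\<in>D. nu1 z p = f (\<nu> p) \<and> nu2 z p = g (\<nu> p))"

definition weingarten_surface :: "(real \<times> real) set \<Rightarrow> (real \<times> real \<Rightarrow> real^3) \<Rightarrow> bool" where
  "weingarten_surface D z \<longleftrightarrow> timelike_surface D z \<and> principal_params D z \<and>
     (\<exists>I f f' g g' \<nu>. weingarten_via I f f' g g' \<nu> D z)"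

text \<open>
  The lower limit \<open>c\<close> of the integrals is arbitrary: changing it multiplies both functions
  by non-zero constants.
\<close>

definition natural_principal_params ::
  "real set \<Rightarrow> (real \<Rightarrow> real) \<Rightarrow> (real \<Rightarrow> real) \<Rightarrow> (real \<Rightarrow> real) \<Rightarrow> (real \<Rightarrow> real) \<Rightarrow>
   (real \<times> real \<Rightarrow> real) \<Rightarrow> (real \<times> real) set \<Rightarrow> (real \<times> real \<Rightarrow> real^3) \<Rightarrow> bool" where
  "natural_principal_params I f f' g g' \<nu> D z \<longleftrightarrow>
     principal_params D z \<and> weingarten_via I f f' g g' \<nu> D z \<and>
     (\<forall>c\<in>I.
       (\<lambda>p. sqrt (- cE z p) * exp (LBINT t=c..\<nu> p. f' t / (f t - g t))) constant_on D \<and>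
       (\<lambda>p. sqrt (cG z p) * exp (LBINT t=c..\<nu> p. g' t / (g t - f t))) constant_on D)"

definition has_invariants ::
  "(real \<Rightarrow> real) \<Rightarrow> (real \<Rightarrow> real) \<Rightarrow> (real \<Rightarrow> real) \<Rightarrow> (real \<Rightarrow> real) \<Rightarrow>
   (real \<times> real \<Rightarrow> real) \<Rightarrow> real \<Rightarrow> real \<Rightarrow> real \<Rightarrow>
   (real \<times> real) set \<Rightarrow> (real \<times> real \<Rightarrow> real^3) \<Rightarrow> bool" where
  "has_invariants f f' g g' \<nu> \<nu>0 a b D z \<longleftrightarrow>
     (\<forall>p\<in>D.
       nu1 z p = f (\<nu> p) \<and>
       nu2 z p = g (\<nu> p) \<and>
       gamma1 z p = exp (LBINT t=\<nu>0..\<nu> p. g' t / (g t - f t)) *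
         (- b * f' (\<nu> p) / (f (\<nu> p) - g (\<nu> p))) * Dv \<nu> p \<and>
       gamma2 z p = exp (LBINT t=\<nu>0..\<nu> p. f' t / (f t - g t)) *
         (- a * g' (\<nu> p) / (f (\<nu> p) - g (\<nu> p))) * Du \<nu> p)"

end

theory Submission
  imports Defs
begin

text \<open>
  Write \<open>P = sqrt (- E)\<close>, \<open>Q = sqrt G\<close>. In principal parameters the frame satisfies
  \<open>X_u = P \<gamma>1 Y - P \<nu>1 l\<close>, \<open>Y_u = P \<gamma>1 X\<close>, \<open>l_u = - P \<nu>1 X\<close>,
  \<open>X_v = - Q \<gamma>2 Y\<close>, \<open>Y_v = Q \<nu>2 l - Q \<gamma>2 X\<close>, \<open>l_v = - Q \<nu>2 Y\<close>,
  together with \<open>z_u = P X\<close>, \<open>z_v = Q Y\<close>. The Codazzi equations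
  \<open>(\<nu>1)_v = - (\<nu>1 - \<nu>2) Q \<gamma>1\<close>, \<open>(\<nu>2)_u = - (\<nu>1 - \<nu>2) P \<gamma>2\<close> then turn the prescribed
  invariants into \<open>P = exp (- \<integral> f' / (f - g)) / \<bar>a\<bar>\<close> and \<open>Q = exp (- \<integral> g' / (g - f)) / \<bar>b\<bar>\<close>.
  Hence the parameters are natural principal, and two surfaces with these invariants have frames
  that solve the same linear system; the linear map that takes one frame to the other is constant.
  Conversely, with these \<open>P\<close> and \<open>Q\<close> the Codazzi equations hold identically and the Gauss equation is
  the given partial differential equation, so the linear system is integrable near the given point.
\<close>

section \<open>Functions of two real variables of class \<open>C^k\<close>\<close>

text \<open>Two obstacles shape the proof. The first is regularity. As \<open>\<nu>\<close> is only
  C^2, the coefficients of the linear system are C^1, so integrability has to be proved for C^1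
  coefficients and gives a C^2 frame; \<open>z\<close> is nevertheless C^3, because
  \<open>z_u = P X\<close> and \<open>z_v = Q Y\<close> with \<open>P\<close>, \<open>Q\<close> of
  class C^2. In the opposite direction, the Codazzi equations need second derivatives of the normal,
  and the equations \<open>l_u = - \<nu>1 z_u\<close>, \<open>l_v = - \<nu>2 z_v\<close> supply
  them. The second is the shape of the Gauss equation. With \<open>k = P \<gamma>1\<close> and
  \<open>m = Q \<gamma>2\<close> it reads \<open>k_v + m_u + \<nu>1 \<nu>2 P Q = 0\<close>, where
  \<open>k = P_v / Q\<close> and \<open>m = - Q_u / P\<close> are a first derivative of
  \<open>\<nu>\<close> times a function of \<open>\<nu>\<close>. When that function is
  differentiated, the terms with \<open>g'\<close> (for \<open>m\<close>, those with
  \<open>f'\<close>) cancel; this is the origin of the coefficients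
  \<open>f'' - 2 f'^2 / (f - g)\<close> and \<open>g'' - 2 g'^2 / (g - f)\<close> in the partial
  differential equation.\<close>

definition partials ::
  "(real \<times> real) set \<Rightarrow> (real \<times> real \<Rightarrow> 'a::real_normed_vector) \<Rightarrow>
   (real \<times> real \<Rightarrow> 'a) \<Rightarrow> (real \<times> real \<Rightarrow> 'a) \<Rightarrow> bool" where
  "partials D h hu hv \<longleftrightarrow> (\<forall>p\<in>D.
     ((\<lambda>s. h (s, snd p)) has_vector_derivative hu p) (at (fst p)) \<and>
     ((\<lambda>t. h (fst p, t)) has_vector_derivative hv p) (at (snd p)))"

lemma partials_Du: "partials D h hu hv \<Longrightarrow> p \<in> D \<Longrightarrow> Du h p = hu p"
  unfolding partials_def Du_def by (auto intro: vector_derivative_at)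

lemma partials_Dv: "partials D h hu hv \<Longrightarrow> p \<in> D \<Longrightarrow> Dv h p = hv p"
  unfolding partials_def Dv_def by (auto intro: vector_derivative_at)

lemma partials_within_u:
  "partials D h hu hv \<Longrightarrow> (s, t) \<in> D \<Longrightarrow> ((\<lambda>s. h (s, t)) has_vector_derivative hu (s, t)) (at s within S)"
  unfolding partials_def by (drule bspec, assumption) (simp add: has_vector_derivative_at_within)

lemma partials_within_v:
  "partials D h hu hv \<Longrightarrow> (s, t) \<in> D \<Longrightarrow> ((\<lambda>t. h (s, t)) has_vector_derivative hv (s, t)) (at t within S)"
  unfolding partials_def by (drule bspec, assumption) (simp add: has_vector_derivative_at_within)

lemma partials_subset: "partials D h hu hv \<Longrightarrow> C \<subseteq> D \<Longrightarrow> partials C h hu hv"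
  unfolding partials_def by blast

lemma partials_eq_rhs:
  "partials D h hu hv \<Longrightarrow> (\<And>p. p \<in> D \<Longrightarrow> hu p = hu' p) \<Longrightarrow> (\<And>p. p \<in> D \<Longrightarrow> hv p = hv' p)
    \<Longrightarrow> partials D h hu' hv'"
  unfolding partials_def by simp

lemma open_section_u:
  assumes "open (D :: (real \<times> real) set)" "p \<in> D"
  shows "\<forall>\<^sub>F s in nhds (fst p). (s, snd p) \<in> D"
proof -
  have "((\<lambda>s. (s, snd p)) \<longlongrightarrow> (fst p, snd p)) (nhds (fst p))"
    by (intro tendsto_Pair filterlim_ident tendsto_const)
  then have "((\<lambda>s. (s, snd p)) \<longlongrightarrow> p) (nhds (fst p))" by simp
  from topological_tendstoD[OF this assms] show ?thesis .
qed

lemma open_section_v: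
  assumes "open (D :: (real \<times> real) set)" "p \<in> D"
  shows "\<forall>\<^sub>F t in nhds (snd p). (fst p, t) \<in> D"
proof -
  have "((\<lambda>t. (fst p, t)) \<longlongrightarrow> (fst p, snd p)) (nhds (snd p))"
    by (intro tendsto_Pair filterlim_ident tendsto_const)
  then have "((\<lambda>t. (fst p, t)) \<longlongrightarrow> p) (nhds (snd p))" by simp
  from topological_tendstoD[OF this assms] show ?thesis .
qed

lemma has_vector_derivative_cong_nhds:
  assumes "\<forall>\<^sub>F s in nhds x. f s = g s" "(f has_vector_derivative d) (at x)"
  shows "(g has_vector_derivative d) (at x)"
proof -
  obtain S where "open S" "x \<in> S" "\<And>s. s \<in> S \<Longrightarrow> f s = g s"
    using assms(1) unfolding eventually_nhds by blast
  with assms(2) show ?thesis by (rule has_vector_derivative_transform_within_open)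
qed

text \<open>Openness of \<open>D\<close> makes the values on \<open>D\<close> determine the
  derivatives along both coordinate lines through a point of \<open>D\<close>.\<close>

lemma partials_cong:
  assumes "open D" "\<And>p. p \<in> D \<Longrightarrow> h p = h' p" "partials D h hu hv"
  shows "partials D h' hu hv"
  unfolding partials_def
proof (intro ballI conjI)
  fix p assume p: "p \<in> D"
  show "((\<lambda>s. h' (s, snd p)) has_vector_derivative hu p) (at (fst p))"
  proof (rule has_vector_derivative_cong_nhds)
    show "\<forall>\<^sub>F s in nhds (fst p). h (s, snd p) = h' (s, snd p)"
      using open_section_u[OF assms(1) p] by (rule eventually_mono) (rule assms(2))
    show "((\<lambda>s. h (s, snd p)) has_vector_derivative hu p) (at (fst p))"
      using assms(3) p unfolding partials_def by blast
  qed
  show "((\<lambda>t. h' (fst p, t)) has_vector_derivative hv p) (at (snd p))"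
  proof (rule has_vector_derivative_cong_nhds)
    show "\<forall>\<^sub>F t in nhds (snd p). h (fst p, t) = h' (fst p, t)"
      using open_section_v[OF assms(1) p] by (rule eventually_mono) (rule assms(2))
    show "((\<lambda>t. h (fst p, t)) has_vector_derivative hv p) (at (snd p))"
      using assms(3) p unfolding partials_def by blast
  qed
qed

lemma differentiable_on_partials:
  assumes "open D" "h differentiable_on D"
  shows "partials D h (Du h) (Dv h)"
  unfolding partials_def
proof (intro ballI conjI)
  fix p assume p: "p \<in> D"
  then have "h differentiable at p" using assms
    by (metis at_within_open differentiable_on_def)
  then have dp: "h differentiable at (fst p, snd p)" by simp
  have "(\<lambda>s. (s, snd p)) differentiable at (fst p)" "(\<lambda>t. (fst p, t)) differentiable at (snd p)"
    unfolding differentiable_def by (rule exI, rule derivative_intros, (rule derivative_intros)+)+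
  then have "h \<circ> (\<lambda>s. (s, snd p)) differentiable at (fst p)" "h \<circ> (\<lambda>t. (fst p, t)) differentiable at (snd p)"
    using dp by (auto intro!: differentiable_chain_at)
  then show "((\<lambda>s. h (s, snd p)) has_vector_derivative Du h p) (at (fst p))"
    "((\<lambda>t. h (fst p, t)) has_vector_derivative Dv h p) (at (snd p))"
    unfolding Du_def Dv_def o_def by (simp_all add: vector_derivative_works[symmetric])
qed

text \<open>Continuity of \<open>hv\<close> makes the mean value estimate in the direction
  \<open>v\<close> uniform near \<open>p\<close>; in the direction \<open>u\<close>,
  differentiability at \<open>p\<close> itself suffices. This turns the coordinatewise relation
  \<open>partials\<close> into the total differentiability that \<open>Ck_on\<close>
  demands.\<close>

lemma partials_has_derivative:
  assumes "open D" "partials D h hu hv" "continuous_on D hv" "p \<in> D"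
  shows "(h has_derivative (\<lambda>q. fst q *\<^sub>R hu p + snd q *\<^sub>R hv p)) (at p)"
proof -
  obtain a b where ab: "open a" "open b" "p \<in> a \<times> b" "a \<times> b \<subseteq> D"
    using assms(1,4) by (rule open_prod_elim)
  obtain e where e: "e > 0" "ball (snd p) e \<subseteq> b"
    using ab by (metis mem_Times_iff openE)
  \<comment> \<open>The mean value estimate runs along the second factor, which therefore has to be
    convex.\<close>
  define B where "B = ball (snd p) e"
  have sub: "a \<times> B \<subseteq> D" using ab e unfolding B_def by auto
  have pa: "fst p \<in> a" "snd p \<in> B" using ab e B_def by (auto simp: mem_Times_iff)
  have "((\<lambda>(x, y). curry h x y) has_derivative (\<lambda>(tx, ty). tx *\<^sub>R hu p + blinfun_apply (blinfun_scaleR_left (hv (fst p, snd p))) ty)) (at (fst p, snd p) within a \<times> B)"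
  proof (rule has_derivative_partialsI[where fy = "\<lambda>x y. blinfun_scaleR_left (hv (x, y))"])
    have "((\<lambda>x. h (x, snd p)) has_vector_derivative hu p) (at (fst p))"
      using assms unfolding partials_def by auto
    then show "((\<lambda>x. curry h x (snd p)) has_derivative (\<lambda>tx. tx *\<^sub>R hu p)) (at (fst p) within a)"
      unfolding has_vector_derivative_def by (auto intro: has_derivative_at_withinI)
    show "((\<lambda>y. curry h x y) has_derivative blinfun_apply (blinfun_scaleR_left (hv (x, y)))) (at y within B)" if "x \<in> a" "y \<in> B" for x y
    proof -
      have "((\<lambda>t. h (x, t)) has_vector_derivative hv (x,y)) (at y)"
        using assms(2) sub that unfolding partials_def by force
      then show ?thesis unfolding has_vector_derivative_def by (auto intro: has_derivative_at_withinI)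
    qed
    have "continuous_on (a \<times> B) (\<lambda>q. blinfun_scaleR_left (hv q))"
      by (intro continuous_intros continuous_on_subset[OF assms(3) sub])
    then show "continuous (at (fst p, snd p) within a \<times> B) (\<lambda>(x, y). blinfun_scaleR_left (hv (x, y)))"
      using pa mem_Times_iff[of p a B] unfolding continuous_on_eq_continuous_within case_prod_beta' prod.collapse by blast
    show "snd p \<in> B" "convex B" using pa by (auto simp: B_def)
  qed
  then have "(h has_derivative (\<lambda>q. fst q *\<^sub>R hu p + snd q *\<^sub>R hv p)) (at p within a \<times> B)"
    by (simp add: case_prod_beta')
  moreover have "open (a \<times> B)" using ab by (auto intro: open_Times simp: B_def)
  ultimately show ?thesis using pa at_within_open[of p "a \<times> B"] by (simp add: mem_Times_iff)
qed

lemma partials_differentiable_on: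
  assumes "open D" "partials D h hu hv" "continuous_on D hv"
  shows "h differentiable_on D"
  using partials_has_derivative[OF assms] unfolding differentiable_on_def differentiable_def
  by (meson has_derivative_at_withinI)

lemma partials_zero_imp_const:
  assumes "open D" "connected D" "partials D h (\<lambda>_. 0) (\<lambda>_. 0)" "p \<in> D" "q \<in> D"
  shows "h p = h q"
  using has_derivative_zero_unique_connected[OF assms(1,2) _ assms(4,5), of h]
    partials_has_derivative[OF assms(1,3)] by simp

section \<open>The classes C^k\<close>

lemma Ck_on_cong:
  assumes "open D" "\<And>p. p \<in> D \<Longrightarrow> h p = h' p" "Ck_on k D h"
  shows "Ck_on k D h'"
  using assms(2,3)
proof (induction k arbitrary: h h')
  case 0
  then show ?case using continuous_on_cong[of D D h h'] by simp
next
  case (Suc k)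
  have "partials D h (Du h) (Dv h)"
    using Suc.prems assms(1) by (intro differentiable_on_partials) auto
  then have *: "partials D h' (Du h) (Dv h)" using Suc.prems assms(1) partials_cong by blast
  then have "Du h p = Du h' p" "Dv h p = Dv h' p" if "p \<in> D" for p
    using partials_Du[OF * that] partials_Dv[OF * that] by simp_all
  then have "Ck_on k D (Du h')" "Ck_on k D (Dv h')" 
    using Suc.IH[of "Du h"] Suc.IH[of "Dv h"] Suc.prems(2) by simp_all
  moreover have "h' differentiable_on D"
    using Suc.prems differentiable_on_def
    by (metis Ck_on.simps(2) differentiable_transform_within zero_less_one)
  ultimately show ?case by simp
qed

lemma Ck_on_imp_continuous_on: "Ck_on k D h \<Longrightarrow> continuous_on D h"
  by (cases k) (auto intro: differentiable_imp_continuous_on)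

lemma Ck_on_Suc_partials: "open D \<Longrightarrow> Ck_on (Suc k) D h \<Longrightarrow> partials D h (Du h) (Dv h)"
  by (auto intro: differentiable_on_partials)

text \<open>\<open>Du\<close> and \<open>Dv\<close> carry information only where a derivative
  exists. Here the partial derivatives are given by formulas, typically the right-hand sides of a
  differential system, and smoothness is raised by one order from them.\<close>

lemma Ck_on_SucI:
  assumes "open D" "partials D h hu hv" "Ck_on k D hu" "Ck_on k D hv"
  shows "Ck_on (Suc k) D h"
proof -
  have "h differentiable_on D"
    using assms by (intro partials_differentiable_on Ck_on_imp_continuous_on)
  moreover have "Ck_on k D (Du h)" "Ck_on k D (Dv h)"
    using assms(3,4) partials_Du[OF assms(2)] partials_Dv[OF assms(2)]
    by (auto intro: Ck_on_cong[OF assms(1)])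
  ultimately show ?thesis by simp
qed

lemma Ck_on_SucD: "Ck_on (Suc k) D h \<Longrightarrow> Ck_on k D h"
proof (induction k arbitrary: h)
  case 0
  then show ?case using Ck_on_imp_continuous_on[of 1] by simp
next
  case (Suc k)
  then show ?case by (metis Ck_on.simps(2))
qed

lemma Ck_on_mono: "Ck_on k D h \<Longrightarrow> j \<le> k \<Longrightarrow> Ck_on j D h"
proof (induction k)
  case (Suc k)
  then show ?case using Ck_on_SucD[OF Suc.prems(1)] by (cases "j = Suc k") simp_all
qed simp

lemma Ck_on_subset:
  "open C \<Longrightarrow> C \<subseteq> D \<Longrightarrow> Ck_on k D h \<Longrightarrow> Ck_on k C h"
proof (induction k arbitrary: h)
  case (Suc k)
  then show ?case using differentiable_on_subset[of h D C] by simp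
qed (simp add: continuous_on_subset)

section \<open>Calculus rules for partial derivatives and C^k functions\<close>

lemma partials_const: "partials D (\<lambda>_. c) (\<lambda>_. 0) (\<lambda>_. 0)"
  unfolding partials_def by auto

lemma partials_add:
  "partials D h hu hv \<Longrightarrow> partials D k ku kv \<Longrightarrow>
   partials D (\<lambda>p. h p + k p) (\<lambda>p. hu p + ku p) (\<lambda>p. hv p + kv p)"
  unfolding partials_def by (simp add: has_vector_derivative_add)

lemma partials_diff:
  "partials D h hu hv \<Longrightarrow> partials D k ku kv \<Longrightarrow>
   partials D (\<lambda>p. h p - k p) (\<lambda>p. hu p - ku p) (\<lambda>p. hv p - kv p)"
  unfolding partials_def by (simp add: has_vector_derivative_diff)

lemma partials_bilinear:
  assumes "bounded_bilinear B" "partials D h hu hv" "partials D k ku kv"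
  shows "partials D (\<lambda>p. B (h p) (k p)) (\<lambda>p. B (h p) (ku p) + B (hu p) (k p)) (\<lambda>p. B (h p) (kv p) + B (hv p) (k p))"
  unfolding partials_def
proof (intro ballI conjI)
  fix p assume p: "p \<in> D"
  show "((\<lambda>s. B (h (s, snd p)) (k (s, snd p))) has_vector_derivative B (h p) (ku p) + B (hu p) (k p)) (at (fst p))"
    using bounded_bilinear.has_vector_derivative[OF assms(1), of "\<lambda>s. h (s, snd p)" "hu p" "fst p" UNIV "\<lambda>s. k (s, snd p)" "ku p"]
      assms(2,3) p unfolding partials_def by simp
  show "((\<lambda>t. B (h (fst p, t)) (k (fst p, t))) has_vector_derivative B (h p) (kv p) + B (hv p) (k p)) (at (snd p))"
    using bounded_bilinear.has_vector_derivative[OF assms(1), of "\<lambda>s. h (fst p, s)" "hv p" "snd p" UNIV "\<lambda>s. k (fst p, s)" "kv p"]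
      assms(2,3) p unfolding partials_def by simp
qed

lemma partials_linear:
  assumes "bounded_linear L" "partials D h hu hv"
  shows "partials D (\<lambda>p. L (h p)) (\<lambda>p. L (hu p)) (\<lambda>p. L (hv p))"
  using assms bounded_linear.has_vector_derivative[OF assms(1)] unfolding partials_def by blast

text \<open>\<open>S\<close> may be an interval that contains its end points: \<open>h\<close> maps
  \<open>D\<close> into \<open>S\<close>, so its increments stay in \<open>S\<close> and a
  derivative of \<open>\<phi>\<close> within \<open>S\<close> is enough.\<close>

lemma partials_chain:
  assumes "\<And>t. t \<in> S \<Longrightarrow> (\<phi> has_real_derivative \<phi>' t) (at t within S)"
    and "partials D h hu hv" "open D" "h ` D \<subseteq> S"
  shows "partials D (\<lambda>p. \<phi> (h p)) (\<lambda>p. \<phi>' (h p) * hu p) (\<lambda>p. \<phi>' (h p) * hv p)"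
  unfolding partials_def
proof (intro ballI conjI)
  fix p assume p: "p \<in> D"
  then have d: "((\<lambda>s. h (s, snd p)) has_vector_derivative hu p) (at (fst p))"
    "((\<lambda>t. h (fst p, t)) has_vector_derivative hv p) (at (snd p))"
    using assms(2) unfolding partials_def by auto
  have \<phi>: "(\<phi> has_real_derivative \<phi>' (h p)) (at (h p) within S)" using assms p by auto
  obtain A where A: "open A" "fst p \<in> A" "\<And>s. s \<in> A \<Longrightarrow> (s, snd p) \<in> D"
    using open_section_u[OF assms(3) p] unfolding eventually_nhds by auto
  have "(\<phi> \<circ> (\<lambda>s. h (s, snd p)) has_vector_derivative (hu p * \<phi>' (h p))) (at (fst p) within A)"
    using d(1) DERIV_subset[OF \<phi>, of "(\<lambda>s. h (s, snd p)) ` A"] A(3) assms(4)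
    by (intro field_vector_diff_chain_within[THEN has_vector_derivative_eq_rhs])
      (auto intro: has_vector_derivative_at_within)
  then show "((\<lambda>s. \<phi> (h (s, snd p))) has_vector_derivative \<phi>' (h p) * hu p) (at (fst p))"
    unfolding at_within_open[OF A(2,1)] by (simp add: o_def mult.commute)
  obtain A where A: "open A" "snd p \<in> A" "\<And>s. s \<in> A \<Longrightarrow> (fst p, s) \<in> D"
    using open_section_v[OF assms(3) p] unfolding eventually_nhds by auto
  have "(\<phi> \<circ> (\<lambda>t. h (fst p, t)) has_vector_derivative (hv p * \<phi>' (h p))) (at (snd p) within A)"
    using d(2) DERIV_subset[OF \<phi>, of "(\<lambda>s. h (fst p, s)) ` A"] A(3) assms(4)
    by (intro field_vector_diff_chain_within[THEN has_vector_derivative_eq_rhs])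
      (auto intro: has_vector_derivative_at_within)
  then show "((\<lambda>t. \<phi> (h (fst p, t))) has_vector_derivative \<phi>' (h p) * hv p) (at (snd p))"
    unfolding at_within_open[OF A(2,1)] by (simp add: o_def mult.commute)
qed

lemma Ck_on_const: "open D \<Longrightarrow> Ck_on k D (\<lambda>_. c)"
proof (induction k arbitrary: c)
  case (Suc k)
  then show ?case using Ck_on_SucI[OF _ partials_const] by blast
qed auto

lemma Ck_on_add: "open D \<Longrightarrow> Ck_on k D h \<Longrightarrow> Ck_on k D g \<Longrightarrow> Ck_on k D (\<lambda>p. h p + g p)"
proof (induction k arbitrary: h g)
  case (Suc k)
  show ?case
    by (rule Ck_on_SucI[OF Suc.prems(1) partials_add[OF Ck_on_Suc_partials Ck_on_Suc_partials]])
      (use Suc in auto)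
qed (auto intro: continuous_intros)

lemma Ck_on_linear:
  assumes "open D" "bounded_linear L"
  shows "Ck_on k D h \<Longrightarrow> Ck_on k D (\<lambda>p. L (h p))"
proof (induction k arbitrary: h)
  case 0
  then show ?case using assms by (auto intro: bounded_linear.continuous_on)
next
  case (Suc k)
  show ?case
    by (rule Ck_on_SucI[OF assms(1) partials_linear[OF assms(2) Ck_on_Suc_partials]])
      (use Suc assms(1) in auto)
qed

lemma Ck_on_bilinear:
  assumes "open D" "bounded_bilinear B"
  shows "Ck_on k D h \<Longrightarrow> Ck_on k D g \<Longrightarrow> Ck_on k D (\<lambda>p. B (h p) (g p))"
proof (induction k arbitrary: h g)
  case 0
  then show ?case using assms by (auto intro: bounded_bilinear.continuous_on)
next
  case (Suc k)
  show ?case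
    by (rule Ck_on_SucI[OF assms(1) partials_bilinear[OF assms(2) Ck_on_Suc_partials Ck_on_Suc_partials]])
      (use Suc assms(1) in \<open>auto intro!: Ck_on_add Suc.IH dest: Ck_on_SucD simp del: Ck_on.simps(2)\<close>,
       auto)
qed

lemmas Ck_on_mult = Ck_on_bilinear[OF _ bounded_bilinear_mult]
lemmas Ck_on_scaleR = Ck_on_bilinear[OF _ bounded_bilinear_scaleR]

lemma Ck_on_1_chain:
  assumes "\<And>t. t \<in> S \<Longrightarrow> (\<phi> has_real_derivative \<phi>' t) (at t within S)" "continuous_on S \<phi>'"
    and "open D" "Ck_on 1 D h" "h ` D \<subseteq> S"
  shows "Ck_on 1 D (\<lambda>p. \<phi> (h p))"
proof -
  have "continuous_on D (\<lambda>p. \<phi>' (h p))"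
    using continuous_on_compose2[OF assms(2) _ assms(5)] assms(4) Ck_on_imp_continuous_on by blast
  then show ?thesis unfolding One_nat_def
    by (intro Ck_on_SucI[OF assms(3) partials_chain[OF assms(1) Ck_on_Suc_partials[OF assms(3), of 0] assms(3,5)]])
     (use assms(4) in \<open>auto intro!: continuous_intros\<close>)
qed

section \<open>Equality of mixed derivatives\<close>

lemma open_imp_square_subset:
  assumes "open (D :: (real \<times> real) set)" "(u0, v0) \<in> D"
  obtains R where "R > 0" "{u0 - R..u0 + R} \<times> {v0 - R..v0 + R} \<subseteq> D"
proof -
  obtain A B where AB: "open A" "open B" "(u0, v0) \<in> A \<times> B" "A \<times> B \<subseteq> D"
    using assms by (rule open_prod_elim)
  obtain e1 where e1: "e1 > 0" "cball u0 e1 \<subseteq> A"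
    using AB(1,3) open_contains_cball[of A] by auto
  obtain e2 where e2: "e2 > 0" "cball v0 e2 \<subseteq> B"
    using AB(2,3) open_contains_cball[of B] by auto
  have "{u0 - min e1 e2..u0 + min e1 e2} \<times> {v0 - min e1 e2..v0 + min e1 e2} \<subseteq> cball u0 e1 \<times> cball v0 e2"
    unfolding cball_eq_atLeastAtMost by (intro Sigma_mono) auto
  then have "{u0 - min e1 e2..u0 + min e1 e2} \<times> {v0 - min e1 e2..v0 + min e1 e2} \<subseteq> D"
    using Sigma_mono[OF e1(2) e2(2)] AB(4) by (meson order_trans)
  then show thesis using that[of "min e1 e2"] e1 e2 by simp
qed

text \<open>The values lie in a Banach space, so integrals take the place of the mean value theorem:
  \<open>h (u, v) - h (u0 - R, v)\<close> is the integral of \<open>h_u\<close>, and differentiating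
  it first in \<open>v\<close> under the integral sign and then in the upper end \<open>u\<close>
  identifies the two mixed derivatives.\<close>

lemma Dv_Du_eq_Du_Dv:
  fixes h :: "real \<times> real \<Rightarrow> 'a::banach"
  assumes D: "open D" and h: "Ck_on 2 D h" and p: "p \<in> D"
  shows "Dv (Du h) p = Du (Dv h) p"
proof -
  obtain u0 v0 where p_eq: "p = (u0, v0)" by (cases p)
  obtain R where R: "R > 0" and sub: "{u0 - R..u0 + R} \<times> {v0 - R..v0 + R} \<subseteq> D"
    using open_imp_square_subset[OF D] p p_eq by blast
  have C: "Ck_on 1 D (Du h)" "Ck_on 1 D (Dv h)" "partials D h (Du h) (Dv h)"
    using h Ck_on_Suc_partials[OF D, of 1 h] by (simp_all add: numeral_2_eq_2)
  have Cu: "partials D (Du h) (Du (Du h)) (Dv (Du h))" and Cv: "partials D (Dv h) (Du (Dv h)) (Dv (Dv h))"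
    using C Ck_on_Suc_partials[OF D, of 0] by simp_all
  have cont: "continuous_on D (Du h)" "continuous_on D (Dv (Du h))"
    using C(1) Ck_on_imp_continuous_on[OF C(1)] by (simp_all add: One_nat_def)
  have contu: "continuous_on {u0 - R..u} (\<lambda>s. Du h (s, v))" "continuous_on {u0 - R..u} (\<lambda>s. Dv (Du h) (s, v))"
    if "u \<in> {u0 - R..u0 + R}" "v \<in> {v0 - R..v0 + R}" for u v
    using that by (auto intro!: continuous_on_compose2[OF cont(1)] continuous_on_compose2[OF cont(2)]
        continuous_intros subsetD[OF sub])
  have ftc: "integral {u0 - R..u} (\<lambda>s. Du h (s, v)) = h (u, v) - h (u0 - R, v)"
    if "u \<in> {u0 - R..u0 + R}" "v \<in> {v0 - R..v0 + R}" for u v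
  proof (intro integral_unique fundamental_theorem_of_calculus)
    show "u0 - R \<le> u" using that by auto
    fix s assume "s \<in> {u0 - R..u}"
    with that have "(s, v) \<in> D" by (intro subsetD[OF sub]) simp
    then show "((\<lambda>s. h (s, v)) has_vector_derivative Du h (s, v)) (at s within {u0 - R..u})"
      by (rule partials_within_u[OF C(3)])
  qed
  \<comment> \<open>Both sides are the \<open>v\<close>-derivative at \<open>v0\<close> of
    \<open>h (u, v) - h (u0 - R, v)\<close>, the left one by differentiation under the integral
    sign.\<close>
  have ftc': "integral {u0 - R..u} (\<lambda>s. Dv (Du h) (s, v0)) = Dv h (u, v0) - Dv h (u0 - R, v0)"
    if u: "u \<in> {u0 - R..u0 + R}" for u
  proof -
    have "((\<lambda>v. integral (cbox (u0 - R) u) (\<lambda>s. Du h (s, v))) has_vector_derivative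
        integral (cbox (u0 - R) u) (\<lambda>s. Dv (Du h) (s, v0))) (at v0 within {v0 - R..v0 + R})"
    proof (rule leibniz_rule_vector_derivative)
      show "((\<lambda>v. Du h (s, v)) has_vector_derivative Dv (Du h) (s, v)) (at v within {v0 - R..v0 + R})"
        if "v \<in> {v0 - R..v0 + R}" "s \<in> cbox (u0 - R) u" for v s
      proof -
        have "(s, v) \<in> D" by (rule subsetD[OF sub]) (use that u in simp)
        then show ?thesis by (rule partials_within_v[OF Cu])
      qed
      show "(\<lambda>s. Du h (s, v)) integrable_on cbox (u0 - R) u" if "v \<in> {v0 - R..v0 + R}" for v
        using contu(1)[OF u that] by (simp add: integrable_continuous_interval)
      show "continuous_on ({v0 - R..v0 + R} \<times> cbox (u0 - R) u) (\<lambda>(v, s). Dv (Du h) (s, v))"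
        unfolding case_prod_beta'
        using u by (intro continuous_on_compose2[OF cont(2)] continuous_intros image_subsetI subsetD[OF sub])
          (auto simp: mem_Times_iff)
      show "v0 \<in> {v0 - R..v0 + R}" "convex {v0 - R..v0 + R}" using R by (simp_all add: convex_real_interval)
    qed
    from this[unfolded box_real] have "((\<lambda>v. h (u, v) - h (u0 - R, v)) has_vector_derivative
        integral {u0 - R..u} (\<lambda>s. Dv (Du h) (s, v0))) (at v0 within {v0 - R..v0 + R})"
      by (rule has_vector_derivative_transform[rotated 2]) (use R ftc[OF u] in simp_all)
    moreover have "((\<lambda>v. h (u, v) - h (u0 - R, v)) has_vector_derivative Dv h (u, v0) - Dv h (u0 - R, v0))
        (at v0 within {v0 - R..v0 + R})"
    proof (rule has_vector_derivative_diff)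
      have "(u, v0) \<in> D" "(u0 - R, v0) \<in> D"
        by (rule subsetD[OF sub], use u R in simp)+
      then show "((\<lambda>v. h (u, v)) has_vector_derivative Dv h (u, v0)) (at v0 within {v0 - R..v0 + R})"
         "((\<lambda>v. h (u0 - R, v)) has_vector_derivative Dv h (u0 - R, v0)) (at v0 within {v0 - R..v0 + R})"
        by (simp_all add: partials_within_v[OF C(3)])
    qed
    ultimately show ?thesis
      by (rule vector_derivative_unique_within_closed_interval[of "v0 - R" "v0 + R" v0, unfolded box_real, rotated 2])
        (use R in simp_all)
  qed
  have "((\<lambda>u. integral {u0 - R..u} (\<lambda>s. Dv (Du h) (s, v0))) has_vector_derivative Dv (Du h) (u0, v0))
      (at u0 within {u0 - R..u0 + R})"
    by (rule integral_has_vector_derivative[OF contu(2)]) (use R in simp_all)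
  then have "((\<lambda>u. Dv h (u, v0) - Dv h (u0 - R, v0)) has_vector_derivative Dv (Du h) (u0, v0))
      (at u0 within {u0 - R..u0 + R})"
    by (rule has_vector_derivative_transform[rotated 2]) (use R ftc' in simp_all)
  moreover have "((\<lambda>u. Dv h (u, v0) - Dv h (u0 - R, v0)) has_vector_derivative Du (Dv h) (u0, v0) - 0)
      (at u0 within {u0 - R..u0 + R})"
    using p p_eq by (intro has_vector_derivative_diff has_vector_derivative_const partials_within_u[OF Cv]) simp
  ultimately have "Dv (Du h) (u0, v0) = Du (Dv h) (u0, v0) - 0"
    by (rule vector_derivative_unique_within_closed_interval[of "u0 - R" "u0 + R" u0, unfolded box_real, rotated 2])
      (use R in simp_all)
  then show ?thesis using p_eq by simp
qed

section \<open>Completely integrable linear systems\<close>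

text \<open>
  The integral of \<open>h\<close> from \<open>c\<close> to \<open>x\<close>, also for \<open>x < c\<close>, rescaled to the fixed interval
  \<open>[0, 1]\<close> so that the library results on integrals with parameters apply.
\<close>

definition dint :: "real \<Rightarrow> real \<Rightarrow> (real \<Rightarrow> 'a::real_normed_vector) \<Rightarrow> 'a" where
  "dint c x h = (x - c) *\<^sub>R integral {0..1} (\<lambda>s. h (c + s * (x - c)))"

lemma segment_mem:
  fixes c x s l r :: real
  assumes "c \<in> {l..r}" "x \<in> {l..r}" "s \<in> {0..1}"
  shows "c + s * (x - c) \<in> {l..r}"
  using convexD[OF convex_real_interval(5)[of l r] assms(1,2), of "1 - s" s] assms(3)
  by (simp add: algebra_simps)

lemma dint_self [simp]: "dint c c h = 0"
  by (simp add: dint_def)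

lemma continuous_on_segment:
  fixes c x l r :: real
  assumes "continuous_on {l..r} h" "c \<in> {l..r}" "x \<in> {l..r}"
  shows "continuous_on {0..1} (\<lambda>s. h (c + s * (x - c)))"
  by (rule continuous_on_compose2[OF assms(1)], intro continuous_intros, rule image_subsetI)
    (rule segment_mem[OF assms(2,3)])

lemma dint_eq:
  fixes h :: "real \<Rightarrow> 'a::banach"
  assumes H: "\<And>y. y \<in> {l..r} \<Longrightarrow> (H has_vector_derivative h y) (at y within {l..r})"
    and c: "c \<in> {l..r}" and x: "x \<in> {l..r}"
  shows "dint c x h = H x - H c"
proof -
  have "((\<lambda>s. (x - c) *\<^sub>R h (c + s * (x - c))) has_integral
      (H \<circ> (\<lambda>s. c + s * (x - c))) 1 - (H \<circ> (\<lambda>s. c + s * (x - c))) 0) {0..1}"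
  proof (rule fundamental_theorem_of_calculus)
    fix s :: real assume s: "s \<in> {0..1}"
    have sub: "(\<lambda>s. c + s * (x - c)) ` {0..1} \<subseteq> {l..r}"
      using segment_mem[OF c x] by blast
    show "(H \<circ> (\<lambda>s. c + s * (x - c)) has_vector_derivative (x - c) *\<^sub>R h (c + s * (x - c))) (at s within {0..1})"
    proof (rule vector_diff_chain_within)
      show "((\<lambda>s. c + s * (x - c)) has_vector_derivative x - c) (at s within {0..1})"
        by (auto intro!: derivative_eq_intros simp: has_real_derivative_iff_has_vector_derivative[symmetric])
      show "(H has_vector_derivative h (c + s * (x - c))) (at (c + s * (x - c)) within (\<lambda>s. c + s * (x - c)) ` {0..1})"
        by (rule has_vector_derivative_within_subset[OF H[OF segment_mem[OF c x s]] sub])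
    qed
  qed simp
  from integral_unique[OF this] show ?thesis by (simp add: dint_def)
qed

lemma dint_has_vector_derivative:
  fixes h :: "real \<Rightarrow> 'a::banach"
  assumes h: "continuous_on {l..r} h" and c: "c \<in> {l..r}" and x: "x \<in> {l..r}"
  shows "((\<lambda>y. dint c y h) has_vector_derivative h x) (at x within {l..r})"
proof -
  have H: "((\<lambda>y. integral {l..y} h) has_vector_derivative h y) (at y within {l..r})" if "y \<in> {l..r}" for y
    by (rule integral_has_vector_derivative[OF h that])
  have "((\<lambda>y. integral {l..y} h - integral {l..c} h) has_vector_derivative h x) (at x within {l..r})"
    using has_vector_derivative_diff[OF H[OF x] has_vector_derivative_const] by simp
  then show ?thesis
    by (rule has_vector_derivative_transform[OF x, rotated]) (rule dint_eq[OF H c])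
qed

lemma norm_dint_le:
  fixes h :: "real \<Rightarrow> 'a::banach"
  assumes h: "continuous_on {l..r} h" and c: "c \<in> {l..r}" and x: "x \<in> {l..r}"
    and B: "\<And>y. y \<in> {l..r} \<Longrightarrow> norm (h y) \<le> B"
  shows "norm (dint c x h) \<le> \<bar>x - c\<bar> * B"
proof -
  have "norm (integral {0..1} (\<lambda>s. h (c + s * (x - c)))) \<le> B * (1 - 0)"
    using B segment_mem[OF c x] by (intro integral_bound continuous_on_segment[OF h c x]) simp_all
  then show ?thesis unfolding dint_def norm_scaleR by (simp add: mult_left_mono)
qed

lemma dint_diff:
  fixes h k :: "real \<Rightarrow> 'a::banach"
  assumes "continuous_on {l..r} h" "continuous_on {l..r} k" "c \<in> {l..r}" "x \<in> {l..r}"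
  shows "dint c x (\<lambda>y. h y - k y) = dint c x h - dint c x k"
proof -
  have "integral {0..1} (\<lambda>s. h (c + s * (x - c)) - k (c + s * (x - c)))
      = integral {0..1} (\<lambda>s. h (c + s * (x - c))) - integral {0..1} (\<lambda>s. k (c + s * (x - c)))"
    by (intro integral_diff integrable_continuous_interval continuous_on_segment[OF _ assms(3,4)] assms(1,2))
  then show ?thesis by (simp add: dint_def scaleR_diff_right)
qed

text \<open>End point and integrand both depend on \<open>q\<close>. The rescaling inside
  \<open>dint\<close> moves the end point into the integrand, which leaves a jointly continuous
  integrand over a fixed interval.\<close>

lemma continuous_on_dint:
  fixes h :: "'b::topological_space \<Rightarrow> real \<Rightarrow> 'a::banach"
  assumes h: "continuous_on (S \<times> {l..r}) (\<lambda>(q, t). h q t)" and x: "continuous_on S x"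
    and c: "c \<in> {l..r}" and xr: "\<And>q. q \<in> S \<Longrightarrow> x q \<in> {l..r}"
  shows "continuous_on S (\<lambda>q. dint c (x q) (h q))"
proof -
  have "continuous_on (S \<times> {0..1}) (\<lambda>p. case (fst p, c + snd p * (x (fst p) - c)) of (q, t) \<Rightarrow> h q t)"
  proof (rule continuous_on_compose2[OF h])
    show "continuous_on (S \<times> {0..1}) (\<lambda>p. (fst p, c + snd p * (x (fst p) - c)))"
      by (intro continuous_intros continuous_on_compose2[OF x]) auto
    show "(\<lambda>p. (fst p, c + snd p * (x (fst p) - c))) ` (S \<times> {0..1}) \<subseteq> S \<times> {l..r}"
      using segment_mem[OF c xr] by (intro image_subsetI) (simp add: mem_Times_iff)
  qed
  then have "continuous_on (S \<times> cbox 0 1) (\<lambda>(q, s). h q (c + s * (x q - c)))"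
    by (simp add: case_prod_beta')
  from integral_continuous_on_param[OF this] show ?thesis
    unfolding dint_def box_real by (intro continuous_intros x)
qed

lemma dint_leibniz:
  fixes h :: "real \<Rightarrow> real \<Rightarrow> 'a::banach"
  assumes hv: "\<And>v t. v \<in> V \<Longrightarrow> t \<in> {l..r} \<Longrightarrow> ((\<lambda>v. h v t) has_vector_derivative hv v t) (at v within V)"
    and h: "\<And>v. v \<in> V \<Longrightarrow> continuous_on {l..r} (h v)"
    and cont: "continuous_on (V \<times> {l..r}) (\<lambda>(v, t). hv v t)"
    and "v0 \<in> V" "convex V" and c: "c \<in> {l..r}" and x: "x \<in> {l..r}"
  shows "((\<lambda>v. dint c x (h v)) has_vector_derivative dint c x (hv v0)) (at v0 within V)"
proof -
  have "((\<lambda>v. integral (cbox 0 1) (\<lambda>s. h v (c + s * (x - c)))) has_vector_derivative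
      integral (cbox 0 1) (\<lambda>s. hv v0 (c + s * (x - c)))) (at v0 within V)"
  proof (rule leibniz_rule_vector_derivative)
    show "((\<lambda>v. h v (c + s * (x - c))) has_vector_derivative hv v (c + s * (x - c))) (at v within V)"
      if "v \<in> V" "s \<in> cbox 0 1" for v s
      using hv[OF that(1) segment_mem[OF c x]] that by simp
    show "(\<lambda>s. h v (c + s * (x - c))) integrable_on cbox 0 1" if "v \<in> V" for v
      unfolding box_real by (intro integrable_continuous_interval continuous_on_segment[OF h c x] that)
    have "continuous_on (V \<times> {0..1}) (\<lambda>p. case (fst p, c + snd p * (x - c)) of (q, t) \<Rightarrow> hv q t)"
    proof (rule continuous_on_compose2[OF cont])
      show "continuous_on (V \<times> {0..1}) (\<lambda>p. (fst p, c + snd p * (x - c)))"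
        by (intro continuous_intros)
      show "(\<lambda>p. (fst p, c + snd p * (x - c))) ` (V \<times> {0..1}) \<subseteq> V \<times> {l..r}"
        using segment_mem[OF c x] by (intro image_subsetI) (simp add: mem_Times_iff)
    qed
    then show "continuous_on (V \<times> cbox 0 1) (\<lambda>(v, s). hv v (c + s * (x - c)))"
      by (simp add: case_prod_beta')
  qed (fact assms)+
  from bounded_linear.has_vector_derivative[OF bounded_linear_scaleR_right this]
  show ?thesis unfolding dint_def box_real .
qed

section \<open>Local solutions of the linear system\<close>

lemmas continuous_on_blinfun_apply = bounded_bilinear.continuous_on[OF bounded_bilinear_blinfun_apply]
lemmas has_vector_derivative_blinfun_apply = bounded_bilinear.has_vector_derivative[OF bounded_bilinear_blinfun_apply]

text \<open>The integral equation reaches \<open>q\<close> along one path: horizontally at height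
  \<open>v0\<close>, then vertically. Each of the two integrals has Lipschitz constant at most
  \<open>r * M\<close> in \<open>A\<close>, and \<open>4 * (r * M) \<le> 1\<close> makes their sum a
  contraction with factor 1/2.\<close>

lemma volterra_fixed_point:
  fixes U V :: "real \<times> real \<Rightarrow> 'b::banach \<Rightarrow>\<^sub>L 'b" and u0 v0 r M :: real
  defines "K \<equiv> {u0 - r..u0 + r} \<times> {v0 - r..v0 + r}"
  assumes r: "r > 0" and U: "continuous_on K U" and V: "continuous_on K V"
    and M: "\<And>q. q \<in> K \<Longrightarrow> norm (U q) \<le> M" "\<And>q. q \<in> K \<Longrightarrow> norm (V q) \<le> M" and rM: "4 * (r * M) \<le> 1"
  obtains A :: "real \<times> real \<Rightarrow> 'b" where "continuous_on K A"
    "\<And>q. q \<in> K \<Longrightarrow> A q = w0 + dint u0 (fst q) (\<lambda>s. U (s, v0) (A (s, v0))) +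
       dint v0 (snd q) (\<lambda>t. V (fst q, t) (A (fst q, t)))"
proof -
  let ?I = "{u0 - r..u0 + r}" and ?J = "{v0 - r..v0 + r}"
  define F :: "(real \<times> real \<Rightarrow> 'b) \<Rightarrow> real \<times> real \<Rightarrow> 'b" where
    "F A q = w0 + dint u0 (fst q) (\<lambda>s. U (s, v0) (A (s, v0))) +
       dint v0 (snd q) (\<lambda>t. V (fst q, t) (A (fst q, t)))" for A q
  define a where "a = (u0 - r, v0 - r)"
  define b where "b = (u0 + r, v0 + r)"
  have K: "K = cbox a b" unfolding K_def a_def b_def by (simp add: cbox_Pair_eq)
  have c: "u0 \<in> ?I" "v0 \<in> ?J" using r by auto
  have slice1: "continuous_on ?I (\<lambda>s. U (s, v0) (A (s, v0)))" if "continuous_on K A" for A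
    using c by (intro continuous_on_compose2[OF continuous_on_blinfun_apply[OF U that], of ?I "\<lambda>s. (s, v0)"]
      continuous_intros) (auto simp: K_def)
  have slice2: "continuous_on ?J (\<lambda>t. V (u, t) (A (u, t)))" if "continuous_on K A" "u \<in> ?I" for A u
    using that(2) by (intro continuous_on_compose2[OF continuous_on_blinfun_apply[OF V that(1)], of ?J "\<lambda>t. (u, t)"]
      continuous_intros) (auto simp: K_def)
  have F_cont: "continuous_on K (F A)" if A: "continuous_on K A" for A
  proof -
    have "continuous_on K (\<lambda>q. dint u0 (fst q) (\<lambda>s. U (s, v0) (A (s, v0))))"
    proof (rule continuous_on_dint[where l = "u0 - r" and r = "u0 + r"])
      show "continuous_on (K \<times> ?I) (\<lambda>(q, t). U (t, v0) (A (t, v0)))"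
        unfolding case_prod_beta'
        by (rule continuous_on_compose2[OF slice1[OF A] continuous_on_snd[OF continuous_on_id]]) auto
    qed (use c in \<open>auto intro!: continuous_intros simp: K_def\<close>)
    moreover have "continuous_on K (\<lambda>q. dint v0 (snd q) (\<lambda>t. V (fst q, t) (A (fst q, t))))"
    proof (rule continuous_on_dint[where l = "v0 - r" and r = "v0 + r"])
      show "continuous_on (K \<times> ?J) (\<lambda>(q, t). V (fst q, t) (A (fst q, t)))"
        unfolding case_prod_beta'
        by (rule continuous_on_compose2[OF continuous_on_blinfun_apply[OF V A], of _ "\<lambda>x. (fst (fst x), snd x)"],
          intro continuous_intros) (auto simp: K_def)
    qed (use c in \<open>auto intro!: continuous_intros simp: K_def\<close>)
    ultimately show ?thesis unfolding F_def by (intro continuous_intros)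
  qed
  \<comment> \<open>The contraction principle is applied in the complete space of bounded continuous
    functions on the whole plane. \<open>ext_cont\<close> extends a function from the square to the
    plane by composing it with the projection \<open>clamp\<close> onto the square.\<close>
  define T where "T A = Bcontfun (ext_cont (F (apply_bcontfun A)) a b)" for A :: "(real \<times> real) \<Rightarrow>\<^sub>C 'b"
  have T: "apply_bcontfun (T A) = ext_cont (F (apply_bcontfun A)) a b" for A
    unfolding T_def
  proof (rule Bcontfun_inverse)
    have "continuous_on (cbox a b) (F (apply_bcontfun A))" using F_cont K by simp
    moreover from this have "bounded (F (apply_bcontfun A) ` cbox a b)"
      by (intro compact_imp_bounded compact_continuous_image compact_cbox)
    ultimately show "ext_cont (F (apply_bcontfun A)) a b \<in> bcontfun"
      unfolding bcontfun_def ext_cont_def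
      by (auto intro!: clamp_continuous_on clamp_bounded)
  qed
  have ne: "clamp a b q \<in> K" for q
    unfolding K using r by (intro clamp_in_interval) (auto simp: a_def b_def Basis_prod_def)
  have "\<exists>!A. T A = A"
  proof (rule banach_fix_type[of "1/2"])
    show "\<forall>A B. dist (T A) (T B) \<le> 1/2 * dist A B"
    proof (intro allI dist_bound)
      fix A B :: "(real \<times> real) \<Rightarrow>\<^sub>C 'b" and q
      define d where "d = dist A B"
      obtain x y where xy: "clamp a b q = (x, y)" by (cases "clamp a b q")
      then have x: "x \<in> ?I" and y: "y \<in> ?J" using ne[of q] K_def by auto
      have dd: "norm (A p - B p) \<le> d" for p
        using dist_bounded[of A p B] by (simp add: d_def dist_norm)
      have cont: "continuous_on K (apply_bcontfun A)" "continuous_on K (apply_bcontfun B)" by auto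
      have bound: "norm (W p (A p) - W p (B p)) \<le> M * d" if "norm (W p) \<le> M" for W :: "real \<times> real \<Rightarrow> 'b \<Rightarrow>\<^sub>L 'b" and p
      proof -
        have "norm (W p (A p) - W p (B p)) \<le> norm (W p) * norm (A p - B p)"
          unfolding blinfun.diff_right[symmetric] by (rule norm_blinfun)
        also have "\<dots> \<le> M * d" using dd[of p] that by (intro mult_mono) (auto intro: order_trans[OF norm_ge_zero])
        finally show ?thesis .
      qed
      have e1: "norm (dint u0 x (\<lambda>s. U (s, v0) (A (s, v0)) - U (s, v0) (B (s, v0)))) \<le> \<bar>x - u0\<bar> * (M * d)"
        by (rule norm_dint_le[OF continuous_on_diff[OF slice1[OF cont(1)] slice1[OF cont(2)]] c(1) x])
          (rule bound, rule M, use c in \<open>auto simp: K_def\<close>)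
      have e2: "norm (dint v0 y (\<lambda>t. V (x, t) (A (x, t)) - V (x, t) (B (x, t)))) \<le> \<bar>y - v0\<bar> * (M * d)"
        by (rule norm_dint_le[OF continuous_on_diff[OF slice2[OF cont(1) x] slice2[OF cont(2) x]] c(2) y])
          (rule bound, rule M, use x in \<open>auto simp: K_def\<close>)
      have M0: "M \<ge> 0" using M(1)[of "(u0,v0)"] c by (auto simp: K_def intro: order_trans[OF norm_ge_zero])
      have d0: "d \<ge> 0" by (simp add: d_def)
      have "dist (T A q) (T B q) = norm (F A (x, y) - F B (x, y))"
        by (simp add: T ext_cont_def xy dist_norm)
      also have "\<dots> = norm (dint u0 x (\<lambda>s. U (s, v0) (A (s, v0)) - U (s, v0) (B (s, v0)))
          + dint v0 y (\<lambda>t. V (x, t) (A (x, t)) - V (x, t) (B (x, t))))"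
        unfolding F_def fst_conv snd_conv dint_diff[OF slice1[OF cont(1)] slice1[OF cont(2)] c(1) x]
          dint_diff[OF slice2[OF cont(1) x] slice2[OF cont(2) x] c(2) y] by (simp add: algebra_simps)
      also have "\<dots> \<le> \<bar>x - u0\<bar> * (M * d) + \<bar>y - v0\<bar> * (M * d)"
        by (rule norm_triangle_mono[OF e1 e2])
      also have "\<dots> \<le> r * (M * d) + r * (M * d)"
        using x y M0 d0 by (intro add_mono mult_right_mono) auto
      also have "\<dots> = 2 * (r * M) * d" by simp
      also have "\<dots> \<le> 1/2 * d" using rM d0 by (intro mult_right_mono) auto
      finally show "dist (T A q) (T B q) \<le> 1/2 * dist A B" by (simp add: d_def)
    qed
  qed auto
  then obtain A where A: "T A = A" by blast
  have "apply_bcontfun A q = F (apply_bcontfun A) q" if "q \<in> K" for q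
  proof -
    have "apply_bcontfun A q = ext_cont (F (apply_bcontfun A)) a b q" using T[of A] A by simp
    then show ?thesis using that K by simp
  qed
  from this[unfolded F_def] show thesis
    by (rule that[OF continuous_on_apply_bcontfun])
qed

text \<open>
  The fixed point \<open>A\<close> solves the \<open>u\<close>-equation only for \<open>v = v0\<close>. Whether it has a \<open>u\<close>-derivative for
  other \<open>v\<close> is not needed: the defect \<open>R\<close> of the integrated \<open>u\<close>-equation satisfies
  \<open>R_v = V R - \<integral> V_u R du\<close> by \<open>compat\<close>, with \<open>R = 0\<close> for \<open>v = v0\<close>, and hence vanishes.
\<close>

lemma total_linear_system_square:
  fixes U V Uv Vu :: "real \<times> real \<Rightarrow> 'b::banach \<Rightarrow>\<^sub>L 'b" and u0 v0 r M :: real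
  defines "I \<equiv> {u0 - r..u0 + r}" and "J \<equiv> {v0 - r..v0 + r}"
  assumes r: "r > 0" "r \<le> 1" and U: "continuous_on (I \<times> J) U" and V: "continuous_on (I \<times> J) V"
    and Uv: "continuous_on (I \<times> J) Uv" and Vu: "continuous_on (I \<times> J) Vu"
    and dU: "\<And>s t. s \<in> I \<Longrightarrow> t \<in> J \<Longrightarrow> ((\<lambda>t. U (s, t)) has_vector_derivative Uv (s, t)) (at t within J)"
    and dV: "\<And>s t. s \<in> I \<Longrightarrow> t \<in> J \<Longrightarrow> ((\<lambda>s. V (s, t)) has_vector_derivative Vu (s, t)) (at s within I)"
    and M: "\<And>q. q \<in> I \<times> J \<Longrightarrow> norm (U q) \<le> M" "\<And>q. q \<in> I \<times> J \<Longrightarrow> norm (V q) \<le> M"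
      "\<And>q. q \<in> I \<times> J \<Longrightarrow> norm (Vu q) \<le> M" and rM: "4 * (r * M) \<le> 1"
    and compat: "\<And>q x. q \<in> I \<times> J \<Longrightarrow> Uv q x + U q (V q x) = Vu q x + V q (U q x)"
  obtains A :: "real \<times> real \<Rightarrow> 'b" where "continuous_on (I \<times> J) A" "A (u0, v0) = w0"
    "\<And>s t. s \<in> I \<Longrightarrow> t \<in> J \<Longrightarrow> ((\<lambda>s. A (s, t)) has_vector_derivative U (s, t) (A (s, t))) (at s within I)"
    "\<And>s t. s \<in> I \<Longrightarrow> t \<in> J \<Longrightarrow> ((\<lambda>t. A (s, t)) has_vector_derivative V (s, t) (A (s, t))) (at t within J)"
proof -
  obtain A :: "real \<times> real \<Rightarrow> 'b" where A: "continuous_on (I \<times> J) A" and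
    fixpt: "\<And>q. q \<in> I \<times> J \<Longrightarrow> A q = w0 + dint u0 (fst q) (\<lambda>s. U (s, v0) (A (s, v0))) +
       dint v0 (snd q) (\<lambda>t. V (fst q, t) (A (fst q, t)))"
    using volterra_fixed_point[OF r(1) U[unfolded I_def J_def] V[unfolded I_def J_def]
      M(1)[unfolded I_def J_def] M(2)[unfolded I_def J_def] rM, of w0] unfolding I_def J_def by blast
  have c: "u0 \<in> I" "v0 \<in> J" using r by (auto simp: I_def J_def)
  note app = continuous_on_blinfun_apply
  have sliceu: "continuous_on I (\<lambda>s. h (s, t))" if "continuous_on (I \<times> J) h" "t \<in> J" for h :: "real \<times> real \<Rightarrow> 'b" and t
    using that(2) by (intro continuous_on_compose2[OF that(1), of I "\<lambda>s. (s, t)"] continuous_intros) auto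
  have slicev: "continuous_on J (\<lambda>t. h (s, t))" if "continuous_on (I \<times> J) h" "s \<in> I" for h :: "real \<times> real \<Rightarrow> 'b" and s
    using that(2) by (intro continuous_on_compose2[OF that(1), of J "\<lambda>t. (s, t)"] continuous_intros) auto
  have swap: "continuous_on (J \<times> I) (\<lambda>(t, s). h (s, t))" if "continuous_on (I \<times> J) h" for h :: "real \<times> real \<Rightarrow> 'b"
    unfolding case_prod_beta'
    by (rule continuous_on_compose2[OF that, of _ "\<lambda>x. (snd x, fst x)"], intro continuous_intros) auto

  \<comment> \<open>\<open>A\<close> was built along the path that is horizontal first;
    \<open>B\<close> takes the other path, vertical at \<open>u0\<close> and then horizontal. Where
    the two agree, \<open>A\<close> inherits the \<open>u\<close>-derivative of
    \<open>B\<close>.\<close>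
  define B where "B q = A (u0, snd q) + dint u0 (fst q) (\<lambda>s. U (s, snd q) (A (s, snd q)))" for q
  define R where "R q = A q - B q" for q
  have dint_cont: "continuous_on (I \<times> J) (\<lambda>q. dint u0 (fst q) (\<lambda>s. h (s, snd q)))"
    if h: "continuous_on (I \<times> J) h" for h :: "real \<times> real \<Rightarrow> 'b"
  proof (rule continuous_on_dint[where l = "u0 - r" and r = "u0 + r"])
    show "continuous_on ((I \<times> J) \<times> {u0 - r..u0 + r}) (\<lambda>(q, t). h (t, snd q))"
      unfolding case_prod_beta' I_def[symmetric]
      by (rule continuous_on_compose2[OF h, of _ "\<lambda>x. (snd x, snd (fst x))"], intro continuous_intros) auto
  qed (use c in \<open>auto intro!: continuous_intros simp: I_def\<close>)
  have B: "continuous_on (I \<times> J) B"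
    unfolding B_def
    by (intro continuous_on_add dint_cont app U A continuous_on_compose2[OF A, of _ "\<lambda>q. (u0, snd q)"] continuous_intros)
      (use c in auto)
  have R: "continuous_on (I \<times> J) R"
    unfolding R_def by (intro continuous_on_diff A B)

  have dA: "((\<lambda>t. A (s, t)) has_vector_derivative V (s, t) (A (s, t))) (at t within J)"
    if "s \<in> I" "t \<in> J" for s t
  proof -
    have "((\<lambda>t. w0 + dint u0 s (\<lambda>s. U (s, v0) (A (s, v0))) + dint v0 t (\<lambda>t. V (s, t) (A (s, t))))
        has_vector_derivative 0 + V (s, t) (A (s, t))) (at t within J)"
      unfolding J_def
      by (intro has_vector_derivative_add has_vector_derivative_const
          dint_has_vector_derivative[OF slicev[OF app[OF V A] that(1), unfolded J_def]
            c(2)[unfolded J_def] that(2)[unfolded J_def]])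
    then have "((\<lambda>t. w0 + dint u0 s (\<lambda>s. U (s, v0) (A (s, v0))) + dint v0 t (\<lambda>t. V (s, t) (A (s, t))))
        has_vector_derivative V (s, t) (A (s, t))) (at t within J)"
      by simp
    then show ?thesis
      by (rule has_vector_derivative_transform[OF that(2), rotated]) (use fixpt that in simp)
  qed
  have dBu: "((\<lambda>s. B (s, t)) has_vector_derivative U (s, t) (A (s, t))) (at s within I)"
    if "s \<in> I" "t \<in> J" for s t
  proof -
    have "((\<lambda>s. A (u0, t) + dint u0 s (\<lambda>s. U (s, t) (A (s, t)))) has_vector_derivative 0 + U (s, t) (A (s, t)))
       (at s within I)"
      unfolding I_def
      by (intro has_vector_derivative_add has_vector_derivative_const
          dint_has_vector_derivative[OF sliceu[OF app[OF U A] that(2), unfolded I_def]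
            c(1)[unfolded I_def] that(1)[unfolded I_def]])
    then show ?thesis by (simp add: B_def)
  qed
  have dBv: "((\<lambda>t. B (s, t)) has_vector_derivative V (u0, t) (A (u0, t)) +
       dint u0 s (\<lambda>s. U (s, t) (V (s, t) (A (s, t))) + Uv (s, t) (A (s, t)))) (at t within J)"
    if s: "s \<in> I" and t: "t \<in> J" for s t
  proof -
    have "((\<lambda>t. dint u0 s (\<lambda>s. U (s, t) (A (s, t)))) has_vector_derivative
        dint u0 s (\<lambda>s. U (s, t) (V (s, t) (A (s, t))) + Uv (s, t) (A (s, t)))) (at t within J)"
    proof (rule dint_leibniz[where l = "u0 - r" and r = "u0 + r"])
      show "((\<lambda>t. U (s, t) (A (s, t))) has_vector_derivative U (s, t) (V (s, t) (A (s, t))) + Uv (s, t) (A (s, t))) (at t within J)"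
        if "t \<in> J" "s \<in> {u0 - r..u0 + r}" for s t
        using that by (intro has_vector_derivative_blinfun_apply dU dA) (auto simp: I_def)
      show "continuous_on {u0 - r..u0 + r} (\<lambda>s. U (s, t) (A (s, t)))" if "t \<in> J" for t
        unfolding I_def[symmetric] by (rule sliceu[OF app[OF U A] that])
      show "continuous_on (J \<times> {u0 - r..u0 + r}) (\<lambda>(t, s). U (s, t) (V (s, t) (A (s, t))) + Uv (s, t) (A (s, t)))"
        unfolding I_def[symmetric] by (intro swap continuous_on_add app U V A Uv)
      show "convex J" unfolding J_def by (rule convex_real_interval)
    qed (use s t c in \<open>auto simp: I_def\<close>)
    then show ?thesis
      unfolding B_def fst_conv snd_conv by (intro has_vector_derivative_add dA c(1) t)
  qed
  \<comment> \<open>The product rule for \<open>V B\<close> in the direction \<open>u\<close>,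
    integrated. It involves \<open>B_u = U A\<close>, which is known, and not
    \<open>A_u\<close>.\<close>
  have VB: "dint u0 s (\<lambda>s. V (s, t) (U (s, t) (A (s, t))) + Vu (s, t) (B (s, t))) = V (s, t) (B (s, t)) - V (u0, t) (A (u0, t))"
    if s: "s \<in> I" and t: "t \<in> J" for s t
  proof -
    have "((\<lambda>s. V (s, t) (B (s, t))) has_vector_derivative V (s, t) (U (s, t) (A (s, t))) + Vu (s, t) (B (s, t))) (at s within I)"
      if "s \<in> I" for s
      by (intro has_vector_derivative_blinfun_apply dV dBu that t)
    from dint_eq[OF this[unfolded I_def] c(1)[unfolded I_def] s[unfolded I_def]] show ?thesis
      by (simp add: B_def)
  qed
  have dR: "((\<lambda>t. R (s, t)) has_vector_derivative V (s, t) (R (s, t)) - dint u0 s (\<lambda>s. Vu (s, t) (R (s, t)))) (at t within J)"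
    if s: "s \<in> I" and t: "t \<in> J" for s t
  proof -
    let ?P = "\<lambda>s. V (s, t) (U (s, t) (A (s, t))) + Vu (s, t) (B (s, t))"
    let ?Q = "\<lambda>s. U (s, t) (V (s, t) (A (s, t))) + Uv (s, t) (A (s, t))"
    have cont: "continuous_on I ?P" "continuous_on I ?Q"
      by (intro sliceu t continuous_on_add app U V Uv Vu A B)+
    \<comment> \<open>By \<open>compat\<close>, \<open>Vu A\<close> equals
      \<open>Uv A + U V A - V U A\<close>, so \<open>Vu R\<close> is the integrand of
      \<open>dBv\<close> minus that of \<open>VB\<close>.\<close>
    have "dint u0 s (\<lambda>s. Vu (s, t) (R (s, t))) = dint u0 s (\<lambda>s. ?Q s - ?P s)"
      unfolding dint_def
    proof (intro arg_cong[where f = "scaleR _"] integral_cong)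
      fix x :: real assume "x \<in> {0..1}"
      then have "(u0 + x * (s - u0), t) \<in> I \<times> J"
        using segment_mem[OF c(1)[unfolded I_def] s[unfolded I_def]] t by (auto simp: I_def)
      from compat[OF this, of "A (u0 + x * (s - u0), t)"]
      show "Vu (u0 + x * (s - u0), t) (R (u0 + x * (s - u0), t)) = ?Q (u0 + x * (s - u0)) - ?P (u0 + x * (s - u0))"
        by (simp add: R_def blinfun.diff_right algebra_simps)
    qed
    also have "\<dots> = dint u0 s ?Q - dint u0 s ?P"
      by (rule dint_diff[OF cont(2,1)[unfolded I_def] c(1)[unfolded I_def] s[unfolded I_def]])
    finally have eq: "V (s, t) (R (s, t)) - dint u0 s (\<lambda>s. Vu (s, t) (R (s, t))) =
       V (s, t) (A (s, t)) - (V (u0, t) (A (u0, t)) + dint u0 s ?Q)"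
      unfolding VB[OF s t] by (simp add: R_def blinfun.diff_right algebra_simps)
    show ?thesis unfolding eq unfolding R_def by (intro has_vector_derivative_diff dA dBv s t)
  qed
  have R_init: "R (s, v0) = 0" if "s \<in> I" for s
  proof -
    have "A (u0, v0) = w0" using fixpt[of "(u0, v0)"] c by simp
    then show ?thesis using fixpt[of "(s, v0)"] that c by (simp add: R_def B_def)
  qed
  have R_int: "R (s, t) = dint v0 t (\<lambda>t. V (s, t) (R (s, t)) - dint u0 s (\<lambda>s. Vu (s, t) (R (s, t))))"
    if "s \<in> I" "t \<in> J" for s t
    using dint_eq[OF dR[OF that(1), unfolded J_def] c(2)[unfolded J_def] that(2)[unfolded J_def]]
      R_init[OF that(1)] by simp
  \<comment> \<open>This replaces Gronwall's inequality: at a maximum of \<open>norm R\<close> the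
    integral equation gives \<open>S \<le> r * (2 * (M * S)) \<le> S / 2\<close>. One
    \<open>M * S\<close> bounds the term with \<open>V\<close>, the other the inner integral of
    \<open>Vu R\<close>, whose length is at most \<open>r \<le> 1\<close>.\<close>
  have "compact (I \<times> J)" "I \<times> J \<noteq> {}"
    using c unfolding I_def J_def by (auto intro: compact_Times)
  then obtain q where q: "q \<in> I \<times> J" and max: "\<And>p. p \<in> I \<times> J \<Longrightarrow> norm (R p) \<le> norm (R q)"
    using continuous_attains_sup[of "I \<times> J" "\<lambda>p. norm (R p)"] continuous_on_norm[OF R] by blast
  define S where "S = norm (R q)"
  obtain s t where st: "q = (s, t)" by (cases q)
  then have s: "s \<in> I" and t: "t \<in> J" using q by auto
  have M0: "M \<ge> 0" using M(1)[OF q] by (rule order_trans[OF norm_ge_zero])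
  have S0: "S \<ge> 0" by (simp add: S_def)
  have bound: "norm (W p (R p)) \<le> M * S" if "norm (W p) \<le> M" "p \<in> I \<times> J" for W :: "real \<times> real \<Rightarrow> 'b \<Rightarrow>\<^sub>L 'b" and p
    using norm_blinfun[of "W p" "R p"] mult_mono[OF that(1) max[OF that(2)] M0 norm_ge_zero] by (simp add: S_def)
  have inner: "norm (dint u0 s (\<lambda>s. Vu (s, t) (R (s, t)))) \<le> M * S" if "t \<in> J" for t
  proof -
    have "norm (dint u0 s (\<lambda>s. Vu (s, t) (R (s, t)))) \<le> \<bar>s - u0\<bar> * (M * S)"
      by (rule norm_dint_le[OF sliceu[OF app[OF Vu R] that, unfolded I_def] c(1)[unfolded I_def] s[unfolded I_def]])
        (rule bound, rule M, use that in \<open>auto simp: I_def\<close>)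
    also have "\<dots> \<le> 1 * (M * S)"
      using s r M0 S0 by (intro mult_right_mono) (auto simp: I_def)
    finally show ?thesis by simp
  qed
  have "norm (dint v0 t (\<lambda>t. V (s, t) (R (s, t)) - dint u0 s (\<lambda>s. Vu (s, t) (R (s, t))))) \<le> \<bar>t - v0\<bar> * (2 * (M * S))"
  proof (rule norm_dint_le[where l = "v0 - r" and r = "v0 + r"])
    show "continuous_on {v0 - r..v0 + r} (\<lambda>t. V (s, t) (R (s, t)) - dint u0 s (\<lambda>s. Vu (s, t) (R (s, t))))"
      unfolding J_def[symmetric]
      by (rule slicev[OF continuous_on_diff[OF app[OF V R] dint_cont[OF app[OF Vu R]]] s, unfolded fst_conv snd_conv])
    show "norm (V (s, t) (R (s, t)) - dint u0 s (\<lambda>s. Vu (s, t) (R (s, t)))) \<le> 2 * (M * S)"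
      if "t \<in> {v0 - r..v0 + r}" for t
    proof -
      have tJ: "t \<in> J" using that by (simp add: J_def)
      have "norm (V (s, t) (R (s, t))) \<le> M * S" using M(2) s tJ by (intro bound) auto
      with inner[OF tJ] show ?thesis
        using norm_triangle_ineq4[of "V (s, t) (R (s, t))" "dint u0 s (\<lambda>s. Vu (s, t) (R (s, t)))"] by linarith
    qed
  qed (use c t in \<open>auto simp: J_def\<close>)
  also have "\<dots> \<le> r * (2 * (M * S))"
    using t r M0 S0 by (intro mult_right_mono) (auto simp: J_def)
  also have "\<dots> = (2 * (r * M)) * S" by simp
  also have "\<dots> \<le> 1/2 * S" using rM S0 by (intro mult_right_mono) auto
  finally have "S \<le> 1/2 * S" using R_int[OF s t] by (simp add: S_def st)
  with S0 have "S = 0" by simp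
  then have AB: "A p = B p" if "p \<in> I \<times> J" for p
    using max[OF that] by (simp add: S_def R_def)
  have "A (u0, v0) = w0" using fixpt[of "(u0, v0)"] c by simp
  moreover have "((\<lambda>s. A (s, t)) has_vector_derivative U (s, t) (A (s, t))) (at s within I)"
    if "s \<in> I" "t \<in> J" for s t
    by (rule has_vector_derivative_transform[OF that(1) _ dBu[OF that]]) (use AB that in simp)
  ultimately show thesis using that[OF A _ _ dA] by blast
qed

text \<open>\<open>compat\<close> is equality of the mixed derivatives of a solution, required for
  every value \<open>x\<close> of it. The bounds on \<open>U\<close>, \<open>V\<close> and
  \<open>Du V\<close> come from compactness of a closed square in \<open>D\<close>; the solution is
  then restricted to an open square, where derivatives within the closed sides are full
  derivatives.\<close>

lemma total_linear_system:
  fixes U V :: "real \<times> real \<Rightarrow> 'b::banach \<Rightarrow>\<^sub>L 'b"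
  assumes D: "open D" and p0: "p0 \<in> D" and U: "Ck_on 1 D U" and V: "Ck_on 1 D V"
    and compat: "\<And>q x. q \<in> D \<Longrightarrow> Dv U q x + U q (V q x) = Du V q x + V q (U q x)"
  obtains C W where "param_domain C" "p0 \<in> C" "C \<subseteq> D" "W p0 = w0" "continuous_on C W"
    "partials C W (\<lambda>q. U q (W q)) (\<lambda>q. V q (W q))"
proof -
  obtain u0 v0 where p0_eq: "p0 = (u0, v0)" by (cases p0)
  obtain R where R: "R > 0" and sub: "{u0 - R..u0 + R} \<times> {v0 - R..v0 + R} \<subseteq> D"
    using open_imp_square_subset[OF D] p0 p0_eq by blast
  have pU: "partials D U (Du U) (Dv U)" and pV: "partials D V (Du V) (Dv V)"
    using Ck_on_Suc_partials[OF D, of 0] U V by simp_all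
  have cont: "continuous_on D U" "continuous_on D V" "continuous_on D (Dv U)" "continuous_on D (Du V)"
    using U V Ck_on_imp_continuous_on[OF U] Ck_on_imp_continuous_on[OF V] by (simp_all add: One_nat_def)
  have K: "compact ({u0 - R..u0 + R} \<times> {v0 - R..v0 + R})" by (intro compact_Times compact_Icc)
  have bdd: "\<exists>m. \<forall>q\<in>{u0 - R..u0 + R} \<times> {v0 - R..v0 + R}. norm (h q) \<le> m"
    if "continuous_on D h" for h :: "real \<times> real \<Rightarrow> 'b \<Rightarrow>\<^sub>L 'b"
    using compact_imp_bounded[OF compact_continuous_image[OF continuous_on_subset[OF that sub] K]]
    unfolding bounded_iff by blast
  obtain m1 m2 m3 where m: "\<And>q. q \<in> {u0 - R..u0 + R} \<times> {v0 - R..v0 + R} \<Longrightarrow> norm (U q) \<le> m1"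
    "\<And>q. q \<in> {u0 - R..u0 + R} \<times> {v0 - R..v0 + R} \<Longrightarrow> norm (V q) \<le> m2"
    "\<And>q. q \<in> {u0 - R..u0 + R} \<times> {v0 - R..v0 + R} \<Longrightarrow> norm (Du V q) \<le> m3"
    using bdd[OF cont(1)] bdd[OF cont(2)] bdd[OF cont(4)] by blast
  define M where "M = max 1 (max m1 (max m2 m3))"
  \<comment> \<open>\<open>1\<close> and \<open>1 / (4 * M)\<close> are the bounds that the previous
    lemma puts on the half side; \<open>R\<close> keeps the square inside \<open>D\<close>.\<close>
  define r where "r = min (min 1 R) (1 / (4 * M))"
  have M1: "M \<ge> 1" by (simp add: M_def)
  have r: "r > 0" "r \<le> 1" "r \<le> R" using R M1 by (auto simp: r_def)
  have "r \<le> 1 / (4 * M)" by (simp add: r_def)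
  then have rM: "4 * (r * M) \<le> 1" using M1 by (simp add: field_simps)
  let ?I = "{u0 - r..u0 + r}" and ?J = "{v0 - r..v0 + r}"
  have subR: "?I \<times> ?J \<subseteq> {u0 - R..u0 + R} \<times> {v0 - R..v0 + R}" using r by (intro Sigma_mono) auto
  then have subD: "?I \<times> ?J \<subseteq> D" using sub by (rule subset_trans)
  have MM: "norm (U q) \<le> M" "norm (V q) \<le> M" "norm (Du V q) \<le> M" if "q \<in> ?I \<times> ?J" for q
    using m[OF subsetD[OF subR that]] by (auto simp: M_def)
  have dU: "((\<lambda>t. U (s, t)) has_vector_derivative Dv U (s, t)) (at t within ?J)" if "s \<in> ?I" "t \<in> ?J" for s t
    using subsetD[OF subD SigmaI[OF that]] by (rule partials_within_v[OF pU])
  have dV: "((\<lambda>s. V (s, t)) has_vector_derivative Du V (s, t)) (at s within ?I)" if "s \<in> ?I" "t \<in> ?J" for s t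
    using subsetD[OF subD SigmaI[OF that]] by (rule partials_within_u[OF pV])
  define C where "C = {u0 - r<..<u0 + r} \<times> {v0 - r<..<v0 + r}"
  have C: "C \<subseteq> ?I \<times> ?J" by (auto simp: C_def)
  show thesis
  proof (rule total_linear_system_square[OF r(1,2) cont[THEN continuous_on_subset, OF subD] dU dV MM rM
        compat[OF subsetD[OF subD]], of w0])
    fix A :: "real \<times> real \<Rightarrow> 'b"
    assume A: "continuous_on (?I \<times> ?J) A" "A (u0, v0) = w0"
      "\<And>s t. s \<in> ?I \<Longrightarrow> t \<in> ?J \<Longrightarrow> ((\<lambda>s. A (s, t)) has_vector_derivative U (s, t) (A (s, t))) (at s within ?I)"
      "\<And>s t. s \<in> ?I \<Longrightarrow> t \<in> ?J \<Longrightarrow> ((\<lambda>t. A (s, t)) has_vector_derivative V (s, t) (A (s, t))) (at t within ?J)"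
    show thesis
    proof (rule that[of C A])
      show "param_domain C"
        using r unfolding param_domain_def C_def
        by (auto intro!: open_Times connected_Times connected_Ioo)
      show "p0 \<in> C" using r by (simp add: C_def p0_eq)
      show "C \<subseteq> D" using C subD by (rule subset_trans)
      show "A p0 = w0" using A(2) p0_eq by simp
      show "continuous_on C A" using A(1) C by (rule continuous_on_subset)
      show "partials C A (\<lambda>q. U q (A q)) (\<lambda>q. V q (A q))"
        unfolding partials_def
      proof (intro ballI conjI)
        fix q assume "q \<in> C"
        then obtain s t where q: "q = (s, t)" "s \<in> interior ?I" "t \<in> interior ?J" by (auto simp: C_def)
        then have "s \<in> ?I" "t \<in> ?J" using interior_subset by blast+
        from A(3,4)[OF this, unfolded at_within_interior[OF q(2)] at_within_interior[OF q(3)]]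
        show "((\<lambda>s. A (s, snd q)) has_vector_derivative U q (A q)) (at (fst q))"
          "((\<lambda>t. A (fst q, t)) has_vector_derivative V q (A q)) (at (snd q))"
          by (simp_all add: q(1))
      qed
    qed
  qed
qed

section \<open>Frames in Minkowski space\<close>

lemma mink_commute: "mink x y = mink y x"
  by (simp add: mink_def algebra_simps)

lemma bounded_bilinear_mink: "bounded_bilinear mink"
  unfolding bilinear_conv_bounded_bilinear[symmetric] bilinear_def linear_iff
  by (simp add: mink_def algebra_simps)

interpretation mink: bounded_bilinear mink
  by (rule bounded_bilinear_mink)

lemmas mink_bilinear_simps = mink.add_left mink.add_right mink.diff_left mink.diff_right
  mink.minus_left mink.minus_right mink.scaleR_left mink.scaleR_right

lemma mink_nondegenerate:
  assumes "\<And>y. mink x y = 0"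
  shows "x = 0"
  using assms[of "vector [1, 0, 0]"] assms[of "vector [0, 1, 0]"] assms[of "vector [0, 0, 1]"]
  by (simp add: vec_eq_iff forall_3 mink_def)

text \<open>The Lorentzian cross product: the Euclidean one with its third component negated, so
  that its Minkowski product with a third vector is the determinant.\<close>

definition mcross :: "real^3 \<Rightarrow> real^3 \<Rightarrow> real^3" where
  "mcross x y = vector [x$2 * y$3 - x$3 * y$2, x$3 * y$1 - x$1 * y$3, x$2 * y$1 - x$1 * y$2]"

lemma bounded_bilinear_mcross: "bounded_bilinear mcross"
  unfolding bilinear_conv_bounded_bilinear[symmetric] bilinear_def linear_iff
  by (simp add: mcross_def vec_eq_iff forall_3 algebra_simps)

interpretation mcross: bounded_bilinear mcross
  by (rule bounded_bilinear_mcross)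

lemma det_vector_3:
  "det (vector [x, y, w] :: real^3^3) = x$1 * y$2 * w$3 + x$2 * y$3 * w$1 + x$3 * y$1 * w$2
     - x$1 * y$3 * w$2 - x$2 * y$1 * w$3 - x$3 * y$2 * w$1"
  by (simp add: det_3)

lemma mink_mcross: "mink (mcross x y) w = det (vector [x, y, w] :: real^3^3)"
  by (simp add: mink_def mcross_def det_vector_3 algebra_simps)

lemma mink_mcross_left [simp]: "mink (mcross x y) x = 0" and mink_mcross_right [simp]: "mink (mcross x y) y = 0"
  by (simp_all add: mink_mcross det_vector_3)

lemma mcross_self [simp]: "mcross x x = 0"
  by (simp add: mcross_def vec_eq_iff forall_3)

text \<open>Lagrange's identity. In this signature its sign is opposite to the Euclidean one, which
  makes the normal of a time-like plane space-like.\<close>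

lemma mink_mcross_mcross: "mink (mcross x y) (mcross x y) = (mink x y)\<^sup>2 - mink x x * mink y y"
  by (simp add: mink_def mcross_def power2_eq_square algebra_simps)

definition mink_frame :: "real^3 \<Rightarrow> real^3 \<Rightarrow> real^3 \<Rightarrow> bool" where
  "mink_frame X Y l \<longleftrightarrow> mink X X = -1 \<and> mink Y Y = 1 \<and> mink l l = 1 \<and>
     mink X Y = 0 \<and> mink X l = 0 \<and> mink Y l = 0 \<and> det (vector [X, Y, l] :: real^3^3) = 1"

lemma mink_orthogonal_imp_zero:
  assumes "det (vector [X, Y, l] :: real^3^3) \<noteq> 0" "mink w X = 0" "mink w Y = 0" "mink w l = 0"
  shows "w = 0"
proof -
  let ?W = "vector [X, Y, l] :: real^3^3"
  \<comment> \<open>Negating the time component turns Minkowski products with the rows of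
    \<open>?W\<close> into Euclidean ones, so \<open>?v\<close> lies in the kernel of an invertible
    matrix.\<close>
  let ?v = "vector [w$1, w$2, - w$3] :: real^3"
  have "?W *v ?v = 0"
    using assms(2-4) by (simp add: vec_eq_iff forall_3 matrix_vector_mult_def sum_3 mink_def algebra_simps)
  then have "?v = 0"
    using assms(1) invertible_det_nz matrix_left_invertible_ker invertible_left_inverse by blast
  then show ?thesis by (simp add: vec_eq_iff forall_3)
qed

lemma mink_frame_expansion:
  assumes "mink_frame X Y l"
  shows "w = - mink w X *\<^sub>R X + mink w Y *\<^sub>R Y + mink w l *\<^sub>R l"
proof -
  have "w - (- mink w X *\<^sub>R X + mink w Y *\<^sub>R Y + mink w l *\<^sub>R l) = 0"
    using assms by (intro mink_orthogonal_imp_zero[of X Y l])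
      (simp_all add: mink_frame_def mink_bilinear_simps mink_commute[of Y X] mink_commute[of l X] mink_commute[of l Y])
  then show ?thesis by simp
qed

lemma mink_frame_parseval:
  assumes "mink_frame X Y l"
  shows "mink x y = - mink x X * mink y X + mink x Y * mink y Y + mink x l * mink y l"
  by (subst mink_frame_expansion[OF assms, of x])
    (simp add: mink_bilinear_simps mink_commute[of X y] mink_commute[of Y y] mink_commute[of l y])

lemma mink_frame_mcross:
  assumes "mink X X = -1" "mink Y Y = 1" "mink X Y = 0"
  shows "mink_frame X Y (mcross X Y)"
  using assms mink_mcross_mcross[of X Y] mink_mcross[of X Y "mcross X Y"]
  by (simp add: mink_frame_def mink_commute[of X "mcross X Y"] mink_commute[of Y "mcross X Y"])

text \<open>
  Along a frame system the right-hand side of \<open>parseval\<close> has derivative zero, whereas the Gram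
  matrix of the frame only satisfies a linear differential equation.
\<close>

lemma mink_frameI_parseval:
  assumes parseval: "\<And>x y. mink x y = - mink x X * mink y X + mink x Y * mink y Y + mink x l * mink y l"
    and det: "det (vector [X, Y, l] :: real^3^3) = 1"
  shows "mink_frame X Y l"
proof -
  have expansion: "w = - mink w X *\<^sub>R X + mink w Y *\<^sub>R Y + mink w l *\<^sub>R l" for w
  proof -
    have "mink (w - (- mink w X *\<^sub>R X + mink w Y *\<^sub>R Y + mink w l *\<^sub>R l)) y = 0" for y
      using parseval[of w y] by (simp add: mink_bilinear_simps mink_commute[of X y] mink_commute[of Y y] mink_commute[of l y])
    from mink_nondegenerate[OF this] show ?thesis by simp
  qed
  \<comment> \<open>Cramer's rule, which makes coordinates with respect to \<open>X\<close>,
    \<open>Y\<close>, \<open>l\<close> unique. Comparing each frame vector with its own expansion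
    then yields the Gram matrix.\<close>
  have det_comb: "det (vector [a *\<^sub>R X + b *\<^sub>R Y + c *\<^sub>R l, Y, l] :: real^3^3) = a * det (vector [X, Y, l] :: real^3^3)"
    "det (vector [X, a *\<^sub>R X + b *\<^sub>R Y + c *\<^sub>R l, l] :: real^3^3) = b * det (vector [X, Y, l] :: real^3^3)"
    "det (vector [X, Y, a *\<^sub>R X + b *\<^sub>R Y + c *\<^sub>R l] :: real^3^3) = c * det (vector [X, Y, l] :: real^3^3)" for a b c
    unfolding det_vector_3 by (simp_all add: algebra_simps)
  have uniq: "a = a' \<and> b = b' \<and> c = c'"
    if "a *\<^sub>R X + b *\<^sub>R Y + c *\<^sub>R l = a' *\<^sub>R X + b' *\<^sub>R Y + c' *\<^sub>R l" for a b c a' b' c'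
    using det_comb[of a b c] det_comb[of a' b' c'] unfolding that det by simp
  show ?thesis
    using uniq[of "- mink X X" "mink X Y" "mink X l" 1 0 0] expansion[of X, symmetric]
      uniq[of "- mink Y X" "mink Y Y" "mink Y l" 0 1 0] expansion[of Y, symmetric]
      uniq[of "- mink l X" "mink l Y" "mink l l" 0 0 1] expansion[of l, symmetric] det
    by (simp add: mink_frame_def)
qed

section \<open>Frame systems and congruence\<close>

lemmas partials_mink = partials_bilinear[OF bounded_bilinear_mink]
lemmas partials_scaleR = partials_bilinear[OF bounded_bilinear_scaleR]
lemmas partials_mult = partials_bilinear[OF bounded_bilinear_mult]

lemma mink_const_partials:
  assumes D: "open D" and h: "partials D h hu hv" and k: "partials D k ku kv"
    and const: "\<And>p. p \<in> D \<Longrightarrow> mink (h p) (k p) = c" and p: "p \<in> D"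
  shows "mink (h p) (ku p) + mink (hu p) (k p) = 0" "mink (h p) (kv p) + mink (hv p) (k p) = 0"
proof -
  have "partials D (\<lambda>_. c) (\<lambda>p. mink (h p) (ku p) + mink (hu p) (k p)) (\<lambda>p. mink (h p) (kv p) + mink (hv p) (k p))"
    by (rule partials_cong[OF D const partials_mink[OF h k]])
  from partials_Du[OF this p] partials_Dv[OF this p] partials_Du[OF partials_const p, of c] partials_Dv[OF partials_const p, of c]
  show "mink (h p) (ku p) + mink (hu p) (k p) = 0" "mink (h p) (kv p) + mink (hv p) (k p) = 0" by simp_all
qed

definition frame_system ::
  "(real \<times> real) set \<Rightarrow> (real \<times> real \<Rightarrow> real) \<Rightarrow> (real \<times> real \<Rightarrow> real) \<Rightarrow> (real \<times> real \<Rightarrow> real) \<Rightarrow>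
   (real \<times> real \<Rightarrow> real) \<Rightarrow> (real \<times> real \<Rightarrow> real) \<Rightarrow> (real \<times> real \<Rightarrow> real) \<Rightarrow>
   (real \<times> real \<Rightarrow> real^3) \<Rightarrow> (real \<times> real \<Rightarrow> real^3) \<Rightarrow> (real \<times> real \<Rightarrow> real^3) \<Rightarrow> bool" where
  "frame_system D P Q g1 g2 n1 n2 X Y l \<longleftrightarrow>
     partials D X (\<lambda>p. (P p * g1 p) *\<^sub>R Y p - (P p * n1 p) *\<^sub>R l p) (\<lambda>p. - (Q p * g2 p) *\<^sub>R Y p) \<and>
     partials D Y (\<lambda>p. (P p * g1 p) *\<^sub>R X p) (\<lambda>p. (Q p * n2 p) *\<^sub>R l p - (Q p * g2 p) *\<^sub>R X p) \<and>
     partials D l (\<lambda>p. - (P p * n1 p) *\<^sub>R X p) (\<lambda>p. - (Q p * n2 p) *\<^sub>R Y p)"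

lemma frame_system_cong:
  assumes "frame_system D P Q g1 g2 n1 n2 X Y l"
    and "\<And>p. p \<in> D \<Longrightarrow> P p = P' p" "\<And>p. p \<in> D \<Longrightarrow> Q p = Q' p"
      "\<And>p. p \<in> D \<Longrightarrow> g1 p = g1' p" "\<And>p. p \<in> D \<Longrightarrow> g2 p = g2' p"
      "\<And>p. p \<in> D \<Longrightarrow> n1 p = n1' p" "\<And>p. p \<in> D \<Longrightarrow> n2 p = n2' p"
  shows "frame_system D P' Q' g1' g2' n1' n2' X Y l"
  using assms unfolding frame_system_def partials_def by simp

text \<open>For fixed \<open>x\<close> the vector \<open>T p x\<close> has derivative zero: both
  frames obey the same coefficient matrix, which is skew for the form with signs -, +, +, so the
  terms from differentiating \<open>X\<close>, \<open>Y\<close>, \<open>l\<close> cancel those from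
  differentiating \<open>X'\<close>, \<open>Y'\<close>, \<open>l'\<close>.\<close>

lemma frame_system_congruent:
  assumes D: "param_domain D" and p0: "p0 \<in> D"
    and F: "frame_system D P Q g1 g2 n1 n2 X Y l" "\<And>p. p \<in> D \<Longrightarrow> mink_frame (X p) (Y p) (l p)"
    and F': "frame_system D P Q g1 g2 n1 n2 X' Y' l'" "\<And>p. p \<in> D \<Longrightarrow> mink_frame (X' p) (Y' p) (l' p)"
  obtains A :: "real^3^3" where "\<And>x y. mink (A *v x) (A *v y) = mink x y" "det A = 1"
    "\<And>p. p \<in> D \<Longrightarrow> X' p = A *v X p" "\<And>p. p \<in> D \<Longrightarrow> Y' p = A *v Y p"
proof -
  have D': "open D" "connected D" using D by (auto simp: param_domain_def)
  define T where "T p x = - mink x (X p) *\<^sub>R X' p + mink x (Y p) *\<^sub>R Y' p + mink x (l p) *\<^sub>R l' p" for p x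
  note P = F(1)[unfolded frame_system_def, THEN conjunct1] F(1)[unfolded frame_system_def, THEN conjunct2, THEN conjunct1]
    F(1)[unfolded frame_system_def, THEN conjunct2, THEN conjunct2]
  note P' = F'(1)[unfolded frame_system_def, THEN conjunct1] F'(1)[unfolded frame_system_def, THEN conjunct2, THEN conjunct1]
    F'(1)[unfolded frame_system_def, THEN conjunct2, THEN conjunct2]
  have "partials D (\<lambda>p. T p x) (\<lambda>_. 0) (\<lambda>_. 0)" for x
  proof -
    have *: "partials D (\<lambda>p. mink x (h p)) (\<lambda>p. mink x (hu p)) (\<lambda>p. mink x (hv p))" if "partials D h hu hv" for h hu hv
      by (rule partials_linear[OF mink.bounded_linear_right that])
    show ?thesis unfolding T_def
      by (rule partials_eq_rhs[OF partials_add[OF partials_add[OF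
           partials_scaleR[OF partials_linear[OF bounded_linear_minus[OF bounded_linear_ident] *[OF P(1)]] P'(1)]
           partials_scaleR[OF *[OF P(2)] P'(2)]] partials_scaleR[OF *[OF P(3)] P'(3)]]])
        (simp_all add: mink_bilinear_simps algebra_simps)
  qed
  then have T_const: "T p x = T p0 x" if "p \<in> D" for p x
    using partials_zero_imp_const[OF D', of "\<lambda>p. T p x" p p0] that p0 by blast
  have T_frame: "T p (X p) = X' p" "T p (Y p) = Y' p" "T p (l p) = l' p" if "p \<in> D" for p
    using F(2)[OF that] unfolding T_def mink_frame_def
    by (simp_all add: mink_commute[of "Y p" "X p"] mink_commute[of "l p" "X p"] mink_commute[of "l p" "Y p"])
  have "linear (T p0)"
    by (rule linearI) (simp_all add: T_def mink_bilinear_simps algebra_simps)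
  then have A: "matrix (T p0) *v x = T p0 x" for x
    by (rule fun_cong[OF matrix_vector_mul(2)])
  show thesis
  proof (rule that[of "matrix (T p0)"])
    show "mink (matrix (T p0) *v x) (matrix (T p0) *v y) = mink x y" for x y
      using F'(2)[OF p0] unfolding A mink_frame_parseval[OF F(2)[OF p0], of x y]
      by (simp add: T_def mink_bilinear_simps mink_frame_def mink_commute[of "Y' p0" "X' p0"]
          mink_commute[of "l' p0" "X' p0"] mink_commute[of "l' p0" "Y' p0"])
    \<comment> \<open>The frame vectors are rows, so the linear map acts on them by its transpose
      from the right. Both frames have determinant 1, and hence so has the map.\<close>
    have "(vector [X p0, Y p0, l p0] :: real^3^3) ** transpose (matrix (T p0)) = vector [X' p0, Y' p0, l' p0]"
    proof -
      have "((vector [X p0, Y p0, l p0] :: real^3^3) ** transpose (matrix (T p0))) $ i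
          = matrix (T p0) *v ((vector [X p0, Y p0, l p0] :: real^3^3) $ i)" for i
        by (simp add: vec_eq_iff matrix_matrix_mult_def matrix_vector_mult_def transpose_def mult.commute)
      then show ?thesis unfolding A using T_frame[OF p0] by (subst vec_eq_iff) (simp add: forall_3)
    qed
    from arg_cong[OF this, of det] show "det (matrix (T p0)) = 1"
      using F(2)[OF p0] F'(2)[OF p0] by (simp add: det_mul mink_frame_def)
    show "X' p = matrix (T p0) *v X p" "Y' p = matrix (T p0) *v Y p" if "p \<in> D" for p
      using T_frame[OF that] T_const[OF that] unfolding A by simp_all
  qed
qed

lemma frame_system_motion:
  assumes D: "param_domain D" and p0: "p0 \<in> D"
    and F: "frame_system D P Q g1 g2 n1 n2 X Y l" "\<And>p. p \<in> D \<Longrightarrow> mink_frame (X p) (Y p) (l p)"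
    and F': "frame_system D P Q g1 g2 n1 n2 X' Y' l'" "\<And>p. p \<in> D \<Longrightarrow> mink_frame (X' p) (Y' p) (l' p)"
    and z: "partials D z (\<lambda>p. P p *\<^sub>R X p) (\<lambda>p. Q p *\<^sub>R Y p)"
    and z': "partials D z' (\<lambda>p. P p *\<^sub>R X' p) (\<lambda>p. Q p *\<^sub>R Y' p)"
  shows "\<exists>T. motion T \<and> (\<forall>p\<in>D. z' p = T (z p))"
proof -
  obtain A :: "real^3^3" where A: "\<And>x y. mink (A *v x) (A *v y) = mink x y" "det A = 1"
    "\<And>p. p \<in> D \<Longrightarrow> X' p = A *v X p" "\<And>p. p \<in> D \<Longrightarrow> Y' p = A *v Y p"
    using frame_system_congruent[OF D p0 F F'] by blast
  have lin: "bounded_linear ((*v) A)" by (simp add: matrix_vector_mul_bounded_linear)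
  have "partials D (\<lambda>p. z' p - A *v z p) (\<lambda>_. 0) (\<lambda>_. 0)"
    by (rule partials_eq_rhs[OF partials_diff[OF z' partials_linear[OF lin z]]])
      (simp_all add: A(3,4) linear_cmul[OF bounded_linear.linear[OF lin]])
  then have "z' p - A *v z p = z' p0 - A *v z p0" if "p \<in> D" for p
    using D partials_zero_imp_const[of D "\<lambda>p. z' p - A *v z p" p p0] that p0 by (auto simp: param_domain_def)
  then have "z' p = A *v z p + (z' p0 - A *v z p0)" if "p \<in> D" for p
    using that by (simp add: algebra_simps)
  moreover have "motion (\<lambda>x. A *v x + (z' p0 - A *v z p0))"
    using A(1,2) unfolding motion_def by blast
  ultimately show ?thesis by blast
qed

text \<open>The normal line is spanned by the cross product of the two tangent frame vectors; unit
  length leaves two candidates and the sign of the determinant selects one. The explicit formula is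
  what makes the normal, a pointwise description, accessible to differentiation.\<close>

lemma unit_normal_eq:
  assumes "cE z p < 0" "cG z p > 0" "cF z p = 0"
  shows "unit_normal z p = mcross (frameX z p) (frameY z p)"
    and "mink_frame (frameX z p) (frameY z p) (unit_normal z p)"
proof -
  have "mink (frameX z p) (frameX z p) = -1" "mink (frameY z p) (frameY z p) = 1" "mink (frameX z p) (frameY z p) = 0"
    using assms unfolding frameX_def frameY_def mink_bilinear_simps
    by (simp_all add: cE_def cF_def cG_def field_simps)
  then have F: "mink_frame (frameX z p) (frameY z p) (mcross (frameX z p) (frameY z p))"
    by (rule mink_frame_mcross)
  have z: "Du z p = sqrt (- cE z p) *\<^sub>R frameX z p" "Dv z p = sqrt (cG z p) *\<^sub>R frameY z p"
    using assms by (simp_all add: frameX_def frameY_def)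
  show "unit_normal z p = mcross (frameX z p) (frameY z p)"
    unfolding unit_normal_def
  proof (rule the_equality)
    show "mink (mcross (frameX z p) (frameY z p)) (mcross (frameX z p) (frameY z p)) = 1 \<and>
        mink (mcross (frameX z p) (frameY z p)) (Du z p) = 0 \<and> mink (mcross (frameX z p) (frameY z p)) (Dv z p) = 0 \<and>
        0 < det (vector [frameX z p, frameY z p, mcross (frameX z p) (frameY z p)] :: real^3^3)"
      using F unfolding z mink_bilinear_simps by (simp add: mink_frame_def)
  next
    fix n assume n: "mink n n = 1 \<and> mink n (Du z p) = 0 \<and> mink n (Dv z p) = 0 \<and>
        0 < det (vector [frameX z p, frameY z p, n] :: real^3^3)"
    define c where "c = mink n (mcross (frameX z p) (frameY z p))"
    have "mink n (frameX z p) = 0" "mink n (frameY z p) = 0"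
      using n assms unfolding z mink_bilinear_simps by simp_all
    then have nc: "n = c *\<^sub>R mcross (frameX z p) (frameY z p)"
      using mink_frame_expansion[OF F, of n] by (simp add: c_def)
    have "c > 0"
      using n mink_commute[of n "mcross (frameX z p) (frameY z p)"] unfolding c_def mink_mcross[symmetric] by simp
    moreover have "c * c = 1"
      using n F unfolding nc mink_bilinear_simps by (simp add: mink_frame_def)
    ultimately have "c = 1" using power2_eq_1_iff[of c] by (simp add: power2_eq_square)
    then show "n = mcross (frameX z p) (frameY z p)" using nc by simp
  qed
  then show "mink_frame (frameX z p) (frameY z p) (unit_normal z p)" using F by simp
qed

section \<open>The equations of Gauss, Weingarten and Codazzi\<close>

lemma Ck_on_1_sqrt:
  assumes D: "open D" and h: "Ck_on 1 D h" and pos: "\<And>p. p \<in> D \<Longrightarrow> h p > 0"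
  shows "Ck_on 1 D (\<lambda>p. sqrt (h p))"
proof (rule Ck_on_1_chain[where S = "{0<..}" and \<phi> = sqrt and \<phi>' = "\<lambda>t. inverse (sqrt t) / 2"])
  show "(sqrt has_real_derivative inverse (sqrt t) / 2) (at t within {0<..})" if "t \<in> {0<..}" for t
    using DERIV_real_sqrt[of t] that by (simp add: has_field_derivative_at_within)
  show "continuous_on {0<..} (\<lambda>t. inverse (sqrt t) / 2)"
    by (intro continuous_intros) auto
qed (use assms in auto)

lemma Ck_on_1_inverse:
  assumes D: "open D" and h: "Ck_on 1 D h" and pos: "\<And>p. p \<in> D \<Longrightarrow> h p > (0::real)"
  shows "Ck_on 1 D (\<lambda>p. inverse (h p))"
proof (rule Ck_on_1_chain[where S = "{0<..}" and \<phi> = inverse and \<phi>' = "\<lambda>t. - (inverse t)\<^sup>2"])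
  show "(inverse has_real_derivative - (inverse t)\<^sup>2) (at t within {0<..})" if "t \<in> {0<..}" for t
    using DERIV_inverse[of t "{0<..}"] that by (simp add: numeral_2_eq_2)
  show "continuous_on {0<..} (\<lambda>t. - (inverse t)\<^sup>2 :: real)"
    by (intro continuous_intros) auto
qed (use assms in auto)

text \<open>The differentiated Gram relations leave three unknown products in each direction.
  \<open>z_uu\<close> and \<open>z_vv\<close> give \<open>X_u\<close> and \<open>Y_v\<close> paired
  with \<open>l\<close>; the other four come from \<open>M = 0\<close> and from equating the two
  expressions for \<open>z_uv\<close> obtained from \<open>z_u = P X\<close> and
  \<open>z_v = Q Y\<close>. The third conclusion prepares the Codazzi equations.\<close>

lemma timelike_surface_frame:
  fixes z :: "real \<times> real \<Rightarrow> real^3"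
  defines "P \<equiv> (\<lambda>p. sqrt (- cE z p))" and "Q \<equiv> (\<lambda>p. sqrt (cG z p))"
  assumes surf: "timelike_surface D z" and prin: "principal_params D z"
  shows "frame_system D P Q (gamma1 z) (gamma2 z) (nu1 z) (nu2 z) (frameX z) (frameY z) (unit_normal z)"
    and "partials D z (\<lambda>p. P p *\<^sub>R frameX z p) (\<lambda>p. Q p *\<^sub>R frameY z p)"
    and "\<And>p. p \<in> D \<Longrightarrow> Dv (Du z) p = (P p * Q p * gamma1 z p) *\<^sub>R frameX z p - (P p * Q p * gamma2 z p) *\<^sub>R frameY z p"
proof -
  have D: "open D" and z: "Ck_on 3 D z" and EG: "\<And>p. p \<in> D \<Longrightarrow> cE z p < 0" "\<And>p. p \<in> D \<Longrightarrow> cG z p > 0"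
    using surf by (auto simp: timelike_surface_def param_domain_def)
  have FM: "\<And>p. p \<in> D \<Longrightarrow> cF z p = 0" "\<And>p. p \<in> D \<Longrightarrow> cM z p = 0"
    using prin by (auto simp: principal_params_def)
  have zk: "Ck_on 2 D (Du z)" "Ck_on 2 D (Dv z)" "Ck_on 2 D z" "Ck_on 1 D (Du z)" "Ck_on 1 D (Dv z)"
    using z Ck_on_mono[OF z, of 2] Ck_on_SucD[of 1 D "Du z"] Ck_on_SucD[of 1 D "Dv z"]
    by (simp_all add: numeral_3_eq_3 numeral_2_eq_2)
  let ?X = "frameX z" and ?Y = "frameY z" and ?l = "unit_normal z"
  have E1: "Ck_on 1 D (\<lambda>p. - cE z p)" and G1: "Ck_on 1 D (cG z)"
    using Ck_on_bilinear[OF D bounded_bilinear_mink zk(4,4)] Ck_on_bilinear[OF D bounded_bilinear_mink zk(5,5)]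
      Ck_on_linear[OF D bounded_linear_minus[OF bounded_linear_ident], of 1 "cE z"]
    unfolding cE_def cG_def by simp_all
  have P1: "Ck_on 1 D P" and Q1: "Ck_on 1 D Q"
    unfolding P_def Q_def using Ck_on_1_sqrt[OF D E1] Ck_on_1_sqrt[OF D G1] EG by simp_all
  have PQ: "P p > 0" "Q p > 0" if "p \<in> D" for p using EG[OF that] by (auto simp: P_def Q_def)
  have EP: "cE z p = - (P p * P p)" and GQ: "cG z p = Q p * Q p" if "p \<in> D" for p
    using EG[OF that] by (auto simp: P_def Q_def)
  have X1: "Ck_on 1 D ?X" and Y1: "Ck_on 1 D ?Y"
    using Ck_on_scaleR[OF D Ck_on_1_inverse[OF D P1 PQ(1)] zk(4)] Ck_on_scaleR[OF D Ck_on_1_inverse[OF D Q1 PQ(2)] zk(5)]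
    unfolding frameX_def frameY_def P_def Q_def by simp_all
  have l_eq: "?l p = mcross (?X p) (?Y p)" and frame: "mink_frame (?X p) (?Y p) (?l p)" if "p \<in> D" for p
    using unit_normal_eq EG FM that by blast+
  have l1: "Ck_on 1 D ?l"
    by (rule Ck_on_cong[OF D _ Ck_on_bilinear[OF D bounded_bilinear_mcross X1 Y1]]) (simp add: l_eq)
  have par: "partials D h (Du h) (Dv h)" if "Ck_on 1 D h" for h :: "real \<times> real \<Rightarrow> 'c::real_normed_vector"
    using Ck_on_Suc_partials[OF D, of 0 h] that by simp
  note pX = par[OF X1] and pY = par[OF Y1] and pl = par[OF l1] and pP = par[OF P1] and pQ = par[OF Q1]
  have zu: "Du z p = P p *\<^sub>R ?X p" and zv: "Dv z p = Q p *\<^sub>R ?Y p" if "p \<in> D" for p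
    using PQ[OF that] by (auto simp: frameX_def frameY_def P_def Q_def)
  show pz: "partials D z (\<lambda>p. P p *\<^sub>R frameX z p) (\<lambda>p. Q p *\<^sub>R frameY z p)"
    by (rule partials_eq_rhs[OF Ck_on_Suc_partials[OF D, of 1]]) (use zk zu zv in \<open>simp_all add: numeral_2_eq_2\<close>)
  have pzu: "partials D (Du z) (\<lambda>p. P p *\<^sub>R Du ?X p + Du P p *\<^sub>R ?X p) (\<lambda>p. P p *\<^sub>R Dv ?X p + Dv P p *\<^sub>R ?X p)"
    by (rule partials_cong[OF D _ partials_scaleR[OF pP pX]]) (simp add: zu)
  have pzv: "partials D (Dv z) (\<lambda>p. Q p *\<^sub>R Du ?Y p + Du Q p *\<^sub>R ?Y p) (\<lambda>p. Q p *\<^sub>R Dv ?Y p + Dv Q p *\<^sub>R ?Y p)"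
    by (rule partials_cong[OF D _ partials_scaleR[OF pQ pY]]) (simp add: zv)
  have deriv: "Du ?X p = (P p * gamma1 z p) *\<^sub>R ?Y p - (P p * nu1 z p) *\<^sub>R ?l p \<and>
      Dv ?X p = - (Q p * gamma2 z p) *\<^sub>R ?Y p \<and>
      Du ?Y p = (P p * gamma1 z p) *\<^sub>R ?X p \<and>
      Dv ?Y p = (Q p * nu2 z p) *\<^sub>R ?l p - (Q p * gamma2 z p) *\<^sub>R ?X p \<and>
      Du ?l p = - (P p * nu1 z p) *\<^sub>R ?X p \<and> Dv ?l p = - (Q p * nu2 z p) *\<^sub>R ?Y p \<and>
      Dv P p = P p * Q p * gamma1 z p" if p: "p \<in> D" for p
  proof -
    note fr = frame[OF p, unfolded mink_frame_def]
    note pos = PQ[OF p]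
    have cancel: "P p * a = P p * b \<Longrightarrow> a = b" "Q p * a = Q p * b \<Longrightarrow> a = b" for a b
      using pos by simp_all
    have gram: "mink (?X p) (?X p) = -1" "mink (?Y p) (?Y p) = 1" "mink (?l p) (?l p) = 1"
      "mink (?X p) (?Y p) = 0" "mink (?X p) (?l p) = 0" "mink (?Y p) (?l p) = 0" if "p \<in> D" for p
      using frame[OF that] by (simp_all add: mink_frame_def)
    note sym = mink_commute[of "?Y p" "?X p"] mink_commute[of "?l p" "?X p"] mink_commute[of "?l p" "?Y p"]
      mink_commute[of "?X p" "Du ?X p"] mink_commute[of "?X p" "Dv ?X p"]
      mink_commute[of "?X p" "Du ?Y p"] mink_commute[of "?X p" "Dv ?Y p"]
      mink_commute[of "?X p" "Du ?l p"] mink_commute[of "?X p" "Dv ?l p"]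
      mink_commute[of "?Y p" "Du ?X p"] mink_commute[of "?Y p" "Dv ?X p"]
      mink_commute[of "?Y p" "Du ?Y p"] mink_commute[of "?Y p" "Dv ?Y p"]
      mink_commute[of "?Y p" "Du ?l p"] mink_commute[of "?Y p" "Dv ?l p"]
      mink_commute[of "?l p" "Du ?X p"] mink_commute[of "?l p" "Dv ?X p"]
      mink_commute[of "?l p" "Du ?Y p"] mink_commute[of "?l p" "Dv ?Y p"]
      mink_commute[of "?l p" "Du ?l p"] mink_commute[of "?l p" "Dv ?l p"]
    note const = mink_const_partials[OF D pX pX gram(1) p] mink_const_partials[OF D pY pY gram(2) p]
      mink_const_partials[OF D pl pl gram(3) p] mink_const_partials[OF D pX pY gram(4) p]
      mink_const_partials[OF D pX pl gram(5) p] mink_const_partials[OF D pY pl gram(6) p]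
    have diag: "mink (Du ?X p) (?X p) = 0" "mink (Dv ?X p) (?X p) = 0" "mink (Du ?Y p) (?Y p) = 0"
      "mink (Dv ?Y p) (?Y p) = 0" "mink (Du ?l p) (?l p) = 0" "mink (Dv ?l p) (?l p) = 0"
      using const(1-6) by (simp_all add: sym)
    have off: "mink (Du ?Y p) (?X p) = - mink (Du ?X p) (?Y p)" "mink (Dv ?Y p) (?X p) = - mink (Dv ?X p) (?Y p)"
      "mink (Du ?l p) (?X p) = - mink (Du ?X p) (?l p)" "mink (Dv ?l p) (?X p) = - mink (Dv ?X p) (?l p)"
      "mink (Du ?l p) (?Y p) = - mink (Du ?Y p) (?l p)" "mink (Dv ?l p) (?Y p) = - mink (Dv ?Y p) (?l p)"
      using const(7-12) by (simp_all add: sym)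
    have mixed: "P p *\<^sub>R Dv ?X p + Dv P p *\<^sub>R ?X p = Q p *\<^sub>R Du ?Y p + Du Q p *\<^sub>R ?Y p"
      using Dv_Du_eq_Du_Dv[OF D zk(3) p] unfolding partials_Dv[OF pzu p] partials_Du[OF pzv p] .
    have XvY: "P p * mink (Dv ?X p) (?Y p) = Du Q p"
      using arg_cong[OF mixed, of "\<lambda>w. mink w (?Y p)"] fr diag by (simp add: mink_bilinear_simps)
    have YuX: "Q p * mink (Du ?Y p) (?X p) = - Dv P p"
      using arg_cong[OF mixed, of "\<lambda>w. mink w (?X p)"] fr diag by (simp add: mink_bilinear_simps sym)
    have Xvl: "mink (Dv ?X p) (?l p) = 0"
      using FM(2)[OF p] pos fr unfolding cM_def partials_Dv[OF pzu p]
      by (simp add: mink_bilinear_simps sym)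
    have Yul: "mink (Du ?Y p) (?l p) = 0"
      using arg_cong[OF mixed, of "\<lambda>w. mink w (?l p)"] fr Xvl pos by (simp add: mink_bilinear_simps)
    have L: "nu1 z p * cE z p = P p * mink (Du ?X p) (?l p)"
      using EG[OF p] fr unfolding nu1_def cL_def partials_Du[OF pzu p]
      by (simp add: mink_bilinear_simps sym)
    have N: "nu2 z p * cG z p = Q p * mink (Dv ?Y p) (?l p)"
      using EG[OF p] fr unfolding nu2_def cN_def partials_Dv[OF pzv p]
      by (simp add: mink_bilinear_simps sym)
    have Xul: "mink (Du ?X p) (?l p) = - (P p * nu1 z p)"
    proof -
      have "P p * mink (Du ?X p) (?l p) = P p * (- (P p * nu1 z p))" using L unfolding EP[OF p] by (simp add: algebra_simps)
      then show ?thesis by (rule cancel)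
    qed
    have Yvl: "mink (Dv ?Y p) (?l p) = Q p * nu2 z p"
    proof -
      have "Q p * mink (Dv ?Y p) (?l p) = Q p * (Q p * nu2 z p)" using N unfolding GQ[OF p] by (auto simp: algebra_simps)
      then show ?thesis by (rule cancel)
    qed
    \<comment> \<open>As \<open>E = - P^2\<close> and \<open>G = Q^2\<close>, the definitions of the
      geodesic curvatures amount to \<open>\<gamma>1 = P_v / (P Q)\<close> and
      \<open>\<gamma>2 = - Q_u / (P Q)\<close>.\<close>
    have "partials D (cE z) (\<lambda>p. - (P p * Du P p + Du P p * P p)) (\<lambda>p. - (P p * Dv P p + Dv P p * P p))"
      by (rule partials_cong[OF D _ partials_linear[OF bounded_linear_minus[OF bounded_linear_ident] partials_mult[OF pP pP]]])
        (simp add: EP)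
    from partials_Dv[OF this p] have "Dv (cE z) p = - (2 * P p * Dv P p)" by simp
    then have Pv: "Dv P p = P p * Q p * gamma1 z p"
      using pos unfolding gamma1_def EP[OF p] by (simp add: Q_def field_simps)
    have "partials D (cG z) (\<lambda>p. Q p * Du Q p + Du Q p * Q p) (\<lambda>p. Q p * Dv Q p + Dv Q p * Q p)"
      by (rule partials_cong[OF D _ partials_mult[OF pQ pQ]]) (simp add: GQ)
    from partials_Du[OF this p] have "Du (cG z) p = 2 * Q p * Du Q p" by simp
    then have Qu: "Du Q p = - (P p * Q p * gamma2 z p)"
      using pos unfolding gamma2_def GQ[OF p] by (simp add: P_def field_simps)
    have XvY': "mink (Dv ?X p) (?Y p) = - (Q p * gamma2 z p)"
    proof -
      have "P p * mink (Dv ?X p) (?Y p) = P p * (- (Q p * gamma2 z p))" using XvY Qu by (simp add: algebra_simps)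
      then show ?thesis by (rule cancel)
    qed
    have XuY: "mink (Du ?X p) (?Y p) = P p * gamma1 z p"
    proof -
      have "Q p * mink (Du ?X p) (?Y p) = Q p * (P p * gamma1 z p)" using YuX Pv off(1) by (simp add: algebra_simps)
      then show ?thesis by (rule cancel)
    qed
    note expand = mink_frame_expansion[OF frame[OF p]]
    have "Du ?X p = (P p * gamma1 z p) *\<^sub>R ?Y p - (P p * nu1 z p) *\<^sub>R ?l p"
      by (subst expand[of "Du ?X p"]) (simp add: diag XuY Xul)
    moreover have "Dv ?X p = - (Q p * gamma2 z p) *\<^sub>R ?Y p"
      by (subst expand[of "Dv ?X p"]) (simp add: diag XvY' Xvl)
    moreover have "Du ?Y p = (P p * gamma1 z p) *\<^sub>R ?X p"
      by (subst expand[of "Du ?Y p"]) (simp add: diag off XuY Yul)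
    moreover have "Dv ?Y p = (Q p * nu2 z p) *\<^sub>R ?l p - (Q p * gamma2 z p) *\<^sub>R ?X p"
      by (subst expand[of "Dv ?Y p"]) (simp add: diag off XvY' Yvl)
    moreover have "Du ?l p = - (P p * nu1 z p) *\<^sub>R ?X p"
      by (subst expand[of "Du ?l p"]) (simp add: diag off Xul Yul)
    moreover have "Dv ?l p = - (Q p * nu2 z p) *\<^sub>R ?Y p"
      by (subst expand[of "Dv ?l p"]) (simp add: diag off Xvl Yvl)
    ultimately show ?thesis using Pv by blast
  qed
  show "frame_system D P Q (gamma1 z) (gamma2 z) (nu1 z) (nu2 z) (frameX z) (frameY z) (unit_normal z)"
    unfolding frame_system_def
    by (intro conjI partials_eq_rhs[OF pX] partials_eq_rhs[OF pY] partials_eq_rhs[OF pl]) (use deriv in blast)+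
  show "Dv (Du z) p = (P p * Q p * gamma1 z p) *\<^sub>R frameX z p - (P p * Q p * gamma2 z p) *\<^sub>R frameY z p"
    if "p \<in> D" for p
    using deriv[OF that] unfolding partials_Dv[OF pzu that] by (simp add: algebra_simps)
qed

text \<open>Equality of the mixed derivatives of the normal, resolved along \<open>X\<close> and
  \<open>Y\<close>. In \<open>l_u = - n1 z_u\<close> and \<open>l_v = - n2 z_v\<close> the
  right-hand sides are C^1, so \<open>l\<close> is C^2, and the frame expression of
  \<open>z_uv\<close> yields both equations at once. The curvatures appear as functions
  \<open>n1\<close>, \<open>n2\<close> because in the application they are \<open>f\<close> and
  \<open>g\<close> composed with \<open>\<nu>\<close>.\<close>

lemma Codazzi:
  assumes surf: "timelike_surface D z" and prin: "principal_params D z"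
    and n: "\<And>p. p \<in> D \<Longrightarrow> nu1 z p = n1 p" "\<And>p. p \<in> D \<Longrightarrow> nu2 z p = n2 p"
    and C1: "Ck_on 1 D n1" "Ck_on 1 D n2" and p: "p \<in> D"
  shows "Dv n1 p = - (n1 p - n2 p) * sqrt (cG z p) * gamma1 z p"
    and "Du n2 p = - (n1 p - n2 p) * sqrt (- cE z p) * gamma2 z p"
proof -
  define P where "P p = sqrt (- cE z p)" for p
  define Q where "Q p = sqrt (cG z p)" for p
  have D: "open D" and z: "Ck_on 3 D z" and EG: "\<And>p. p \<in> D \<Longrightarrow> cE z p < 0" "\<And>p. p \<in> D \<Longrightarrow> cG z p > 0"
    using surf by (auto simp: timelike_surface_def param_domain_def)
  have FM: "\<And>p. p \<in> D \<Longrightarrow> cF z p = 0"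
    using prin by (auto simp: principal_params_def)
  have zk: "Ck_on 2 D z" "Ck_on 1 D (Du z)" "Ck_on 1 D (Dv z)"
    using z Ck_on_mono[OF z, of 2] Ck_on_SucD[of 1 D "Du z"] Ck_on_SucD[of 1 D "Dv z"]
    by (simp_all add: numeral_3_eq_3 numeral_2_eq_2)
  note fs = timelike_surface_frame[OF surf prin, folded P_def Q_def]
  have pzu: "partials D (Du z) (Du (Du z)) (Dv (Du z))" and pzv: "partials D (Dv z) (Du (Dv z)) (Dv (Dv z))"
    and pn1: "partials D n1 (Du n1) (Dv n1)" and pn2: "partials D n2 (Du n2) (Dv n2)"
    using zk C1 Ck_on_Suc_partials[OF D, of 0] by simp_all
  have zu: "Du z q = P q *\<^sub>R frameX z q" and zv: "Dv z q = Q q *\<^sub>R frameY z q" if "q \<in> D" for q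
    using partials_Du[OF fs(2) that] partials_Dv[OF fs(2) that] by auto
  have pl: "partials D (unit_normal z) (\<lambda>p. - (n1 p *\<^sub>R Du z p)) (\<lambda>p. - (n2 p *\<^sub>R Dv z p))"
    by (rule partials_eq_rhs[OF fs(1)[unfolded frame_system_def, THEN conjunct2, THEN conjunct2]])
      (simp_all add: zu zv n mult.commute)
  have neg: "bounded_linear (\<lambda>x::real^3. - x)"
    by (rule bounded_linear_minus[OF bounded_linear_ident])
  have l2: "Ck_on 2 D (unit_normal z)" unfolding numeral_2_eq_2
    by (rule Ck_on_SucI[OF D pl])
      (use Ck_on_linear[OF D neg Ck_on_scaleR[OF D C1(1) zk(2)]] Ck_on_linear[OF D neg Ck_on_scaleR[OF D C1(2) zk(3)]]
        in simp_all)
  have "partials D (Du (unit_normal z)) (\<lambda>p. - (n1 p *\<^sub>R Du (Du z) p + Du n1 p *\<^sub>R Du z p))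
      (\<lambda>p. - (n1 p *\<^sub>R Dv (Du z) p + Dv n1 p *\<^sub>R Du z p))"
    by (rule partials_cong[OF D _ partials_linear[OF neg partials_scaleR[OF pn1 pzu]]]) (simp add: partials_Du[OF pl])
  from partials_Dv[OF this p] have luv: "Dv (Du (unit_normal z)) p = - (n1 p *\<^sub>R Dv (Du z) p + Dv n1 p *\<^sub>R Du z p)" .
  have "partials D (Dv (unit_normal z)) (\<lambda>p. - (n2 p *\<^sub>R Du (Dv z) p + Du n2 p *\<^sub>R Dv z p))
      (\<lambda>p. - (n2 p *\<^sub>R Dv (Dv z) p + Dv n2 p *\<^sub>R Dv z p))"
    by (rule partials_cong[OF D _ partials_linear[OF neg partials_scaleR[OF pn2 pzv]]]) (simp add: partials_Dv[OF pl])
  from partials_Du[OF this p] have lvu: "Du (Dv (unit_normal z)) p = - (n2 p *\<^sub>R Du (Dv z) p + Du n2 p *\<^sub>R Dv z p)" .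
  have eq: "n1 p *\<^sub>R Dv (Du z) p + Dv n1 p *\<^sub>R Du z p = n2 p *\<^sub>R Dv (Du z) p + Du n2 p *\<^sub>R Dv z p"
    using Dv_Du_eq_Du_Dv[OF D l2 p, unfolded luv lvu neg_equal_iff_equal]
    by (simp only: Dv_Du_eq_Du_Dv[OF D zk(1) p])
  have pos: "P p > 0" "Q p > 0" using EG[OF p] by (auto simp: P_def Q_def)
  have fr: "mink (frameX z p) (frameX z p) = -1" "mink (frameY z p) (frameY z p) = 1"
    "mink (frameX z p) (frameY z p) = 0" "mink (frameY z p) (frameX z p) = 0"
    using unit_normal_eq(2)[OF EG(1,2)[OF p] FM[OF p]] mink_commute[of "frameY z p" "frameX z p"]
    by (simp_all add: mink_frame_def)
  have "P p * Dv n1 p = P p * (- (n1 p - n2 p) * Q p * gamma1 z p)"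
    using arg_cong[OF eq, of "\<lambda>w. mink w (frameX z p)"]
    unfolding zu[OF p] zv[OF p] fs(3)[OF p] by (simp add: mink_bilinear_simps fr algebra_simps)
  then show "Dv n1 p = - (n1 p - n2 p) * sqrt (cG z p) * gamma1 z p" using pos by (simp add: Q_def)
  have "Q p * Du n2 p = Q p * (- (n1 p - n2 p) * P p * gamma2 z p)"
    using arg_cong[OF eq, of "\<lambda>w. mink w (frameY z p)"]
    unfolding zu[OF p] zv[OF p] fs(3)[OF p] by (simp add: mink_bilinear_simps fr algebra_simps)
  then show "Du n2 p = - (n1 p - n2 p) * sqrt (- cE z p) * gamma2 z p" using pos by (simp add: P_def)
qed

section \<open>Surfaces with prescribed invariants\<close>

lemma mink_frame_normal:
  assumes "mink_frame X Y l"
  shows "l = mcross X Y"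
  using mink_frame_expansion[OF assms, of "mcross X Y"] assms mink_mcross[of X Y l]
  by (simp add: mink_frame_def)

text \<open>Two first integrals: the coefficient matrices are skew for the Minkowski form, which
  keeps \<open>- X \<otimes> X + Y \<otimes> Y + l \<otimes> l\<close> constant, and trace-free,
  which keeps the determinant constant.\<close>

lemma frame_system_mink_frame:
  assumes D: "param_domain D" and p0: "p0 \<in> D" and F: "frame_system D P Q g1 g2 n1 n2 X Y l"
    and init: "mink_frame (X p0) (Y p0) (l p0)" and p: "p \<in> D"
  shows "mink_frame (X p) (Y p) (l p)"
proof (rule mink_frameI_parseval)
  have D': "open D" "connected D" using D by (auto simp: param_domain_def)
  note P = F[unfolded frame_system_def, THEN conjunct1] F[unfolded frame_system_def, THEN conjunct2, THEN conjunct1]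
    F[unfolded frame_system_def, THEN conjunct2, THEN conjunct2]
  fix x y
  define T where "T p = - mink x (X p) * mink y (X p) + mink x (Y p) * mink y (Y p) + mink x (l p) * mink y (l p)" for p
  have *: "partials D (\<lambda>p. mink x (h p)) (\<lambda>p. mink x (hu p)) (\<lambda>p. mink x (hv p))" if "partials D h hu hv" for x h hu hv
    by (rule partials_linear[OF mink.bounded_linear_right that])
  have "partials D T (\<lambda>_. 0) (\<lambda>_. 0)"
    unfolding T_def
    by (rule partials_eq_rhs[OF partials_add[OF partials_add[OF
         partials_mult[OF partials_linear[OF bounded_linear_minus[OF bounded_linear_ident] *[OF P(1)]] *[OF P(1)]]
         partials_mult[OF *[OF P(2)] *[OF P(2)]]] partials_mult[OF *[OF P(3)] *[OF P(3)]]]])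
      (simp_all add: mink_bilinear_simps algebra_simps)
  then have "T p = T p0" using partials_zero_imp_const[OF D'] p p0 by blast
  then show "mink x y = - mink x (X p) * mink y (X p) + mink x (Y p) * mink y (Y p) + mink x (l p) * mink y (l p)"
    using mink_frame_parseval[OF init, of x y] by (simp add: T_def)
next
  have D': "open D" "connected D" using D by (auto simp: param_domain_def)
  note P = F[unfolded frame_system_def, THEN conjunct1] F[unfolded frame_system_def, THEN conjunct2, THEN conjunct1]
    F[unfolded frame_system_def, THEN conjunct2, THEN conjunct2]
  have swap: "mink (mcross x y) x = 0" "mink (mcross x y) y = 0" "mink (mcross x w) y = - mink (mcross x y) w"
    "mink (mcross w y) x = - mink (mcross x y) w" for x y w
    by (simp_all add: mink_mcross det_vector_3)
  have "partials D (\<lambda>p. mink (mcross (X p) (Y p)) (l p)) (\<lambda>_. 0) (\<lambda>_. 0)"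
    by (rule partials_eq_rhs[OF partials_mink[OF partials_bilinear[OF bounded_bilinear_mcross P(1,2)] P(3)]])
      (simp_all add: mink_bilinear_simps mcross.add_left mcross.add_right mcross.diff_left mcross.diff_right
        mcross.minus_left mcross.minus_right mcross.scaleR_left mcross.scaleR_right swap)
  from partials_zero_imp_const[OF D' this p p0] show "det (vector [X p, Y p, l p] :: real^3^3) = 1"
    using init by (simp add: mink_mcross mink_frame_def)
qed

text \<open>\<open>k\<close> and \<open>m\<close> play the role of \<open>P * gamma1\<close> and
  \<open>Q * gamma2\<close>: they are the coefficients of the connection form
  \<open>k du - m dv\<close>, and \<open>gauss\<close> is its structure equation. The integrability
  condition splits accordingly: \<open>Pv\<close> and \<open>Qu\<close> settle the component
  \<open>z\<close>, the Codazzi equations the entries that involve \<open>l\<close>, and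
  \<open>gauss\<close> those between \<open>X\<close> and \<open>Y\<close>.\<close>

lemma Bonnet_local_existence:
  fixes P Q k m n1 n2 :: "real \<times> real \<Rightarrow> real"
  assumes D: "open D" and p0: "p0 \<in> D"
    and PQ2: "Ck_on 2 D P" "Ck_on 2 D Q" and pos: "\<And>p. p \<in> D \<Longrightarrow> P p > 0" "\<And>p. p \<in> D \<Longrightarrow> Q p > 0"
    and C1: "Ck_on 1 D k" "Ck_on 1 D m" "Ck_on 1 D n1" "Ck_on 1 D n2"
    and Pv: "\<And>p. p \<in> D \<Longrightarrow> Dv P p = Q p * k p" and Qu: "\<And>p. p \<in> D \<Longrightarrow> Du Q p = - (P p * m p)"
    and codazzi1: "\<And>p. p \<in> D \<Longrightarrow> P p * Dv n1 p = - (n1 p - n2 p) * Q p * k p"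
    and codazzi2: "\<And>p. p \<in> D \<Longrightarrow> Q p * Du n2 p = - (n1 p - n2 p) * P p * m p"
    and gauss: "\<And>p. p \<in> D \<Longrightarrow> Dv k p + Du m p + n1 p * n2 p * P p * Q p = 0"
  obtains C z where "param_domain C" "p0 \<in> C" "C \<subseteq> D" "timelike_surface C z" "principal_params C z"
    "\<And>p. p \<in> C \<Longrightarrow> nu1 z p = n1 p" "\<And>p. p \<in> C \<Longrightarrow> nu2 z p = n2 p"
    "\<And>p. p \<in> C \<Longrightarrow> gamma1 z p = k p / P p" "\<And>p. p \<in> C \<Longrightarrow> gamma2 z p = m p / Q p"
proof -
  define B1 :: "((real^3) \<times> (real^3) \<times> (real^3) \<times> (real^3)) \<Rightarrow>\<^sub>L ((real^3) \<times> (real^3) \<times> (real^3) \<times> (real^3))"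
    where "B1 = Blinfun (\<lambda>w. (fst (snd w), fst w, 0, 0))"
  define B2 :: "((real^3) \<times> (real^3) \<times> (real^3) \<times> (real^3)) \<Rightarrow>\<^sub>L ((real^3) \<times> (real^3) \<times> (real^3) \<times> (real^3))"
    where "B2 = Blinfun (\<lambda>w. (- fst (snd (snd w)), 0, - fst w, 0))"
  define B3 :: "((real^3) \<times> (real^3) \<times> (real^3) \<times> (real^3)) \<Rightarrow>\<^sub>L ((real^3) \<times> (real^3) \<times> (real^3) \<times> (real^3))"
    where "B3 = Blinfun (\<lambda>w. (0, 0, 0, fst w))"
  define B4 :: "((real^3) \<times> (real^3) \<times> (real^3) \<times> (real^3)) \<Rightarrow>\<^sub>L ((real^3) \<times> (real^3) \<times> (real^3) \<times> (real^3))"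
    where "B4 = Blinfun (\<lambda>w. (0, fst (snd (snd w)), - fst (snd w), 0))"
  define B5 :: "((real^3) \<times> (real^3) \<times> (real^3) \<times> (real^3)) \<Rightarrow>\<^sub>L ((real^3) \<times> (real^3) \<times> (real^3) \<times> (real^3))"
    where "B5 = Blinfun (\<lambda>w. (0, 0, 0, fst (snd w)))"
  have B_apply: "B1 w = (fst (snd w), fst w, 0, 0)" "B2 w = (- fst (snd (snd w)), 0, - fst w, 0)"
    "B3 w = (0, 0, 0, fst w)" "B4 w = (0, fst (snd (snd w)), - fst (snd w), 0)" "B5 w = (0, 0, 0, fst (snd w))" for w
    unfolding B1_def B2_def B3_def B4_def B5_def
    by (subst bounded_linear_Blinfun_apply, (intro bounded_linear_intros bounded_linear_Pair bounded_linear_minus)[1], rule refl)+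
  \<comment> \<open>The state is \<open>(X, Y, l, z)\<close>: the position \<open>z\<close> is integrated together with the frame.\<close>
  define U where "U p = k p *\<^sub>R B1 + (P p * n1 p) *\<^sub>R B2 + P p *\<^sub>R B3" for p
  define V where "V p = (- m p) *\<^sub>R B1 + (Q p * n2 p) *\<^sub>R B4 + Q p *\<^sub>R B5" for p
  have neg: "bounded_linear (\<lambda>x::real. - x)"
    by (rule bounded_linear_minus[OF bounded_linear_ident])
  have PQ1: "Ck_on 1 D P" "Ck_on 1 D Q"
    using PQ2[THEN Ck_on_mono, of 1] by simp_all
  have U1: "Ck_on 1 D U" and V1: "Ck_on 1 D V"
    unfolding U_def V_def by (intro Ck_on_add Ck_on_scaleR Ck_on_mult Ck_on_const Ck_on_linear[OF D neg] D C1 PQ1)+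
  have par: "partials D h (Du h) (Dv h)" if "Ck_on 1 D h" for h :: "real \<times> real \<Rightarrow> real"
    using Ck_on_Suc_partials[OF D, of 0 h] that by simp
  note pk = par[OF C1(1)] and pm = par[OF C1(2)] and pn1 = par[OF C1(3)] and pn2 = par[OF C1(4)]
    and pP = par[OF PQ1(1)] and pQ = par[OF PQ1(2)]
  have Uv: "Dv U p = Dv k p *\<^sub>R B1 + (P p * Dv n1 p + Dv P p * n1 p) *\<^sub>R B2 + Dv P p *\<^sub>R B3" if "p \<in> D" for p
    using partials_Dv[OF partials_add[OF partials_add[OF partials_scaleR[OF pk partials_const]
        partials_scaleR[OF partials_mult[OF pP pn1] partials_const]] partials_scaleR[OF pP partials_const]] that, of B1 B2 B3]
    unfolding U_def by simp
  have Vu: "Du V p = (- Du m p) *\<^sub>R B1 + (Q p * Du n2 p + Du Q p * n2 p) *\<^sub>R B4 + Du Q p *\<^sub>R B5" if "p \<in> D" for p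
    using partials_Du[OF partials_add[OF partials_add[OF partials_scaleR[OF partials_linear[OF neg pm] partials_const]
        partials_scaleR[OF partials_mult[OF pQ pn2] partials_const]] partials_scaleR[OF pQ partials_const]] that, of B1 B4 B5]
    unfolding V_def by simp
  have compat: "Dv U p w + U p (V p w) = Du V p w + V p (U p w)" if p: "p \<in> D" for p w
  proof -
    have kv: "Dv k p = - (Du m p + n1 p * n2 p * P p * Q p)"
      using gauss[OF p] by linarith
    \<comment> \<open>With \<open>Pv\<close> and \<open>Qu\<close> the Codazzi equations take the
      form \<open>(P n1)_v = Q n2 k\<close> and \<open>(Q n2)_u = - P n1 m\<close> in which the
      mixed derivatives contain them.\<close>
    have w1: "P p * Dv n1 p + Dv P p * n1 p = Q p * n2 p * k p"
      using codazzi1[OF p] Pv[OF p] by (simp add: algebra_simps)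
    have w2: "Q p * Du n2 p + Du Q p * n2 p = - (P p * n1 p * m p)"
      using codazzi2[OF p] Qu[OF p] by (simp add: algebra_simps)
    show ?thesis
      unfolding Uv[OF p] Vu[OF p] w1 w2 unfolding kv Pv[OF p] Qu[OF p] U_def V_def
      by (cases w) (simp add: blinfun.bilinear_simps B_apply algebra_simps)
  qed
  \<comment> \<open>The initial frame is \<open>e3\<close>, \<open>e1\<close>, \<open>e2\<close>:
    the time-like vector has to be first, and the cyclic order gives determinant 1. The initial
    position is arbitrary.\<close>
  obtain C W where C: "param_domain C" "p0 \<in> C" "C \<subseteq> D" and W0: "W p0 = (axis 3 1, axis 1 1, axis 2 1, 0)"
    and contW: "continuous_on C W" and pW: "partials C W (\<lambda>p. U p (W p)) (\<lambda>p. V p (W p))"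
    by (rule total_linear_system[OF D p0 U1 V1 compat, of "(axis 3 1, axis 1 1, axis 2 1, 0)"])
  have oC: "open C" using C by (simp add: param_domain_def)
  note sub = Ck_on_subset[OF oC C(3)]
  have W1: "Ck_on 1 C W" unfolding One_nat_def
    by (rule Ck_on_SucI[OF oC pW])
      (auto intro!: continuous_on_blinfun_apply contW Ck_on_imp_continuous_on[OF sub[OF U1]] Ck_on_imp_continuous_on[OF sub[OF V1]])
  have W2: "Ck_on 2 C W" unfolding numeral_2_eq_2
    using Ck_on_bilinear[OF oC bounded_bilinear_blinfun_apply sub[OF U1] W1]
      Ck_on_bilinear[OF oC bounded_bilinear_blinfun_apply sub[OF V1] W1]
    by (intro Ck_on_SucI[OF oC pW]) (simp_all add: One_nat_def del: Ck_on.simps)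
  define X where "X p = fst (W p)" for p
  define Y where "Y p = fst (snd (W p))" for p
  define l where "l p = fst (snd (snd (W p)))" for p
  define z where "z p = snd (snd (snd (W p)))" for p
  have lins: "bounded_linear (\<lambda>w::(real^3) \<times> (real^3) \<times> (real^3) \<times> (real^3). fst w)"
    "bounded_linear (\<lambda>w::(real^3) \<times> (real^3) \<times> (real^3) \<times> (real^3). fst (snd w))"
    "bounded_linear (\<lambda>w::(real^3) \<times> (real^3) \<times> (real^3) \<times> (real^3). fst (snd (snd w)))"
    "bounded_linear (\<lambda>w::(real^3) \<times> (real^3) \<times> (real^3) \<times> (real^3). snd (snd (snd w)))"
    by (intro bounded_linear_intros)+
  have posC: "P p > 0" "Q p > 0" if "p \<in> C" for p using pos[OF subsetD[OF C(3) that]] by simp_all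
  have pX: "partials C X (\<lambda>p. k p *\<^sub>R Y p - (P p * n1 p) *\<^sub>R l p) (\<lambda>p. - m p *\<^sub>R Y p)"
    and pY: "partials C Y (\<lambda>p. k p *\<^sub>R X p) (\<lambda>p. (Q p * n2 p) *\<^sub>R l p - m p *\<^sub>R X p)"
    and pl: "partials C l (\<lambda>p. - (P p * n1 p) *\<^sub>R X p) (\<lambda>p. - (Q p * n2 p) *\<^sub>R Y p)"
    and pz: "partials C z (\<lambda>p. P p *\<^sub>R X p) (\<lambda>p. Q p *\<^sub>R Y p)"
    using partials_linear[OF lins(1) pW] partials_linear[OF lins(2) pW] partials_linear[OF lins(3) pW] partials_linear[OF lins(4) pW]
    unfolding X_def Y_def l_def z_def U_def V_def by (simp_all add: blinfun.bilinear_simps B_apply)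
  have F: "frame_system C P Q (\<lambda>p. k p / P p) (\<lambda>p. m p / Q p) n1 n2 X Y l"
    unfolding frame_system_def
    by (intro conjI partials_eq_rhs[OF pX] partials_eq_rhs[OF pY] partials_eq_rhs[OF pl])
      (use posC in \<open>simp_all add: less_imp_neq[THEN not_sym]\<close>)
  have "mink_frame (X p0) (Y p0) (l p0)"
    unfolding mink_frame_def X_def Y_def l_def W0 by (simp add: mink_def det_vector_3 axis_def)
  then have frame: "mink_frame (X p) (Y p) (l p)" if "p \<in> C" for p
    using frame_system_mink_frame[OF C(1,2) F _ that] by blast
  have zu: "Du z p = P p *\<^sub>R X p" and zv: "Dv z p = Q p *\<^sub>R Y p" if "p \<in> C" for p
    using partials_Du[OF pz that] partials_Dv[OF pz that] by auto
  have E: "cE z p = - (P p * P p)" and F0: "cF z p = 0" and G: "cG z p = Q p * Q p" if "p \<in> C" for p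
    using frame[OF that] by (simp_all add: cE_def cF_def cG_def zu zv that mink_bilinear_simps mink_frame_def)
  have EG: "cE z p < 0" "cG z p > 0" if "p \<in> C" for p
    using posC[OF that] E[OF that] G[OF that] by simp_all
  have fX: "frameX z p = X p" and fY: "frameY z p = Y p" if "p \<in> C" for p
    using posC[OF that] by (simp_all add: frameX_def frameY_def E[OF that] G[OF that] zu[OF that] zv[OF that])
  have normal: "unit_normal z p = l p" if "p \<in> C" for p
    using unit_normal_eq(1)[OF EG[OF that] F0[OF that]] mink_frame_normal[OF frame[OF that]] fX[OF that] fY[OF that] by simp
  have z3: "Ck_on 3 C z" unfolding numeral_3_eq_3
  proof (rule Ck_on_SucI[OF oC pz], unfold numeral_2_eq_2[symmetric])
    show "Ck_on 2 C (\<lambda>p. P p *\<^sub>R X p)" "Ck_on 2 C (\<lambda>p. Q p *\<^sub>R Y p)"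
      unfolding X_def Y_def by (intro Ck_on_scaleR oC sub PQ2 Ck_on_linear[OF oC lins(1) W2] Ck_on_linear[OF oC lins(2) W2])+
  qed
  have surf: "timelike_surface C z"
    using C(1) z3 EG by (simp add: timelike_surface_def)
  note pPC = partials_subset[OF pP C(3)] and pQC = partials_subset[OF pQ C(3)]
  have pzu: "partials C (Du z) (\<lambda>p. P p *\<^sub>R (k p *\<^sub>R Y p - (P p * n1 p) *\<^sub>R l p) + Du P p *\<^sub>R X p)
      (\<lambda>p. P p *\<^sub>R (- m p *\<^sub>R Y p) + Dv P p *\<^sub>R X p)"
    by (rule partials_cong[OF oC _ partials_scaleR[OF pPC pX]]) (simp add: zu)
  have pzv: "partials C (Dv z) (\<lambda>p. Q p *\<^sub>R (k p *\<^sub>R X p) + Du Q p *\<^sub>R Y p)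
      (\<lambda>p. Q p *\<^sub>R ((Q p * n2 p) *\<^sub>R l p - m p *\<^sub>R X p) + Dv Q p *\<^sub>R Y p)"
    by (rule partials_cong[OF oC _ partials_scaleR[OF pQC pY]]) (simp add: zv)
  have pE: "partials C (cE z) (\<lambda>p. - (P p * Du P p + Du P p * P p)) (\<lambda>p. - (P p * Dv P p + Dv P p * P p))"
    by (rule partials_cong[OF oC _ partials_linear[OF neg partials_mult[OF pPC pPC]]]) (simp add: E)
  have pG: "partials C (cG z) (\<lambda>p. Q p * Du Q p + Du Q p * Q p) (\<lambda>p. Q p * Dv Q p + Dv Q p * Q p)"
    by (rule partials_cong[OF oC _ partials_mult[OF pQC pQC]]) (simp add: G)
  have inv: "cM z p = 0 \<and> nu1 z p = n1 p \<and> nu2 z p = n2 p \<and> gamma1 z p = k p / P p \<and> gamma2 z p = m p / Q p"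
    if p: "p \<in> C" for p
  proof (intro conjI)
    note fr = frame[OF p, unfolded mink_frame_def]
    note sym = mink_commute[of "l p" "X p"] mink_commute[of "l p" "Y p"]
    note pq = posC[OF p]
    show "cM z p = 0"
      unfolding cM_def normal[OF p] partials_Dv[OF pzu p] using fr by (simp add: mink_bilinear_simps sym)
    show "nu1 z p = n1 p"
      unfolding nu1_def cL_def normal[OF p] partials_Du[OF pzu p] E[OF p] using fr pq by (simp add: mink_bilinear_simps sym)
    show "nu2 z p = n2 p"
      unfolding nu2_def cN_def normal[OF p] partials_Dv[OF pzv p] G[OF p] using fr pq by (simp add: mink_bilinear_simps sym)
    show "gamma1 z p = k p / P p"
      unfolding gamma1_def partials_Dv[OF pE p] E[OF p] G[OF p] using pq Pv[OF subsetD[OF C(3) p]]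
      by (simp add: field_simps)
    show "gamma2 z p = m p / Q p"
      unfolding gamma2_def partials_Du[OF pG p] E[OF p] G[OF p] using pq Qu[OF subsetD[OF C(3) p]]
      by (simp add: field_simps)
  qed
  have prin: "principal_params C z"
    using F0 inv by (simp add: principal_params_def)
  show thesis
    by (rule that[OF C surf prin]) (use inv in blast)+
qed

section \<open>Weingarten surfaces in natural principal parameters\<close>

text \<open>The fundamental theorem is applied on a compact interval, whereas \<open>I\<close> is
  arbitrary and \<open>c\<close> or \<open>x\<close> may be an end point of it. So
  \<open>{l..u}\<close> is chosen to contain both and to agree with \<open>I\<close> near
  \<open>x\<close>, which makes the derivatives within the two sets the same.\<close>

lemma interval_integral_has_real_derivative:
  fixes h :: "real \<Rightarrow> real"
  assumes I: "is_interval I" and h: "continuous_on I h" and c: "c \<in> I" and x: "x \<in> I"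
  shows "((\<lambda>u. LBINT t=c..u. h t) has_real_derivative h x) (at x within I)"
proof -
  obtain l where l: "l \<in> I" "l \<le> c" "l \<le> x" "l < x \<or> (\<forall>y\<in>I. x \<le> y)"
  proof (cases "\<exists>y\<in>I. y < x")
    case True
    then obtain y where "y \<in> I" "y < x" by blast
    then show thesis using that[of "min y c"] c by (auto simp: min_def)
  next
    case False
    then show thesis using that[of x] c x by (auto simp: not_less)
  qed
  obtain u where u: "u \<in> I" "c \<le> u" "x \<le> u" "x < u \<or> (\<forall>y\<in>I. y \<le> x)"
  proof (cases "\<exists>y\<in>I. x < y")
    case True
    then obtain y where "y \<in> I" "x < y" by blast
    then show thesis using that[of "max y c"] c by (auto simp: max_def)
  next
    case False
    then show thesis using that[of x] c x by (auto simp: not_less)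
  qed
  have sub: "{l..u} \<subseteq> I"
    using mem_is_interval_1_I[OF I l(1) u(1)] by auto
  have "((\<lambda>u. LBINT t=c..u. h t) has_vector_derivative h x) (at x within {l..u})"
    using l u by (intro interval_integral_FTC2 continuous_on_subset[OF h sub]) auto
  \<comment> \<open>A neighbourhood of \<open>x\<close> on which \<open>{l..u}\<close> and
    \<open>I\<close> coincide. The bounds \<open>x - 1\<close> and \<open>x + 1\<close> serve on a
    side where \<open>I\<close> has no points beyond \<open>x\<close>.\<close>
  moreover define S where "S = {(if l < x then l else x - 1)<..<(if x < u then u else x + 1)}"
  have "at x within {l..u} = at x within I"
  proof (rule at_within_nhd[of x S])
    have "y \<in> {l..u}" if "y \<in> I" "y \<in> S" for y
      using that l(4) u(4) l(3) u(3) by (force simp: S_def split: if_splits)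
    then show "{l..u} \<inter> S - {x} = I \<inter> S - {x}" using sub by blast
  qed (auto simp: S_def)
  ultimately show ?thesis
    by (simp add: has_real_derivative_iff_has_vector_derivative)
qed

lemma Ck_on_2_chain:
  assumes "\<And>t. t \<in> S \<Longrightarrow> (\<phi> has_real_derivative \<phi>' t) (at t within S)"
    and "\<And>t. t \<in> S \<Longrightarrow> (\<phi>' has_real_derivative \<phi>'' t) (at t within S)" "continuous_on S \<phi>''"
    and D: "open D" and h: "Ck_on 2 D h" and hD: "h ` D \<subseteq> S"
  shows "Ck_on 2 D (\<lambda>p. \<phi> (h p))"
proof -
  have h1: "Ck_on 1 D h" "Ck_on 1 D (Du h)" "Ck_on 1 D (Dv h)" "partials D h (Du h) (Dv h)"
    using h Ck_on_mono[OF h, of 1] Ck_on_Suc_partials[OF D, of 1 h] by (simp_all add: numeral_2_eq_2)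
  have "Ck_on 1 D (\<lambda>p. \<phi>' (h p))"
    by (rule Ck_on_1_chain[OF assms(2,3) D h1(1) hD])
  then show ?thesis unfolding numeral_2_eq_2
    using Ck_on_mult[OF D _ h1(2)] Ck_on_mult[OF D _ h1(3)]
    by (intro Ck_on_SucI[OF D partials_chain[OF assms(1) h1(4) D hD]]) (simp_all del: Ck_on.simps)
qed

text \<open>The positive \<open>a\<close>, \<open>b\<close> will be the absolute values of the given
  constants. The differential equation is an assumption of \<open>local_existence\<close> instead,
  so that \<open>swap\<close> can exchange \<open>f\<close> with \<open>g\<close> and
  \<open>a\<close> with \<open>b\<close> while \<open>u\<close> and \<open>v\<close> stay in place;
  facts about functions of one variable then come in pairs.\<close>

locale weingarten_solution =
  fixes I :: "real set" and f f' f'' g g' g'' :: "real \<Rightarrow> real" and D :: "(real \<times> real) set"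
    and \<nu> :: "real \<times> real \<Rightarrow> real" and p0 :: "real \<times> real" and a b :: real
  assumes I: "is_interval I"
    and f: "\<And>t. t \<in> I \<Longrightarrow> (f has_real_derivative f' t) (at t within I)"
    and f': "\<And>t. t \<in> I \<Longrightarrow> (f' has_real_derivative f'' t) (at t within I)"
    and f'': "continuous_on I f''"
    and g: "\<And>t. t \<in> I \<Longrightarrow> (g has_real_derivative g' t) (at t within I)"
    and g': "\<And>t. t \<in> I \<Longrightarrow> (g' has_real_derivative g'' t) (at t within I)"
    and g'': "continuous_on I g''"
    and fg: "\<And>t. t \<in> I \<Longrightarrow> f t - g t \<noteq> 0"
    and fg': "\<And>t. t \<in> I \<Longrightarrow> f' t * g' t \<noteq> 0"
    and D: "param_domain D"
    and \<nu>_smooth: "Ck_on 2 D \<nu>"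
    and \<nu>_regular: "\<And>p. p \<in> D \<Longrightarrow> Du \<nu> p * Dv \<nu> p \<noteq> 0"
    and \<nu>_I: "\<And>p. p \<in> D \<Longrightarrow> \<nu> p \<in> I"
    and p0: "p0 \<in> D"
    and a: "a > 0" and b: "b > 0"
begin

definition \<Phi> :: "real \<Rightarrow> real" where "\<Phi> s = exp (LBINT t=\<nu> p0..s. f' t / (f t - g t))"
definition \<Psi> :: "real \<Rightarrow> real" where "\<Psi> s = exp (LBINT t=\<nu> p0..s. g' t / (g t - f t))"

lemma pos [simp]: "\<Phi> s > 0" "\<Psi> s > 0" "\<Phi> s \<noteq> 0" "\<Psi> s \<noteq> 0" "a \<noteq> 0" "b \<noteq> 0"
  using a b by (simp_all add: \<Phi>_def \<Psi>_def)

lemma cont: "continuous_on I f" "continuous_on I f'" "continuous_on I g" "continuous_on I g'"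
  using DERIV_continuous_on[of I, OF f] DERIV_continuous_on[of I, OF f']
    DERIV_continuous_on[of I, OF g] DERIV_continuous_on[of I, OF g'] by blast+

lemma nonzero: "t \<in> I \<Longrightarrow> g t - f t \<noteq> 0" "t \<in> I \<Longrightarrow> f' t \<noteq> 0" "t \<in> I \<Longrightarrow> g' t \<noteq> 0"
  using fg[of t] fg'[of t] by auto

lemma cont_quot: "continuous_on I (\<lambda>t. f' t / (f t - g t))" "continuous_on I (\<lambda>t. g' t / (g t - f t))"
  by (auto intro!: continuous_intros cont dest: fg nonzero)

lemma \<Phi>_deriv: "t \<in> I \<Longrightarrow> (\<Phi> has_real_derivative \<Phi> t * (f' t / (f t - g t))) (at t within I)"
  unfolding \<Phi>_def
  using interval_integral_has_real_derivative[OF I cont_quot(1) \<nu>_I[OF p0]]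
  by (auto intro!: derivative_eq_intros)

lemma \<Psi>_deriv: "t \<in> I \<Longrightarrow> (\<Psi> has_real_derivative \<Psi> t * (g' t / (g t - f t))) (at t within I)"
  unfolding \<Psi>_def
  using interval_integral_has_real_derivative[OF I cont_quot(2) \<nu>_I[OF p0]]
  by (auto intro!: derivative_eq_intros)

lemma cont\<Phi>: "continuous_on I \<Phi>" "continuous_on I \<Psi>"
  using DERIV_continuous_on[of I, OF \<Phi>_deriv] DERIV_continuous_on[of I, OF \<Psi>_deriv] by blast+

lemma swap: "weingarten_solution I g g' g'' f f' f'' D \<nu> p0 b a"
  by unfold_locales
    (fact I f f' f'' g g' g'' D \<nu>_smooth \<nu>_regular \<nu>_I p0 a b nonzero | simp add: nonzero)+

text \<open>\<open>sqrt (- E)\<close> as a function of \<open>\<nu>\<close>; its counterpart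
  \<open>Q\<close> in the swapped locale is \<open>sqrt G\<close>. The function
  \<open>\<kappa>\<close> is \<open>- P' / Q\<close>, so that the connection coefficients are
  \<open>k = - \<kappa> \<nu>_v\<close> and, with the swapped \<open>\<kappa>\<close>,
  \<open>m = \<kappa> \<nu>_u\<close>.\<close>

definition P :: "real \<Rightarrow> real" where "P t = 1 / (a * \<Phi> t)"
definition P' :: "real \<Rightarrow> real" where "P' t = - (f' t / (f t - g t)) / (a * \<Phi> t)"
definition \<kappa> :: "real \<Rightarrow> real" where "\<kappa> t = f' t / (f t - g t) * (b * \<Psi> t / (a * \<Phi> t))"
definition \<kappa>' :: "real \<Rightarrow> real"
  where "\<kappa>' t = (f'' t / (f t - g t) - 2 * (f' t)\<^sup>2 / (f t - g t)\<^sup>2) * (b * \<Psi> t / (a * \<Phi> t))"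

lemma quot_deriv:
  assumes t: "t \<in> I"
  shows "((\<lambda>t. f' t / (f t - g t)) has_real_derivative
    (f'' t * (f t - g t) - f' t * (f' t - g' t)) / ((f t - g t) * (f t - g t))) (at t within I)"
  by (rule DERIV_divide[OF f'[OF t] DERIV_diff[OF f[OF t] g[OF t]] fg[OF t]])

lemma P_deriv:
  assumes t: "t \<in> I"
  shows "(P has_real_derivative P' t) (at t within I)"
  unfolding P_def P'_def
  by (rule derivative_eq_intros \<Phi>_deriv[OF t] refl | simp)+

lemma P'_deriv:
  assumes t: "t \<in> I"
  shows "(P' has_real_derivative
     - (f'' t / (f t - g t) - f' t * (f' t - g' t) / (f t - g t)\<^sup>2 - (f' t / (f t - g t))\<^sup>2) / (a * \<Phi> t)) (at t within I)"
proof -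
  define d where "d = f t - g t"
  have "d \<noteq> 0" using fg[OF t] by (simp add: d_def)
  then show ?thesis
    unfolding P'_def d_def[symmetric]
    by (intro DERIV_cong[OF DERIV_divide[OF DERIV_minus[OF quot_deriv[OF t]] DERIV_cmult[OF \<Phi>_deriv[OF t]]]])
      (simp_all add: d_def[symmetric], simp add: field_simps power2_eq_square)
qed

text \<open>Besides the term with \<open>f''\<close>, the quotient \<open>f' / (f - g)\<close>
  contributes \<open>- f' (f' - g') / (f - g)^2\<close> and the factor
  \<open>\<Psi> / \<Phi>\<close> contributes \<open>- f' (f' + g') / (f - g)^2\<close>. The terms
  with \<open>g'\<close> cancel and the remaining ones double.\<close>

lemma \<kappa>_deriv:
  assumes t: "t \<in> I"
  shows "(\<kappa> has_real_derivative \<kappa>' t) (at t within I)"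
proof -
  have "g' t / (g t - f t) = - (g' t / (f t - g t))"
    using fg[OF t] nonzero(1)[OF t] by (simp add: field_simps)
  note \<Psi> = \<Psi>_deriv[OF t, unfolded this]
  define d where "d = f t - g t"
  have "d \<noteq> 0" using fg[OF t] by (simp add: d_def)
  then show ?thesis
    unfolding \<kappa>_def \<kappa>'_def d_def[symmetric]
    by (intro DERIV_cong[OF DERIV_mult[OF quot_deriv[OF t]
          DERIV_divide[OF DERIV_cmult[OF \<Psi>] DERIV_cmult[OF \<Phi>_deriv[OF t]]]]])
      (simp_all add: d_def[symmetric], simp add: field_simps power2_eq_square)
qed

lemma P''_cont: "continuous_on I (\<lambda>t. - (f'' t / (f t - g t) - f' t * (f' t - g' t) / (f t - g t)\<^sup>2 -
   (f' t / (f t - g t))\<^sup>2) / (a * \<Phi> t))"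
  by (auto intro!: continuous_intros cont cont\<Phi> f'' dest: fg)

lemma \<kappa>'_cont: "continuous_on I \<kappa>'"
  unfolding \<kappa>'_def by (auto intro!: continuous_intros cont cont\<Phi> f'' dest: fg)

end

section \<open>The metric forced by the invariants, and uniqueness\<close>

context weingarten_solution
begin

interpretation swapped: weingarten_solution I g g' g'' f f' f'' D \<nu> p0 b a
  by (rule swap)

lemma swapped_eq: "swapped.\<Phi> = \<Psi>" "swapped.\<Psi> = \<Phi>"
  by (simp_all add: fun_eq_iff \<Phi>_def \<Psi>_def swapped.\<Phi>_def swapped.\<Psi>_def)

lemma open_D: "open D"
  using D by (simp add: param_domain_def)

lemma \<nu>_Ck: "Ck_on 1 D \<nu>" "Ck_on 1 D (Du \<nu>)" "Ck_on 1 D (Dv \<nu>)" "partials D \<nu> (Du \<nu>) (Dv \<nu>)"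
    "partials D (Du \<nu>) (Du (Du \<nu>)) (Dv (Du \<nu>))" "partials D (Dv \<nu>) (Du (Dv \<nu>)) (Dv (Dv \<nu>))"
proof -
  show *: "Ck_on 1 D \<nu>" "Ck_on 1 D (Du \<nu>)" "Ck_on 1 D (Dv \<nu>)" "partials D \<nu> (Du \<nu>) (Dv \<nu>)"
    using \<nu>_smooth Ck_on_mono[OF \<nu>_smooth, of 1] Ck_on_Suc_partials[OF open_D, of 1 \<nu>] by (simp_all add: numeral_2_eq_2)
  show "partials D (Du \<nu>) (Du (Du \<nu>)) (Dv (Du \<nu>))" "partials D (Dv \<nu>) (Du (Dv \<nu>)) (Dv (Dv \<nu>))"
    using *(2,3) Ck_on_Suc_partials[OF open_D, of 0] by simp_all
qed

lemma \<nu>_image: "\<nu> ` D \<subseteq> I"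
  using \<nu>_I by blast

lemmas chain = partials_chain[OF _ \<nu>_Ck(4) open_D \<nu>_image]

lemma has_invariants_iff:
  "has_invariants f f' g g' \<nu> (\<nu> p0) a b C z \<longleftrightarrow> (\<forall>p\<in>C. nu1 z p = f (\<nu> p) \<and> nu2 z p = g (\<nu> p) \<and>
     gamma1 z p = \<Psi> (\<nu> p) * (- b * f' (\<nu> p) / (f (\<nu> p) - g (\<nu> p))) * Dv \<nu> p \<and>
     gamma2 z p = \<Phi> (\<nu> p) * (- a * g' (\<nu> p) / (f (\<nu> p) - g (\<nu> p))) * Du \<nu> p)"
  by (simp only: has_invariants_def \<Phi>_def \<Psi>_def)

text \<open>No integration is involved. With the prescribed \<open>gamma1\<close> the first Codazzi
  equation becomes \<open>f' \<nu>_v = sqrt G * b * \<Psi> * f' \<nu>_v\<close>, and the nonzero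
  factor \<open>f' \<nu>_v\<close> cancels; the second equation gives \<open>sqrt (- E)\<close> in
  the same way.\<close>

lemma metric_of_invariants:
  assumes C: "C \<subseteq> D" and surf: "timelike_surface C z" and prin: "principal_params C z"
    and inv: "has_invariants f f' g g' \<nu> (\<nu> p0) a b C z" and p: "p \<in> C"
  shows "sqrt (- cE z p) = 1 / (a * \<Phi> (\<nu> p))" "sqrt (cG z p) = 1 / (b * \<Psi> (\<nu> p))"
proof -
  have oC: "open C" using surf by (simp add: timelike_surface_def param_domain_def)
  have pD: "p \<in> D" using p C by blast
  note I1 = inv[unfolded has_invariants_iff, rule_format]
  have n: "nu1 z q = f (\<nu> q)" "nu2 z q = g (\<nu> q)" if "q \<in> C" for q
    using I1[OF that] by simp_all
  have C1: "Ck_on 1 C (\<lambda>q. f (\<nu> q))" "Ck_on 1 C (\<lambda>q. g (\<nu> q))"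
    by (rule Ck_on_subset[OF oC C], rule Ck_on_1_chain[OF f cont(2) open_D \<nu>_Ck(1) \<nu>_image], assumption,
        rule Ck_on_subset[OF oC C], rule Ck_on_1_chain[OF g cont(4) open_D \<nu>_Ck(1) \<nu>_image], assumption)
  have d: "Dv (\<lambda>q. f (\<nu> q)) p = f' (\<nu> p) * Dv \<nu> p" "Du (\<lambda>q. g (\<nu> q)) p = g' (\<nu> p) * Du \<nu> p"
    using partials_Dv[OF chain[OF f] pD] partials_Du[OF chain[OF g] pD] by blast+
  define e where "e = f (\<nu> p) - g (\<nu> p)"
  have nz: "e \<noteq> 0" "f' (\<nu> p) \<noteq> 0" "g' (\<nu> p) \<noteq> 0" "Du \<nu> p \<noteq> 0" "Dv \<nu> p \<noteq> 0"
    using fg[OF \<nu>_I[OF pD]] nonzero[OF \<nu>_I[OF pD]] \<nu>_regular[OF pD] by (auto simp: e_def)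
  note Cod = Codazzi[OF surf prin n C1 p, unfolded d]
  have "f' (\<nu> p) * Dv \<nu> p * (sqrt (cG z p) * (b * \<Psi> (\<nu> p))) = f' (\<nu> p) * Dv \<nu> p * 1"
    using Cod(1) I1[OF p] nz(1) unfolding e_def[symmetric] by (simp add: field_simps)
  then have "sqrt (cG z p) * (b * \<Psi> (\<nu> p)) = 1"
    using nz by simp
  then show "sqrt (cG z p) = 1 / (b * \<Psi> (\<nu> p))"
    by (metis pos(4,6) eq_divide_eq mult_eq_0_iff)
  have "g' (\<nu> p) * Du \<nu> p * (sqrt (- cE z p) * (a * \<Phi> (\<nu> p))) = g' (\<nu> p) * Du \<nu> p * 1"
    using Cod(2) I1[OF p] nz(1) unfolding e_def[symmetric] by (simp add: field_simps)
  then have "sqrt (- cE z p) * (a * \<Phi> (\<nu> p)) = 1"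
    using nz by simp
  then show "sqrt (- cE z p) = 1 / (a * \<Phi> (\<nu> p))"
    by (metis pos(3,5) eq_divide_eq mult_eq_0_iff)
qed

lemma unique_up_to_motion:
  assumes C: "C \<subseteq> D" "p0 \<in> C" and surf: "timelike_surface C z" "principal_params C z"
    and inv: "has_invariants f f' g g' \<nu> (\<nu> p0) a b C z"
    and surf': "timelike_surface C z'" "principal_params C z'"
    and inv': "has_invariants f f' g g' \<nu> (\<nu> p0) a b C z'"
  shows "\<exists>T. motion T \<and> (\<forall>p\<in>C. z' p = T (z p))"
proof (rule frame_system_motion)
  show "param_domain C" using surf by (simp add: timelike_surface_def)
  show "frame_system C (\<lambda>p. sqrt (- cE z p)) (\<lambda>p. sqrt (cG z p)) (gamma1 z) (gamma2 z) (nu1 z) (nu2 z)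
      (frameX z) (frameY z) (unit_normal z)"
    "partials C z (\<lambda>p. sqrt (- cE z p) *\<^sub>R frameX z p) (\<lambda>p. sqrt (cG z p) *\<^sub>R frameY z p)"
    using timelike_surface_frame[OF surf] by blast+
  note eq = metric_of_invariants[OF C(1) surf inv] metric_of_invariants[OF C(1) surf' inv']
    inv[unfolded has_invariants_iff, rule_format] inv'[unfolded has_invariants_iff, rule_format]
  show "frame_system C (\<lambda>p. sqrt (- cE z p)) (\<lambda>p. sqrt (cG z p)) (gamma1 z) (gamma2 z) (nu1 z) (nu2 z)
      (frameX z') (frameY z') (unit_normal z')"
    by (rule frame_system_cong[OF timelike_surface_frame(1)[OF surf']]) (simp_all add: eq)
  show "partials C z' (\<lambda>p. sqrt (- cE z p) *\<^sub>R frameX z' p) (\<lambda>p. sqrt (cG z p) *\<^sub>R frameY z' p)"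
    by (rule partials_eq_rhs[OF timelike_surface_frame(2)[OF surf']]) (simp_all add: eq)
qed (use C surf surf' in \<open>auto intro: unit_normal_eq(2) simp: timelike_surface_def principal_params_def\<close>)

text \<open>Exponentials with different lower limits have the same logarithmic derivative, so their
  quotient has derivative zero on the interval \<open>I\<close>.\<close>

lemma natural_quotient_const:
  assumes c: "c \<in> I"
  obtains k where "\<And>t. t \<in> I \<Longrightarrow> exp (LBINT s=c..t. f' s / (f s - g s)) = k * \<Phi> t"
proof -
  define h where "h t = exp (LBINT s=c..t. f' s / (f s - g s)) / \<Phi> t" for t
  have "(h has_real_derivative 0) (at t within I)" if t: "t \<in> I" for t
  proof -
    have "((\<lambda>t. exp (LBINT s=c..t. f' s / (f s - g s))) has_real_derivative
        exp (LBINT s=c..t. f' s / (f s - g s)) * (f' t / (f t - g t))) (at t within I)"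
      using interval_integral_has_real_derivative[OF I cont_quot(1) c t]
      by (auto intro!: derivative_eq_intros)
    from DERIV_divide[OF this \<Phi>_deriv[OF t] pos(3)]
    show ?thesis unfolding h_def by (rule DERIV_cong) simp
  qed
  then obtain k where "\<And>t. t \<in> I \<Longrightarrow> h t = k"
    using has_field_derivative_zero_constant[of I h] is_interval_convex[OF I] by blast
  then have "exp (LBINT s=c..t. f' s / (f s - g s)) = k * \<Phi> t" if "t \<in> I" for t
    using that by (auto simp: h_def field_simps)
  then show thesis by (rule that)
qed

end

section \<open>Natural parameters, existence and strong regularity\<close>

context weingarten_solution
begin

interpretation swapped: weingarten_solution I g g' g'' f f' f'' D \<nu> p0 b a
  by (rule swap)

lemma natural_principal:
  assumes C: "C \<subseteq> D" and surf: "timelike_surface C z" and prin: "principal_params C z"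
    and inv: "has_invariants f f' g g' \<nu> (\<nu> p0) a b C z"
  shows "natural_principal_params I f f' g g' \<nu> C z"
  unfolding natural_principal_params_def
proof (intro conjI ballI)
  have oC: "open C" using surf by (simp add: timelike_surface_def param_domain_def)
  show "principal_params C z" by (rule prin)
  show "weingarten_via I f f' g g' \<nu> C z"
    unfolding weingarten_via_def
    using I f g cont fg fg' Ck_on_subset[OF oC C \<nu>_Ck(1)] subset_trans[OF image_mono[OF C] \<nu>_image] inv
    by (simp add: has_invariants_def)
  fix c assume c: "c \<in> I"
  obtain k where k: "\<And>t. t \<in> I \<Longrightarrow> exp (LBINT s=c..t. f' s / (f s - g s)) = k * \<Phi> t"
    using natural_quotient_const[OF c] by blast
  have "sqrt (- cE z p) * exp (LBINT t=c..\<nu> p. f' t / (f t - g t)) = k / a" if "p \<in> C" for p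
    using metric_of_invariants(1)[OF C surf prin inv that] k[OF \<nu>_I, of p] that C by auto
  then show "(\<lambda>p. sqrt (- cE z p) * exp (LBINT t=c..\<nu> p. f' t / (f t - g t))) constant_on C"
    unfolding constant_on_def by blast
  obtain k where k: "\<And>t. t \<in> I \<Longrightarrow> exp (LBINT s=c..t. g' s / (g s - f s)) = k * \<Psi> t"
    using swapped.natural_quotient_const[OF c] unfolding swapped_eq by blast
  have "sqrt (cG z p) * exp (LBINT t=c..\<nu> p. g' t / (g t - f t)) = k / b" if "p \<in> C" for p
    using metric_of_invariants(2)[OF C surf prin inv that] k[OF \<nu>_I, of p] that C by auto
  then show "(\<lambda>p. sqrt (cG z p) * exp (LBINT t=c..\<nu> p. g' t / (g t - f t))) constant_on C"
    unfolding constant_on_def by blast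
qed

text \<open>With \<open>S = a \<Phi>\<close> and \<open>T = b \<Psi>\<close> the metric is
  \<open>P = 1 / S\<close>, \<open>Q = 1 / T\<close>, and multiplying the Gauss equation by
  \<open>S T (f - g)\<close> gives \<open>S^2 y + T^2 x = f g (f - g)\<close>, which is
  \<open>pde\<close>.\<close>

lemma local_existence:
  assumes pde: "\<And>p. p \<in> D \<Longrightarrow> a\<^sup>2 * (\<Phi> (\<nu> p))\<^sup>2 * (g' (\<nu> p) * Du (Du \<nu>) p +
         (g'' (\<nu> p) - 2 * (g' (\<nu> p))\<^sup>2 / (g (\<nu> p) - f (\<nu> p))) * (Du \<nu> p)\<^sup>2) +
      b\<^sup>2 * (\<Psi> (\<nu> p))\<^sup>2 * (f' (\<nu> p) * Dv (Dv \<nu>) p +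
         (f'' (\<nu> p) - 2 * (f' (\<nu> p))\<^sup>2 / (f (\<nu> p) - g (\<nu> p))) * (Dv \<nu> p)\<^sup>2)
      = f (\<nu> p) * g (\<nu> p) * (f (\<nu> p) - g (\<nu> p))"
  obtains C z where "param_domain C" "p0 \<in> C" "C \<subseteq> D" "timelike_surface C z" "principal_params C z"
    "has_invariants f f' g g' \<nu> (\<nu> p0) a b C z"
proof -
  let ?P = "\<lambda>p. P (\<nu> p)" and ?Q = "\<lambda>p. swapped.P (\<nu> p)"
  let ?k = "\<lambda>p. - (\<kappa> (\<nu> p) * Dv \<nu> p)" and ?m = "\<lambda>p. swapped.\<kappa> (\<nu> p) * Du \<nu> p"
  have neg: "bounded_linear (\<lambda>x::real. - x)"
    by (rule bounded_linear_minus[OF bounded_linear_ident])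
  have P2: "Ck_on 2 D ?P" "Ck_on 2 D ?Q"
    by (rule Ck_on_2_chain[OF P_deriv P'_deriv P''_cont open_D \<nu>_smooth \<nu>_image]; assumption)
      (rule Ck_on_2_chain[OF swapped.P_deriv swapped.P'_deriv swapped.P''_cont open_D \<nu>_smooth \<nu>_image]; assumption)
  have pos': "?P p > 0" "?Q p > 0" for p
    using a b by (simp_all add: P_def swapped.P_def swapped_eq)
  have \<kappa>1: "Ck_on 1 D (\<lambda>p. \<kappa> (\<nu> p))" "Ck_on 1 D (\<lambda>p. swapped.\<kappa> (\<nu> p))"
    by (rule Ck_on_1_chain[OF \<kappa>_deriv \<kappa>'_cont open_D \<nu>_Ck(1) \<nu>_image]; assumption)
      (rule Ck_on_1_chain[OF swapped.\<kappa>_deriv swapped.\<kappa>'_cont open_D \<nu>_Ck(1) \<nu>_image]; assumption)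
  have C1: "Ck_on 1 D ?k" "Ck_on 1 D ?m"
    by (rule Ck_on_linear[OF open_D neg Ck_on_mult[OF open_D \<kappa>1(1) \<nu>_Ck(3)]],
        rule Ck_on_mult[OF open_D \<kappa>1(2) \<nu>_Ck(2)])
  have C1': "Ck_on 1 D (\<lambda>p. f (\<nu> p))" "Ck_on 1 D (\<lambda>p. g (\<nu> p))"
    by (rule Ck_on_1_chain[OF f cont(2) open_D \<nu>_Ck(1) \<nu>_image]; assumption)
      (rule Ck_on_1_chain[OF g cont(4) open_D \<nu>_Ck(1) \<nu>_image]; assumption)
  define e where "e p = f (\<nu> p) - g (\<nu> p)" for p
  define S where "S p = a * \<Phi> (\<nu> p)" for p
  define T where "T p = b * \<Psi> (\<nu> p)" for p
  note folds = e_def[symmetric] S_def[symmetric] T_def[symmetric]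
  have e: "e p \<noteq> 0" "g (\<nu> p) - f (\<nu> p) = - e p" if "p \<in> D" for p
    using fg[OF \<nu>_I[OF that]] by (simp_all add: e_def)
  have ST: "S p \<noteq> 0" "T p \<noteq> 0" for p by (simp_all add: S_def T_def)
  have dP: "partials D ?P (\<lambda>p. P' (\<nu> p) * Du \<nu> p) (\<lambda>p. P' (\<nu> p) * Dv \<nu> p)"
    by (rule chain[OF P_deriv])
  have dQ: "partials D ?Q (\<lambda>p. swapped.P' (\<nu> p) * Du \<nu> p) (\<lambda>p. swapped.P' (\<nu> p) * Dv \<nu> p)"
    by (rule chain[OF swapped.P_deriv])
  have df: "partials D (\<lambda>p. f (\<nu> p)) (\<lambda>p. f' (\<nu> p) * Du \<nu> p) (\<lambda>p. f' (\<nu> p) * Dv \<nu> p)"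
    by (rule chain[OF f])
  have dg: "partials D (\<lambda>p. g (\<nu> p)) (\<lambda>p. g' (\<nu> p) * Du \<nu> p) (\<lambda>p. g' (\<nu> p) * Dv \<nu> p)"
    by (rule chain[OF g])
  have d\<kappa>: "partials D (\<lambda>p. \<kappa> (\<nu> p)) (\<lambda>p. \<kappa>' (\<nu> p) * Du \<nu> p) (\<lambda>p. \<kappa>' (\<nu> p) * Dv \<nu> p)"
    by (rule chain[OF \<kappa>_deriv])
  have ds\<kappa>: "partials D (\<lambda>p. swapped.\<kappa> (\<nu> p)) (\<lambda>p. swapped.\<kappa>' (\<nu> p) * Du \<nu> p)
      (\<lambda>p. swapped.\<kappa>' (\<nu> p) * Dv \<nu> p)"
    by (rule chain[OF swapped.\<kappa>_deriv])
  have Pv: "Dv ?P p = ?Q p * ?k p" if "p \<in> D" for p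
    unfolding partials_Dv[OF dP that] P'_def \<kappa>_def swapped.P_def swapped_eq folds
    using e(1)[OF that] ST[of p] by (simp add: field_simps)
  have Qu: "Du ?Q p = - (?P p * ?m p)" if "p \<in> D" for p
    unfolding partials_Du[OF dQ that] P_def swapped.\<kappa>_def swapped.P'_def
      swapped_eq folds e(2)[OF that]
    using e(1)[OF that] ST[of p] by (simp add: field_simps)
  have cod1: "?P p * Dv (\<lambda>p. f (\<nu> p)) p = - (f (\<nu> p) - g (\<nu> p)) * ?Q p * ?k p" if "p \<in> D" for p
    unfolding partials_Dv[OF df that] P_def \<kappa>_def swapped.P_def swapped_eq folds
    using e(1)[OF that] ST[of p] by (simp add: field_simps)
  have cod2: "?Q p * Du (\<lambda>p. g (\<nu> p)) p = - (f (\<nu> p) - g (\<nu> p)) * ?P p * ?m p" if "p \<in> D" for p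
    unfolding partials_Du[OF dg that] P_def swapped.\<kappa>_def swapped.P_def swapped_eq folds e(2)[OF that]
    using e(1)[OF that] ST[of p] by (simp add: field_simps)
  have gauss: "Dv ?k p + Du ?m p + f (\<nu> p) * g (\<nu> p) * ?P p * ?Q p = 0" if p: "p \<in> D" for p
  proof -
    have k: "Dv ?k p = - (\<kappa> (\<nu> p) * Dv (Dv \<nu>) p + \<kappa>' (\<nu> p) * Dv \<nu> p * Dv \<nu> p)"
      by (rule partials_Dv[OF partials_linear[OF neg partials_mult[OF d\<kappa> \<nu>_Ck(6)]] p])
    have m: "Du ?m p = swapped.\<kappa> (\<nu> p) * Du (Du \<nu>) p + swapped.\<kappa>' (\<nu> p) * Du \<nu> p * Du \<nu> p"
      by (rule partials_Du[OF partials_mult[OF ds\<kappa> \<nu>_Ck(5)] p])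
    \<comment> \<open>\<open>x\<close> and \<open>y\<close> are the two square brackets of the
      differential equation; up to the factors \<open>- T / (S e)\<close> and
      \<open>- S / (T e)\<close> they are the derivatives \<open>k_v\<close> and
      \<open>m_u\<close>.\<close>
    define x where "x = f' (\<nu> p) * Dv (Dv \<nu>) p + (f'' (\<nu> p) - 2 * (f' (\<nu> p))\<^sup>2 / e p) * (Dv \<nu> p)\<^sup>2"
    define y where "y = g' (\<nu> p) * Du (Du \<nu>) p + (g'' (\<nu> p) - 2 * (g' (\<nu> p))\<^sup>2 / - e p) * (Du \<nu> p)\<^sup>2"
    have kx: "Dv ?k p = - (T p / S p) * x / e p"
      unfolding k unfolding \<kappa>_def \<kappa>'_def x_def folds
      using e(1)[OF p] ST[of p] by (simp add: field_simps power2_eq_square)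
    have my: "Du ?m p = - (S p / T p) * y / e p"
      unfolding m unfolding swapped.\<kappa>_def swapped.\<kappa>'_def swapped_eq y_def folds e(2)[OF p]
      using e(1)[OF p] ST[of p] by (simp add: field_simps power2_eq_square)
    have "(S p)\<^sup>2 * y + (T p)\<^sup>2 * x = f (\<nu> p) * g (\<nu> p) * e p"
      using pde[OF p] unfolding e(2)[OF p] x_def y_def S_def T_def power_mult_distrib e_def[symmetric] .
    then have fg_eq: "f (\<nu> p) * g (\<nu> p) = ((S p)\<^sup>2 * y + (T p)\<^sup>2 * x) / e p"
      using e(1)[OF p] by simp
    show ?thesis
      unfolding kx my fg_eq unfolding P_def swapped.P_def swapped_eq folds
      using e(1)[OF p] ST[of p] by (simp add: field_simps power2_eq_square)
  qed
  show thesis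
  proof (rule Bonnet_local_existence[OF open_D p0 P2 pos' C1 C1' Pv Qu cod1 cod2 gauss])
    fix C z
    assume C: "param_domain C" "p0 \<in> C" "C \<subseteq> D" "timelike_surface C z" "principal_params C z"
      and inv: "\<And>p. p \<in> C \<Longrightarrow> nu1 z p = f (\<nu> p)" "\<And>p. p \<in> C \<Longrightarrow> nu2 z p = g (\<nu> p)"
      "\<And>p. p \<in> C \<Longrightarrow> gamma1 z p = ?k p / ?P p" "\<And>p. p \<in> C \<Longrightarrow> gamma2 z p = ?m p / ?Q p"
    have "has_invariants f f' g g' \<nu> (\<nu> p0) a b C z"
      unfolding has_invariants_iff
    proof (intro ballI conjI)
      fix p assume p: "p \<in> C"
      then have pD: "p \<in> D" using C by blast
      show "nu1 z p = f (\<nu> p)" "nu2 z p = g (\<nu> p)" using inv p by simp_all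
      show "gamma1 z p = \<Psi> (\<nu> p) * (- b * f' (\<nu> p) / (f (\<nu> p) - g (\<nu> p))) * Dv \<nu> p"
        using inv(3)[OF p] by (simp add: \<kappa>_def P_def)
      show "gamma2 z p = \<Phi> (\<nu> p) * (- a * g' (\<nu> p) / (f (\<nu> p) - g (\<nu> p))) * Du \<nu> p"
        using inv(4)[OF p] unfolding swapped.\<kappa>_def swapped.P_def swapped_eq e_def[symmetric] e(2)[OF pD] by simp
    qed
    then show thesis using that C by blast
  qed
qed

lemma strongly_regular_of_invariants:
  assumes C: "C \<subseteq> D" and inv: "has_invariants f f' g g' \<nu> (\<nu> p0) a b C z"
  shows "strongly_regular C z"
  unfolding strongly_regular_def
proof
  fix p assume p: "p \<in> C"
  then have pD: "p \<in> D" using C by blast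
  show "(nu1 z p - nu2 z p) * gamma1 z p * gamma2 z p \<noteq> 0"
    using inv[unfolded has_invariants_iff, rule_format, OF p] fg[OF \<nu>_I[OF pD]] nonzero[OF \<nu>_I[OF pD]] \<nu>_regular[OF pD]
    by simp
qed

end

theorem theorem3p6:
  fixes I :: "real set"
    and f f' f'' g g' g'' :: "real \<Rightarrow> real"
    and D :: "(real \<times> real) set"
    and \<nu> :: "real \<times> real \<Rightarrow> real"
    and u0 v0 \<nu>0 a b :: real
  assumes I: "is_interval I"
    and f: "\<And>t. t \<in> I \<Longrightarrow> (f has_real_derivative f' t) (at t within I)"
    and f': "\<And>t. t \<in> I \<Longrightarrow> (f' has_real_derivative f'' t) (at t within I)"
    and f'': "continuous_on I f''"
    and g: "\<And>t. t \<in> I \<Longrightarrow> (g has_real_derivative g' t) (at t within I)"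
    and g': "\<And>t. t \<in> I \<Longrightarrow> (g' has_real_derivative g'' t) (at t within I)"
    and g'': "continuous_on I g''"
    and fg: "\<And>t. t \<in> I \<Longrightarrow> f t - g t \<noteq> 0"
    and fg': "\<And>t. t \<in> I \<Longrightarrow> f' t * g' t \<noteq> 0"
    and D: "param_domain D"
    and \<nu>_smooth: "Ck_on 2 D \<nu>"
    and \<nu>_regular: "\<And>p. p \<in> D \<Longrightarrow> Du \<nu> p * Dv \<nu> p \<noteq> 0"
    and \<nu>_I: "\<And>p. p \<in> D \<Longrightarrow> \<nu> p \<in> I"
    and p0: "(u0, v0) \<in> D"
    and \<nu>0: "\<nu>0 = \<nu> (u0, v0)"
    and a: "a \<noteq> 0"
    and b: "b \<noteq> 0"
    and pde: "\<And>p. p \<in> D \<Longrightarrow>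
      a\<^sup>2 * exp (2 * (LBINT t=\<nu>0..\<nu> p. f' t / (f t - g t))) *
        (g' (\<nu> p) * Du (Du \<nu>) p +
         (g'' (\<nu> p) - 2 * (g' (\<nu> p))\<^sup>2 / (g (\<nu> p) - f (\<nu> p))) * (Du \<nu> p)\<^sup>2) +
      b\<^sup>2 * exp (2 * (LBINT t=\<nu>0..\<nu> p. g' t / (g t - f t))) *
        (f' (\<nu> p) * Dv (Dv \<nu>) p +
         (f'' (\<nu> p) - 2 * (f' (\<nu> p))\<^sup>2 / (f (\<nu> p) - g (\<nu> p))) * (Dv \<nu> p)\<^sup>2)
      = f (\<nu> p) * g (\<nu> p) * (f (\<nu> p) - g (\<nu> p))"
  shows
    "(\<exists>D0 z. param_domain D0 \<and> (u0, v0) \<in> D0 \<and> D0 \<subseteq> D \<and>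
        weingarten_surface D0 z \<and> strongly_regular D0 z \<and>
        has_invariants f f' g g' \<nu> \<nu>0 \<bar>a\<bar> \<bar>b\<bar> D0 z) \<and>
     (\<forall>D0 z z'. param_domain D0 \<and> (u0, v0) \<in> D0 \<and> D0 \<subseteq> D \<and>
        weingarten_surface D0 z \<and> strongly_regular D0 z \<and>
        has_invariants f f' g g' \<nu> \<nu>0 \<bar>a\<bar> \<bar>b\<bar> D0 z \<and>
        weingarten_surface D0 z' \<and> strongly_regular D0 z' \<and>
        has_invariants f f' g g' \<nu> \<nu>0 \<bar>a\<bar> \<bar>b\<bar> D0 z' \<longrightarrow>
        (\<exists>T. motion T \<and> (\<forall>p\<in>D0. z' p = T (z p)))) \<and>
     (\<forall>D0 z. param_domain D0 \<and> (u0, v0) \<in> D0 \<and> D0 \<subseteq> D \<and>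
        weingarten_surface D0 z \<and> strongly_regular D0 z \<and>
        has_invariants f f' g g' \<nu> \<nu>0 \<bar>a\<bar> \<bar>b\<bar> D0 z \<longrightarrow>
        natural_principal_params I f f' g g' \<nu> D0 z)"
proof -
  have exp2: "exp (2 * x) = (exp x)\<^sup>2" for x :: real
    by (simp add: exp_double)
  \<comment> \<open>The metric coefficients \<open>1 / (\<bar>a\<bar> * \<Phi>)\<close> and
    \<open>1 / (\<bar>b\<bar> * \<Psi>)\<close> have to be positive, while the differential equation
    contains only the squares of the constants.\<close>
  interpret weingarten_solution I f f' f'' g g' g'' D \<nu> "(u0, v0)" "\<bar>a\<bar>" "\<bar>b\<bar>"
    by unfold_locales (use assms in auto)
  have D0: "timelike_surface D0 z" "principal_params D0 z" if "weingarten_surface D0 z" for D0 z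
    using that by (simp_all add: weingarten_surface_def)
  have "\<exists>D0 z. param_domain D0 \<and> (u0, v0) \<in> D0 \<and> D0 \<subseteq> D \<and> weingarten_surface D0 z \<and>
      strongly_regular D0 z \<and> has_invariants f f' g g' \<nu> \<nu>0 \<bar>a\<bar> \<bar>b\<bar> D0 z"
  proof (rule local_existence)
    show "\<bar>a\<bar>\<^sup>2 * (\<Phi> (\<nu> p))\<^sup>2 * (g' (\<nu> p) * Du (Du \<nu>) p +
         (g'' (\<nu> p) - 2 * (g' (\<nu> p))\<^sup>2 / (g (\<nu> p) - f (\<nu> p))) * (Du \<nu> p)\<^sup>2) +
      \<bar>b\<bar>\<^sup>2 * (\<Psi> (\<nu> p))\<^sup>2 * (f' (\<nu> p) * Dv (Dv \<nu>) p +
         (f'' (\<nu> p) - 2 * (f' (\<nu> p))\<^sup>2 / (f (\<nu> p) - g (\<nu> p))) * (Dv \<nu> p)\<^sup>2)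
      = f (\<nu> p) * g (\<nu> p) * (f (\<nu> p) - g (\<nu> p))" if "p \<in> D" for p
      using pde[OF that, unfolded exp2 \<nu>0] unfolding \<Phi>_def \<Psi>_def power2_abs .
  next
    fix C z
    assume *: "param_domain C" "(u0, v0) \<in> C" "C \<subseteq> D" "timelike_surface C z" "principal_params C z"
      "has_invariants f f' g g' \<nu> (\<nu> (u0, v0)) \<bar>a\<bar> \<bar>b\<bar> C z"
    have "weingarten_via I f f' g g' \<nu> C z"
      using natural_principal[OF *(3-6)] by (simp add: natural_principal_params_def)
    then have "weingarten_surface C z" unfolding weingarten_surface_def using * by blast
    with * strongly_regular_of_invariants[OF *(3,6)] show ?thesis unfolding \<nu>0 by blast
  qed
  moreover have "\<exists>T. motion T \<and> (\<forall>p\<in>D0. z' p = T (z p))"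
    if "(u0, v0) \<in> D0" "D0 \<subseteq> D" "weingarten_surface D0 z" "has_invariants f f' g g' \<nu> \<nu>0 \<bar>a\<bar> \<bar>b\<bar> D0 z"
      "weingarten_surface D0 z'" "has_invariants f f' g g' \<nu> \<nu>0 \<bar>a\<bar> \<bar>b\<bar> D0 z'" for D0 z z'
    using unique_up_to_motion[OF that(2,1) D0[OF that(3)] _ D0[OF that(5)]] that(4,6) unfolding \<nu>0 by blast
  moreover have "natural_principal_params I f f' g g' \<nu> D0 z"
    if "D0 \<subseteq> D" "weingarten_surface D0 z" "has_invariants f f' g g' \<nu> \<nu>0 \<bar>a\<bar> \<bar>b\<bar> D0 z" for D0 z
    using natural_principal[OF that(1) D0[OF that(2)]] that(3) unfolding \<nu>0 by blast
  ultimately show ?thesis by blast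
qed

end
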